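(* Let $g$ be a nonconstant complex valued step function on $\mathbb T$ with jumps only at rational multiples of $\pi$. Then for almost every $t\in\mathbb R$ the graphs of $x\mapsto|e^{it\partial_{xx}}g(x)|^2$ and $x\mapsto|e^{it\partial_{xx}}g(x)|$ have upper Minkowski dimension $\frac32$.
   Context: $\mathbb T=\mathbb R/2\pi\mathbb Z$. A step function is a function taking constant values on each of finitely many intervals partitioning $\mathbb T$. With $\widehat g(k)=\frac1{2\pi}\int_0^{2\pi}g(x)e^{-ikx}\,dx$, $e^{it\partial_{xx}}g=\sum_{k\in\mathbb Z}e^{-itk^2+ikx}\widehat g(k)$ (for almost every $t$ this is a continuous function of $x$, up to a.e. equality, and graphs are those of the continuous representative). The upper Minkowski dimension of a bounded set $E$ is $\limsup_{\epsilon\to0}\frac{\log\mathcal N(E,\epsilon)}{\log(1/\epsilon)}$, where $\mathcal N(E,\epsilon)$ is the minimum number of $\epsilon$-balls required to cover $E$. *)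

theory Defs
  imports "HOL-Analysis.Analysis"
begin

(* Functions on the circle R/2piZ are represented by 2pi-periodic functions on the real line. *)
definition periodic_2pi :: "(real \<Rightarrow> 'a) \<Rightarrow> bool" where
  "periodic_2pi f \<longleftrightarrow> (\<forall>x. f (x + 2 * pi) = f x)"

(* The base point a is free: every partition of the circle into finitely many nondegenerate
   arcs becomes a partition of some [a, a + 2pi) into nondegenerate intervals (cut at an interior
   point of an arc).  Intervals may be open, half-open or closed, but not reduced to a point: with
   singletons a function that is constant off a finite set could be nonconstant, although its
   evolution is that of a constant. *)
definition step_function :: "(real \<Rightarrow> complex) \<Rightarrow> bool" where
  "step_function g \<longleftrightarrow> periodic_2pi g \<and>
     (\<exists>a P. finite P \<and> partition_on {a..<a + 2 * pi} P \<and>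
        (\<forall>I\<in>P. is_interval I \<and> interior I \<noteq> {} \<and> g constant_on I))"

definition fourier_coeff :: "(real \<Rightarrow> complex) \<Rightarrow> int \<Rightarrow> complex" where
  "fourier_coeff g k = 1 / (2 * of_real pi) *
     (LINT x:{0..2 * pi}|lborel. g x * exp (- \<i> * of_int k * of_real x))"

(* u is a representative of exp(i t d_xx) g; the series over all integers k is
   understood as an (unordered) sum in L2 of the circle. *)
definition schrodinger_evolution ::
    "(real \<Rightarrow> complex) \<Rightarrow> real \<Rightarrow> (real \<Rightarrow> complex) \<Rightarrow> bool" where
  "schrodinger_evolution g t u \<longleftrightarrow>
     periodic_2pi u \<and> u \<in> borel_measurable borel \<and>
     set_integrable lborel {0..2 * pi} (\<lambda>x. (cmod (u x))\<^sup>2) \<and>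
     ((\<lambda>K. LINT x:{0..2 * pi}|lborel.
         (cmod (u x - (\<Sum>k\<in>K. exp (- \<i> * of_real t * (of_int k)\<^sup>2 + \<i> * of_int k * of_real x)
                               * fourier_coeff g k)))\<^sup>2)
       \<longlongrightarrow> 0) (finite_subsets_at_top (UNIV :: int set))"

(* Over one full period; for periodic f this is the graph over the circle, cut open. *)
definition period_graph :: "(real \<Rightarrow> real) \<Rightarrow> (real \<times> real) set" where
  "period_graph f = (\<lambda>x. (x, f x)) ` {0..2 * pi}"

(* Meaningful for totally bounded E, in particular for bounded subsets of the plane. *)
definition covering_number :: "'a::metric_space set \<Rightarrow> real \<Rightarrow> nat" where
  "covering_number E \<epsilon> =
     (LEAST n. \<exists>C. finite C \<and> card C = n \<and> E \<subseteq> (\<Union>c\<in>C. ball c \<epsilon>))"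

definition upper_minkowski_dim :: "'a::metric_space set \<Rightarrow> ereal" where
  "upper_minkowski_dim E =
     Limsup (at_right 0) (\<lambda>\<epsilon>. ereal (ln (real (covering_number E \<epsilon>)) / ln (1 / \<epsilon>)))"

end

theory Submission
  imports Defs "HOL-Real_Asymp.Real_Asymp"
begin

text \<open>
  Let \<open>u\<close> be the solution at time \<open>t\<close>. A step function with jumps \<open>J j\<close> at points \<open>x j\<close>
  has, for \<open>k \<noteq> 0\<close>, the Fourier coefficients \<open>(\<Sum>j. J j * cis (- k * x j)) / (2 * pi * \<i> * k)\<close>.
  Both halves of the proof rest on this formula.

  Dimension at most \<open>3/2\<close>. By the formula, \<open>u\<close> is a constant plus a finite combination of
  translates and reflections of the single series \<open>\<Sum>k\<ge>1. cis (k * x - k\<^sup>2 * t) / k\<close>. Weyl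
  differencing bounds the square of the exponential sum of length \<open>N\<close>, uniformly in \<open>x\<close>, by
  \<open>N + 2 * (\<Sum>h\<in>{1..<N}. min N (1 / \<bar>sin (h * t)\<bar>))\<close>. The mean of this over \<open>t\<close> is \<open>N\<close> up to a
  logarithm, so the exponential sum is \<open>O(N powr (1/2 + e))\<close> for almost every \<open>t\<close>
  (\<open>AE_weyl_bounded\<close>). Then the tails of the series are small by summation by parts, and the
  partial sums have a derivative that is again the exponential sum; cutting the series at
  \<open>1 / \<bar>x - y\<bar>\<close> shows that \<open>u\<close> is Hoelder continuous of every order below \<open>1/2\<close>
  (\<open>weyl_limit_holder\<close>). The graph of a Hoelder function of order \<open>a\<close> has dimension at most
  \<open>2 - a\<close>.

  Dimension at least \<open>3/2\<close>. If the graph of a continuous \<open>v\<close> is covered by \<open>n\<close> balls of radius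
  \<open>h\<close>, then \<open>\<integral>\<bar>v (x + h) - v x\<bar> dx \<le> 8 * h\<^sup>2 * n\<close>, by the intermediate value theorem. Multiplied
  with the Hoelder bound, a dimension below \<open>3/2\<close> would make the square integral of the increments
  \<open>O(h powr (1 + \<delta>))\<close> with some \<open>\<delta> > 0\<close> (\<open>upper_dim_ge_of_increments\<close>). The increments of \<open>\<bar>u\<bar>\<^sup>2\<close>
  violate this, and since \<open>\<bar>u\<bar>\<^sup>2\<close> is a Lipschitz function of the bounded function \<open>\<bar>u\<bar>\<close>, so do
  those of \<open>\<bar>u\<bar>\<close>. Indeed, let all jumps lie in the multiples of \<open>2 * pi / q\<close>, and let \<open>q\<close> divide
  \<open>m\<close>. Then the coefficient of \<open>\<bar>u\<bar>\<^sup>2\<close> at \<open>m\<close> has modulus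
  \<open>\<bar>1 - cis (2 * m\<^sup>2 * t)\<bar> * \<bar>H (2 * m * t)\<bar> / (4 * pi\<^sup>2 * m)\<close>, where \<open>H\<close> is a periodic step function
  that jumps at \<open>0\<close> by a multiple of \<open>\<Sum>j. \<bar>J j\<bar>\<^sup>2\<close> and hence is a nonzero constant on one of the
  two arcs of length \<open>2 * pi / q\<close> at \<open>0\<close> (\<open>intensity_coeff_tendsto\<close>,
  \<open>autocorrelation_series_tendsto\<close>). When \<open>t / pi\<close> is irrational, both factors are bounded below
  for a set of \<open>m\<close> with bounded gaps (\<open>syndetic_good_multiples\<close>). So the squared coefficients with
  \<open>M \<le> m \<le> 2 * M\<close> add up to at least a constant over \<open>M\<close>, and Bessel's inequality with
  \<open>h = 1 / M\<close> bounds the square integral of the increments below by a constant times \<open>h\<close>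
  (\<open>increments_lower_bound\<close>).
\<close>

section \<open>Quadratic Weyl sums at almost every time\<close>

lemma norm_geometric_cis_le:
  assumes "sin (\<theta> / 2) \<noteq> 0"
  shows "norm (\<Sum>l\<in>{1..n::nat}. cis (real l * \<theta>)) \<le> 1 / \<bar>sin (\<theta> / 2)\<bar>"
proof -
  have n1: "norm (1 - cis \<theta>) = 2 * \<bar>sin (\<theta> / 2)\<bar>"
  proof -
    have "(norm (1 - cis \<theta>))\<^sup>2 = 2 - 2 * cos \<theta>"
      using sin_cos_squared_add[of \<theta>] unfolding cmod_power2 by (simp add: power2_diff)
    also have "\<dots> = (2 * \<bar>sin (\<theta> / 2)\<bar>)\<^sup>2"
      using cos_double_sin[of "\<theta>/2"] by (simp add: power_mult_distrib)
    finally have "(norm (1 - cis \<theta>))\<^sup>2 = (2 * \<bar>sin (\<theta> / 2)\<bar>)\<^sup>2" .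
    then show ?thesis by (smt (verit, best) norm_ge_zero power2_eq_iff_nonneg)
  qed
  have ne: "cis \<theta> \<noteq> 1" using n1 assms by auto
  have "(\<Sum>l\<in>{1..n}. cis (real l * \<theta>)) = (\<Sum>l\<in>{1..n}. cis \<theta> ^ l)"
    by (intro sum.cong refl) (simp only: Complex.DeMoivre)
  also have "\<dots> = (cis \<theta> - cis \<theta> ^ Suc n) / (1 - cis \<theta>)"
    using ne by (cases "n = 0") (auto simp: sum_gp)
  finally have "norm (\<Sum>l\<in>{1..n}. cis (real l * \<theta>)) = norm (cis \<theta> - cis \<theta> ^ Suc n) / norm (1 - cis \<theta>)"
    by (simp add: norm_divide)
  also have "\<dots> \<le> 2 / norm (1 - cis \<theta>)"
    by (intro divide_right_mono order_trans[OF norm_triangle_ineq4]) (auto simp: norm_mult norm_power)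
  also have "\<dots> = 1 / \<bar>sin (\<theta> / 2)\<bar>" using n1 by simp
  finally show ?thesis .
qed

lemma triangle_sum_by_difference:
  fixes F :: "nat \<Rightarrow> nat \<Rightarrow> 'a::comm_monoid_add"
  shows "(\<Sum>k\<in>{1..N}. \<Sum>l\<in>{1..<k}. F k l) = (\<Sum>h\<in>{1..<N}. \<Sum>l\<in>{1..N-h}. F (l + h) l)"
  unfolding sum.Sigma[OF finite_atLeastAtMost ballI[OF finite_atLeastLessThan]] 
    sum.Sigma[OF finite_atLeastLessThan ballI[OF finite_atLeastAtMost]]
  by (rule sum.reindex_bij_witness[where i="\<lambda>(h,l). (l + h, l)" and j="\<lambda>(k,l). (k - l, l)"]) auto

lemma cmod_add_squared: "(cmod (a + b))\<^sup>2 = (cmod a)\<^sup>2 + (cmod b)\<^sup>2 + 2 * Re (b * cnj a)"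
  unfolding cmod_power2 by (simp add: power2_eq_square algebra_simps)

lemma norm_sum_unimodular_squared:
  fixes w :: "nat \<Rightarrow> complex"
  assumes "\<And>k. norm (w k) = 1"
  shows "(norm (\<Sum>k\<in>{1..N}. w k))\<^sup>2 = real N + 2 * Re (\<Sum>k\<in>{1..N}. \<Sum>l\<in>{1..<k}. w k * cnj (w l))"
proof (induction N)
  case (Suc N)
  let ?S = "\<Sum>k\<in>{1..N}. w k"
  have "(norm (?S + w (Suc N)))\<^sup>2 = (norm ?S)\<^sup>2 + (norm (w (Suc N)))\<^sup>2 + 2 * Re (w (Suc N) * cnj ?S)"
    by (rule cmod_add_squared)
  moreover have "w (Suc N) * cnj ?S = (\<Sum>l\<in>{1..<Suc N}. w (Suc N) * cnj (w l))"
    by (simp add: sum_distrib_left atLeastLessThanSuc_atLeastAtMost)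
  ultimately have "(norm (\<Sum>k\<in>{1..Suc N}. w k))\<^sup>2 = (norm ?S)\<^sup>2 + 1 + 2 * Re (\<Sum>l\<in>{1..<Suc N}. w (Suc N) * cnj (w l))"
    using assms by (simp only: sum.cl_ivl_Suc) simp
  then show ?case unfolding Suc.IH
    by (simp del: Re_sum sum.op_ivl_Suc)
qed simp

definition weyl_sum :: "real \<Rightarrow> nat \<Rightarrow> real \<Rightarrow> complex" where
  "weyl_sum t N x = (\<Sum>k\<in>{1..N}. cis (real k * x - (real k)\<^sup>2 * t))"

text \<open>
  The correlations \<open>w (l + h) * cnj (w l)\<close> of a quadratic phase form a geometric progression in
  \<open>l\<close>, whose ratio depends on \<open>h * t\<close> but not on \<open>x\<close>; this is why the bound is uniform in \<open>x\<close>.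
  Each such sum is at most \<open>N\<close> and at most \<open>1 / \<bar>sin (h * t)\<bar>\<close>, hence at most any weighted
  geometric mean of the two, and with the weight \<open>e\<close> that mean is integrable in \<open>t\<close>.
\<close>

lemma weyl_differencing:
  assumes "\<And>h::nat. h \<ge> 1 \<Longrightarrow> sin (real h * t) \<noteq> 0" and e: "0 < e" "e < 1"
  shows "(norm (weyl_sum t N x))\<^sup>2 \<le> real N + 2 * (\<Sum>h\<in>{1..<N}. real N powr e * \<bar>sin (real h * t)\<bar> powr (e - 1))"
proof -
  define w where "w k = cis (real k * x - (real k)\<^sup>2 * t)" for k :: nat
  have "norm (\<Sum>l\<in>{1..N-h}. w (l + h) * cnj (w l)) \<le> real N powr e * \<bar>sin (real h * t)\<bar> powr (e - 1)"
    if h: "h \<in> {1..<N}" for h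
  proof -
    have "w (l + h) * cnj (w l) = cis (real h * x - (real h)\<^sup>2 * t) * cis (real l * (- 2 * real h * t))" for l
      unfolding w_def cis_cnj cis_mult by (simp add: power2_eq_square algebra_simps)
    then have eq: "norm (\<Sum>l\<in>{1..N-h}. w (l + h) * cnj (w l)) = norm (\<Sum>l\<in>{1..N-h}. cis (real l * (- 2 * real h * t)))"
      by (simp add: sum_distrib_left[symmetric] norm_mult)
    define A where "A = norm (\<Sum>l\<in>{1..N-h}. cis (real l * (- 2 * real h * t)))"
    have s: "\<bar>sin (real h * t)\<bar> > 0" using assms(1) h by auto
    have A1: "A \<le> real N" unfolding A_def by (rule order_trans[OF norm_sum]) simp
    have A2: "A \<le> 1 / \<bar>sin (real h * t)\<bar>"
      using norm_geometric_cis_le[of "- 2 * real h * t" "N - h"] s unfolding A_def by simp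
    have A0: "A \<ge> 0" unfolding A_def by simp
    have "A = A powr e * A powr (1 - e)" using A0 by (simp flip: powr_add)
    also have "\<dots> \<le> real N powr e * (1 / \<bar>sin (real h * t)\<bar>) powr (1 - e)"
      using A0 A1 A2 e by (intro mult_mono powr_mono2) auto
    also have "(1 / \<bar>sin (real h * t)\<bar>) powr (1 - e) = \<bar>sin (real h * t)\<bar> powr (e - 1)"
      using s by (simp add: powr_divide powr_diff field_simps)
    finally show ?thesis using eq A_def by simp
  qed
  then have "Re (\<Sum>k\<in>{1..N}. \<Sum>l\<in>{1..<k}. w k * cnj (w l)) \<le> (\<Sum>h\<in>{1..<N}. real N powr e * \<bar>sin (real h * t)\<bar> powr (e - 1))"
    unfolding triangle_sum_by_difference
    by (intro order_trans[OF complex_Re_le_cmod] sum_norm_le)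
  moreover have "norm (w k) = 1" for k by (simp add: w_def)
  ultimately show ?thesis using norm_sum_unimodular_squared[of w N]
    unfolding weyl_sum_def w_def by simp
qed

lemma sin_ge_half:
  assumes "0 \<le> x" "x \<le> pi / 2" shows "sin x \<ge> x / 2"
proof (cases "x \<le> pi / 3")
  case True
  have "((\<lambda>x. sin x - x / 2) has_real_derivative (cos y - 1/2)) (at y)" for y
    by (auto intro!: derivative_eq_intros)
  moreover have "cos y - 1/2 \<ge> 0" if "0 \<le> y" "y \<le> x" for y
    using cos_monotone_0_pi_le[of y "pi/3"] that True assms by (simp add: cos_60)
  ultimately have "sin 0 - 0 / 2 \<le> sin x - x / 2"
    using DERIV_nonneg_imp_nondecreasing[of 0 x "\<lambda>x. sin x - x / 2"] assms by metis
  then show ?thesis by simp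
next
  case False
  then have "sin x \<ge> sin (pi/3)" using assms by (intro sin_monotone_2pi_le) auto
  moreover have "sqrt 3 \<ge> 1.7" by (rule real_le_rsqrt) (simp add: power2_eq_square)
  ultimately show ?thesis using assms pi_less_4 pi_approx by (simp add: sin_60)
qed

definition sin_power_integral :: "real \<Rightarrow> ennreal" where
  "sin_power_integral a = (\<integral>\<^sup>+t. ennreal (\<bar>sin t\<bar> powr a) * indicator {0..pi} t \<partial>lborel)"

lemma sin_power_integral_finite:
  assumes "-1 < a" "a < 0"
  shows "sin_power_integral a < \<infinity>"
proof -
  let ?f = "\<lambda>x. ennreal (2 powr (-a) * x powr a) * indicator {0..pi} x"
  have fin: "(\<integral>\<^sup>+x. ?f x \<partial>lborel) < \<infinity>"
  proof -
    have "((\<lambda>x. 2 powr (-a) * x powr a) has_integral (2 powr (-a) * (pi powr (a + 1) / (a + 1)))) {0..pi}"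
      using assms by (intro has_integral_mult_right has_integral_powr_from_0) auto
    from nn_integral_has_integral_lebesgue'[OF _ this] show ?thesis by simp
  qed
  have "ennreal (\<bar>sin t\<bar> powr a) * indicator {0..pi} t \<le> ?f t + ?f (pi - t)" for t
  proof (cases "t \<in> {0<..<pi}")
    case True
    have *: "\<bar>sin s\<bar> powr a \<le> 2 powr (-a) * s powr a" if "0 < s" "s \<le> pi / 2" for s
    proof -
      have "\<bar>sin s\<bar> powr a \<le> (s / 2) powr a"
        using sin_ge_half[of s] that assms by (intro powr_mono2') auto
      also have "\<dots> = 2 powr (-a) * s powr a"
        using that by (simp add: powr_divide powr_minus field_simps)
      finally show ?thesis .
    qed
    show ?thesis
    proof (cases "t \<le> pi / 2")
      case True
      then have "ennreal (\<bar>sin t\<bar> powr a) * indicator {0..pi} t \<le> ?f t"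
        using * \<open>t \<in> {0<..<pi}\<close> by (auto intro!: ennreal_leI)
      then show ?thesis by (simp add: add_increasing2)
    next
      case False
      then have "ennreal (\<bar>sin t\<bar> powr a) * indicator {0..pi} t \<le> ?f (pi - t)"
        using *[of "pi - t"] \<open>t \<in> {0<..<pi}\<close> by (auto intro!: ennreal_leI)
      then show ?thesis by (simp add: add_increasing)
    qed
  next
    case False
    then show ?thesis by (auto simp: indicator_def)
  qed
  then have "sin_power_integral a \<le> (\<integral>\<^sup>+t. ?f t + ?f (pi - t) \<partial>lborel)"
    unfolding sin_power_integral_def by (intro nn_integral_mono)
  also have "\<dots> = (\<integral>\<^sup>+t. ?f t \<partial>lborel) + (\<integral>\<^sup>+t. ?f (pi - t) \<partial>lborel)"
    by (intro nn_integral_add) auto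
  also have "(\<integral>\<^sup>+t. ?f (pi - t) \<partial>lborel) = (\<integral>\<^sup>+t. ?f t \<partial>lborel)"
    using nn_integral_real_affine[of ?f "-1" pi] by simp
  finally show ?thesis using fin by (auto elim!: le_less_trans simp: ennreal_add_less_top)
qed

lemma abs_sin_shift: "\<bar>sin (of_int m * pi + t)\<bar> = \<bar>sin t\<bar>"
proof -
  have "sin (of_int m * pi) = 0" "\<bar>cos (of_int m * pi)\<bar> = 1"
    using sin_zero_iff_int2 sin_zero_abs_cos_one by blast+
  then show ?thesis by (simp add: sin_add abs_mult)
qed

lemma sin_power_integral_periods:
  "(\<integral>\<^sup>+t. ennreal (\<bar>sin t\<bar> powr a) * indicator {of_int m * pi..of_int m * pi + real n * pi} t \<partial>lborel)
    \<le> of_nat n * sin_power_integral a"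
proof (induction n)
  case 0
  have "(\<integral>\<^sup>+t. ennreal (\<bar>sin t\<bar> powr a) * indicator {of_int m * pi} t \<partial>lborel) = 0"
    by (subst nn_integral_indicator_singleton) auto
  then show ?case by simp
next
  case (Suc n)
  let ?f = "\<lambda>t. ennreal (\<bar>sin t\<bar> powr a)"
  let ?c = "of_int (m + int n) * pi"
  have "(\<integral>\<^sup>+t. ?f t * indicator {of_int m * pi..of_int m * pi + real (Suc n) * pi} t \<partial>lborel)
     \<le> (\<integral>\<^sup>+t. ?f t * indicator {of_int m * pi..of_int m * pi + real n * pi} t + ?f t * indicator {?c..?c + pi} t \<partial>lborel)"
    by (intro nn_integral_mono) (auto simp: indicator_def algebra_simps)
  also have "\<dots> = (\<integral>\<^sup>+t. ?f t * indicator {of_int m * pi..of_int m * pi + real n * pi} t \<partial>lborel)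
     + (\<integral>\<^sup>+t. ?f t * indicator {?c..?c + pi} t \<partial>lborel)"
    by (intro nn_integral_add) auto
  also have "(\<integral>\<^sup>+t. ?f t * indicator {?c..?c + pi} t \<partial>lborel) = sin_power_integral a"
  proof -
    have "(\<integral>\<^sup>+t. ?f t * indicator {?c..?c + pi} t \<partial>lborel) = (\<integral>\<^sup>+t. ?f (?c + t) * indicator {?c..?c + pi} (?c + t) \<partial>lborel)"
      using nn_integral_real_affine[of "\<lambda>t. ?f t * indicator {?c..?c + pi} t" 1 ?c] by simp
    also have "\<dots> = sin_power_integral a" unfolding sin_power_integral_def abs_sin_shift
      by (intro nn_integral_cong) (auto simp: indicator_def)
    finally show ?thesis .
  qed
  also note add_right_mono[OF Suc.IH]
  finally show ?case by (simp add: distrib_right add.commute)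
qed

text \<open>
  Dilating by an integer preserves the mean of a periodic function, so the bound is uniform in
  \<open>h\<close>.
\<close>

lemma sin_power_integral_dilate:
  assumes "h \<ge> (1::nat)"
  shows "(\<integral>\<^sup>+t. ennreal (\<bar>sin (real h * t)\<bar> powr a) * indicator {of_int j * pi..of_int j * pi + pi} t \<partial>lborel)
    \<le> sin_power_integral a"
proof -
  define m where "m = int h * j"
  let ?g = "\<lambda>t. ennreal (\<bar>sin t\<bar> powr a) * indicator {of_int m * pi..of_int m * pi + real h * pi} t"
  have h: "real h > 0" using assms by simp
  have "(\<integral>\<^sup>+t. ennreal (\<bar>sin (real h * t)\<bar> powr a) * indicator {of_int j * pi..of_int j * pi + pi} t \<partial>lborel)
      = (\<integral>\<^sup>+t. ?g (0 + real h * t) \<partial>lborel)"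
  proof (intro nn_integral_cong)
    fix t
    have "real h * t \<in> {of_int m * pi..of_int m * pi + real h * pi} \<longleftrightarrow> t \<in> {of_int j * pi..of_int j * pi + pi}"
      using mult_le_cancel_left_pos[OF h, of "of_int j * pi" t] mult_le_cancel_left_pos[OF h, of t "of_int j * pi + pi"]
      by (simp add: m_def algebra_simps)
    then show "ennreal (\<bar>sin (real h * t)\<bar> powr a) * indicator {of_int j * pi..of_int j * pi + pi} t = ?g (0 + real h * t)"
      by (simp add: indicator_def)
  qed
  also have "\<dots> = ennreal (1 / real h) * (ennreal (real h) * (\<integral>\<^sup>+t. ?g (0 + real h * t) \<partial>lborel))"
    using h by (simp flip: mult.assoc ennreal_mult')
  also have "ennreal (real h) * (\<integral>\<^sup>+t. ?g (0 + real h * t) \<partial>lborel) = (\<integral>\<^sup>+t. ?g t \<partial>lborel)"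
    using nn_integral_real_affine[of ?g "real h" 0] h by simp
  also have "ennreal (1 / real h) * \<dots> \<le> ennreal (1 / real h) * (of_nat h * sin_power_integral a)"
    by (intro mult_left_mono sin_power_integral_periods) auto
  also have "\<dots> = sin_power_integral a"
    using h by (simp add: ennreal_of_nat_eq_real_of_nat flip: mult.assoc ennreal_mult')
  finally show ?thesis .
qed

text \<open>
  A series of nonnegative functions whose integrals have a finite sum converges almost everywhere.
  One convergent series at each \<open>t\<close> controls the differenced sums of all lengths at once.
\<close>

lemma AE_summable_sin_power:
  assumes e: "0 < e" "e < 1"
  shows "AE t in lborel. summable (\<lambda>h. real (Suc h) powr (- 1 - e) * \<bar>sin (real (Suc h) * t)\<bar> powr (e - 1))"
proof -
  define f where "f h t = real (Suc h) powr (- 1 - e) * \<bar>sin (real (Suc h) * t)\<bar> powr (e - 1)" for h t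
  have f0: "f h t \<ge> 0" for h t by (simp add: f_def)
  have *: "AE t in lborel. t \<in> {of_int j * pi..of_int j * pi + pi} \<longrightarrow> summable (\<lambda>h. f h t)" for j
  proof -
    let ?I = "{of_int j * pi..of_int j * pi + pi}"
    have [measurable]: "f h \<in> borel_measurable borel" for h unfolding f_def by measurable
    have sm: "summable (\<lambda>h. real (Suc h) powr (- 1 - e))"
      using e by (subst summable_Suc_iff) (simp add: summable_real_powr_iff)
    have "(\<integral>\<^sup>+t. (\<Sum>h. ennreal (f h t) * indicator ?I t) \<partial>lborel) = (\<Sum>h. \<integral>\<^sup>+t. ennreal (f h t) * indicator ?I t \<partial>lborel)"
      by (intro nn_integral_suminf) measurable
    also have "\<dots> \<le> (\<Sum>h. ennreal (real (Suc h) powr (- 1 - e)) * sin_power_integral (e - 1))"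
    proof (intro suminf_le summableI)
      fix h
      have "(\<integral>\<^sup>+t. ennreal (f h t) * indicator ?I t \<partial>lborel)
        = (\<integral>\<^sup>+t. ennreal (real (Suc h) powr (- 1 - e)) * (ennreal (\<bar>sin (real (Suc h) * t)\<bar> powr (e - 1)) * indicator ?I t) \<partial>lborel)"
        unfolding f_def by (intro nn_integral_cong) (simp add: ennreal_mult mult.assoc)
      also have "\<dots> = ennreal (real (Suc h) powr (- 1 - e)) * (\<integral>\<^sup>+t. ennreal (\<bar>sin (real (Suc h) * t)\<bar> powr (e - 1)) * indicator ?I t \<partial>lborel)"
        by (intro nn_integral_cmult) measurable
      also have "\<dots> \<le> ennreal (real (Suc h) powr (- 1 - e)) * sin_power_integral (e - 1)"
        by (intro mult_left_mono sin_power_integral_dilate) auto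
      finally show "(\<integral>\<^sup>+t. ennreal (f h t) * indicator ?I t \<partial>lborel) \<le> ennreal (real (Suc h) powr (- 1 - e)) * sin_power_integral (e - 1)" .
    qed
    also have "\<dots> = (\<Sum>h. ennreal (real (Suc h) powr (- 1 - e))) * sin_power_integral (e - 1)"
      by (rule ennreal_suminf_multc)
    also have "\<dots> < \<infinity>"
      using sm sin_power_integral_finite[of "e - 1"] e
      by (subst suminf_ennreal_eq[OF _ summable_sums]) (auto intro!: ennreal_mult_less_top[THEN iffD2])
    finally have "AE t in lborel. (\<Sum>h. ennreal (f h t) * indicator ?I t) \<noteq> \<infinity>"
      by (intro nn_integral_PInf_AE) auto
    then show ?thesis
    proof eventually_elim
      case (elim t)
      show ?case
      proof
        assume t: "t \<in> ?I"
        then have "(\<Sum>h. ennreal (f h t)) \<noteq> \<infinity>" using elim by simp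
        then show "summable (\<lambda>h. f h t)" using f0 by (intro summable_suminf_not_top) auto
      qed
    qed
  qed
  have "AE t in lborel. \<forall>j::int. t \<in> {of_int j * pi..of_int j * pi + pi} \<longrightarrow> summable (\<lambda>h. f h t)"
    using * by (subst AE_all_countable) auto
  then show ?thesis
  proof eventually_elim
    case (elim t)
    define n where "n = \<lfloor>t / pi\<rfloor>"
    have "of_int n \<le> t / pi" "t / pi \<le> of_int n + 1" unfolding n_def by linarith+
    then have "t \<in> {of_int n * pi..of_int n * pi + pi}"
      by (simp add: pos_divide_le_eq pos_le_divide_eq distrib_right)
    then show ?case using elim unfolding f_def by blast
  qed
qed

text \<open>
  Square root cancellation, up to an arbitrarily small power, that is uniform in \<open>x\<close>.
\<close>

definition weyl_bounded :: "real \<Rightarrow> bool" where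
  "weyl_bounded t \<longleftrightarrow> (\<forall>e>0. \<exists>C. \<forall>N x. norm (weyl_sum t N x) \<le> C * real N powr (1 / 2 + e))"

lemma AE_irrational_multiple_pi: "AE t in lborel. t / pi \<notin> \<rat>"
proof -
  have "countable ((\<lambda>q. q * pi) ` \<rat>)" using countable_rat by blast
  then have "AE t in lborel. t \<notin> (\<lambda>q. q * pi) ` \<rat>"
    by (intro AE_not_in countable_imp_null_set_lborel)
  then show ?thesis
  proof eventually_elim
    case (elim t)
    have "t = (t / pi) * pi" by simp
    with elim show ?case by blast
  qed
qed

lemma irrational_sin_nonzero:
  assumes "t / pi \<notin> \<rat>" "h \<noteq> (0::int)" shows "sin (of_int h * t) \<noteq> 0"
proof
  assume "sin (of_int h * t) = 0"
  then obtain i :: int where "of_int h * t = of_int i * pi" using sin_zero_iff_int2 by blast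
  then have "t / pi = of_int i / of_int h" using assms(2) by (simp add: field_simps)
  then show False using assms(1) by simp
qed

lemma AE_weyl_bounded: "AE t in lborel. weyl_bounded t"
proof -
  have "AE t in lborel. \<forall>n::nat. summable (\<lambda>h. real (Suc h) powr (- 1 - 1 / real (n + 2)) * \<bar>sin (real (Suc h) * t)\<bar> powr (1 / real (n + 2) - 1))"
    by (subst AE_all_countable) (intro allI AE_summable_sin_power, auto)
  with AE_irrational_multiple_pi show ?thesis
  proof eventually_elim
    case (elim t)
    show ?case unfolding weyl_bounded_def
    proof (intro allI impI)
      fix e0 :: real assume "e0 > 0"
      obtain n :: nat where "1 / e0 < real n" using reals_Archimedean2 by blast
      then have n: "1 / real (n + 2) < e0" using \<open>e0 > 0\<close> by (simp add: field_simps add_strict_increasing)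
      define e where "e = 1 / real (n + 2)"
      have e: "0 < e" "e < 1" "e < e0" using n by (auto simp: e_def)
      define f where "f h = real (Suc h) powr (- 1 - e) * \<bar>sin (real (Suc h) * t)\<bar> powr (e - 1)" for h
      have sm: "summable f" using elim(2) unfolding f_def e_def by blast
      have f0: "f h \<ge> 0" for h by (simp add: f_def)
      define S where "S = suminf f"
      have S0: "S \<ge> 0" unfolding S_def using sm f0 by (intro suminf_nonneg) auto
      have main: "(norm (weyl_sum t N x))\<^sup>2 \<le> (1 + 2 * S) * real N powr (1 + 2 * e)" if N: "N \<ge> 1" for N x
      proof -
        have "(norm (weyl_sum t N x))\<^sup>2 \<le> real N + 2 * (\<Sum>h\<in>{1..<N}. real N powr e * \<bar>sin (real h * t)\<bar> powr (e - 1))"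
          using irrational_sin_nonzero[OF elim(1), of "int h" for h] e
          by (intro weyl_differencing) auto
        also have "(\<Sum>h\<in>{1..<N}. real N powr e * \<bar>sin (real h * t)\<bar> powr (e - 1)) \<le> (\<Sum>h\<in>{1..<N}. real N powr (1 + 2 * e) * f (h - 1))"
        proof (intro sum_mono)
          fix h assume h: "h \<in> {1..<N}"
          have "real N powr e \<le> real N powr e * (real N powr (1 + e) * real h powr (- 1 - e))"
          proof -
            have "real h powr (1 + e) \<le> real N powr (1 + e)" using h e by (intro powr_mono2) auto
            moreover have "real h powr (1 + e) * real h powr (- 1 - e) = 1" using h by (simp flip: powr_add)
            ultimately have "1 \<le> real N powr (1 + e) * real h powr (- 1 - e)"
              by (metis mult_right_mono powr_ge_zero)
            then show ?thesis by (simp add: mult_le_cancel_left1)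
          qed
          then have "real N powr e * \<bar>sin (real h * t)\<bar> powr (e - 1) \<le> real N powr e * (real N powr (1 + e) * real h powr (- 1 - e)) * \<bar>sin (real h * t)\<bar> powr (e - 1)"
            by (intro mult_right_mono) auto
          also have "\<dots> = real N powr (1 + 2 * e) * f (h - 1)"
            proof -
            have "real N powr (1 + 2 * e) = real N powr e * real N powr (1 + e)"
              by (simp add: powr_add[symmetric] algebra_simps)
            then show ?thesis using h by (simp add: f_def)
          qed
          finally show "real N powr e * \<bar>sin (real h * t)\<bar> powr (e - 1) \<le> real N powr (1 + 2 * e) * f (h - 1)" .
        qed
        also have "\<dots> = real N powr (1 + 2 * e) * (\<Sum>h<N-1. f h)"
          unfolding sum_distrib_left
          by (rule sum.reindex_bij_witness[where i=Suc and j="\<lambda>h. h - 1"]) auto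
        also have "\<dots> \<le> real N powr (1 + 2 * e) * S"
          unfolding S_def using sm f0 by (intro mult_left_mono sum_le_suminf) auto
        finally have "(norm (weyl_sum t N x))\<^sup>2 \<le> real N powr 1 + 2 * (real N powr (1 + 2 * e) * S)" using N by simp
        also have "real N powr 1 \<le> real N powr (1 + 2 * e)" using N e by (intro powr_mono) auto
        finally show ?thesis by (simp add: algebra_simps)
      qed
      have "norm (weyl_sum t N x) \<le> sqrt (1 + 2 * S) * real N powr (1 / 2 + e0)" for N x
      proof (cases "N = 0")
        case True then show ?thesis by (simp add: weyl_sum_def)
      next
        case False
        then have "norm (weyl_sum t N x) \<le> sqrt ((1 + 2 * S) * real N powr (1 + 2 * e))"
          using main by (intro real_le_rsqrt) auto
        also have "\<dots> = sqrt (1 + 2 * S) * real N powr (1 / 2 + e)"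
          by (simp add: real_sqrt_mult powr_half_sqrt_powr[symmetric] add_divide_distrib)
        also have "\<dots> \<le> sqrt (1 + 2 * S) * real N powr (1 / 2 + e0)"
          using False e S0 by (intro mult_left_mono powr_mono) auto
        finally show ?thesis .
      qed
      then show "\<exists>C. \<forall>N x. norm (weyl_sum t N x) \<le> C * real N powr (1 / 2 + e0)" by blast
    qed
  qed
qed

section \<open>Graphs of functions and their dimension\<close>

definition holder_below_half :: "(real \<Rightarrow> 'a::real_normed_vector) \<Rightarrow> bool" where
  "holder_below_half f \<longleftrightarrow> (\<forall>a. 0 < a \<longrightarrow> a < 1 / 2 \<longrightarrow> 
     (\<exists>C. \<forall>x y. \<bar>x - y\<bar> \<le> 1 \<longrightarrow> norm (f x - f y) \<le> C * \<bar>x - y\<bar> powr a))"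

lemma holder_below_halfE:
  assumes "holder_below_half f" "0 < a" "a < 1 / 2"
  obtains C where "C \<ge> 0" "\<And>x y. \<bar>x - y\<bar> \<le> 1 \<Longrightarrow> norm (f x - f y) \<le> C * \<bar>x - y\<bar> powr a"
proof -
  obtain C where C: "\<And>x y. \<bar>x - y\<bar> \<le> 1 \<Longrightarrow> norm (f x - f y) \<le> C * \<bar>x - y\<bar> powr a"
    using assms unfolding holder_below_half_def by blast
  have "C \<ge> 0" using C[of 1 0] by (simp add: order_trans[OF norm_ge_zero])
  then show thesis using that C by blast
qed

lemma holder_below_half_continuous:
  assumes "holder_below_half f" shows "continuous_on UNIV f"
proof -
  obtain C where C: "C \<ge> 0" "\<And>x y. \<bar>x - y\<bar> \<le> 1 \<Longrightarrow> norm (f x - f y) \<le> C * \<bar>x - y\<bar> powr (1/4)"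
    by (rule holder_below_halfE[OF assms, of "1/4"]) auto
  have "(f \<longlongrightarrow> f x) (at x)" for x
  proof (rule LIM_zero_cancel, rule Lim_null_comparison)
    show "\<forall>\<^sub>F y in at x. norm (f y - f x) \<le> C * \<bar>y - x\<bar> powr (1/4)"
      using C(2) by (auto simp: eventually_at dist_real_def intro!: exI[of _ 1])
    have "((\<lambda>y. C * \<bar>y - x\<bar> powr (1/4)) \<longlongrightarrow> C * \<bar>x - x\<bar> powr (1/4)) (at x)"
      by (intro tendsto_intros) auto
    then show "((\<lambda>y. C * \<bar>y - x\<bar> powr (1/4)) \<longlongrightarrow> 0) (at x)" by simp
  qed
  then show ?thesis by (simp add: continuous_on_eq_continuous_at isCont_def)
qed

lemma card_floor_image_le:
  fixes S :: "real set" and r :: real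
  assumes "r > 0" "\<And>x y. x \<in> S \<Longrightarrow> y \<in> S \<Longrightarrow> \<bar>x - y\<bar> \<le> D" "D \<ge> 0"
  shows "finite ((\<lambda>x. \<lfloor>x / r\<rfloor>) ` S) \<and> real (card ((\<lambda>x. \<lfloor>x / r\<rfloor>) ` S)) \<le> 2 * D / r + 3"
proof (cases "S = {}")
  case False
  then obtain x where x: "x \<in> S" by blast
  have sub: "(\<lambda>x. \<lfloor>x / r\<rfloor>) ` S \<subseteq> {\<lfloor>(x - D) / r\<rfloor>..\<lfloor>(x + D) / r\<rfloor>}"
    using assms(1) assms(2)[OF x] by (auto intro!: floor_mono divide_right_mono) (smt (verit))+
  have "real (card ((\<lambda>x. \<lfloor>x / r\<rfloor>) ` S)) \<le> real (card {\<lfloor>(x - D) / r\<rfloor>..\<lfloor>(x + D) / r\<rfloor>})"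
    using sub by (intro of_nat_mono card_mono) auto
  also have "\<dots> = of_int (max 0 (\<lfloor>(x + D) / r\<rfloor> - \<lfloor>(x - D) / r\<rfloor> + 1))" by simp
  also have "\<dots> \<le> max 0 ((x + D) / r - (x - D) / r + 2)" by linarith
  also have "\<dots> = (x + D) / r - (x - D) / r + 2" using assms by (simp add: field_simps)
  also have "\<dots> = 2 * D / r + 2" by (simp add: add_divide_distrib diff_divide_distrib)
  finally show ?thesis using finite_subset[OF sub] by auto
qed (use assms in auto)

lemma floor_grid_dist:
  fixes x r :: real assumes "r > 0"
  shows "r * of_int \<lfloor>x / r\<rfloor> \<le> x" "x < r * of_int \<lfloor>x / r\<rfloor> + r"
proof -
  define n where "n = \<lfloor>x / r\<rfloor>"
  have "of_int n \<le> x / r" "x / r < of_int n + 1" unfolding n_def by linarith+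
  then have "r * of_int n \<le> x" "x < r * of_int n + r"
    using assms by (simp_all add: pos_le_divide_eq pos_divide_less_eq algebra_simps)
  then show "r * of_int \<lfloor>x / r\<rfloor> \<le> x" "x < r * of_int \<lfloor>x / r\<rfloor> + r" by (simp_all add: n_def)
qed

text \<open>
  The points of the graph are rounded down to the grid of mesh \<open>r\<close>. Over one column of the grid the
  function varies by at most \<open>C * r powr a\<close>, which bounds the number of grid points it is rounded
  to.
\<close>

lemma period_graph_cover:
  fixes f :: "real \<Rightarrow> real"
  assumes H: "\<And>x y. \<bar>x - y\<bar> \<le> 1 \<Longrightarrow> norm (f x - f y) \<le> C * \<bar>x - y\<bar> powr a" and a: "a > 0" and C: "C \<ge> 0"
    and r: "0 < r" "r \<le> 1"
  shows "\<exists>X. finite X \<and> real (card X) \<le> (16 / r + 3) * (2 * (C * r powr a) / r + 3) \<and> period_graph f \<subseteq> (\<Union>c\<in>X. ball c (3 * r))"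
proof -
  define fl where "fl x = \<lfloor>x / r\<rfloor>" for x
  note fld = floor_grid_dist[OF r(1), folded fl_def]
  define I where "I = fl ` {0..2 * pi}"
  have "finite I \<and> real (card I) \<le> 2 * (2 * pi) / r + 3"
    unfolding I_def fl_def using r by (intro card_floor_image_le) auto
  moreover have "2 * (2 * pi) / r \<le> 16 / r" using r pi_less_4 by (intro divide_right_mono) auto
  ultimately have I: "finite I" "real (card I) \<le> 16 / r + 3" by auto
  define S where "S i = f ` {x \<in> {0..2 * pi}. fl x = i}" for i
  have S: "finite (fl ` S i)" "real (card (fl ` S i)) \<le> 2 * (C * r powr a) / r + 3" for i
  proof -
    have "finite (fl ` S i) \<and> real (card (fl ` S i)) \<le> 2 * (C * r powr a) / r + 3"
      unfolding fl_def
    proof (rule card_floor_image_le)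
      fix u v assume "u \<in> S i" "v \<in> S i"
      then obtain x y where xy: "u = f x" "v = f y" "fl x = i" "fl y = i" by (auto simp: S_def)
      then have d: "\<bar>x - y\<bar> \<le> r" using fld[of x] fld[of y] by auto
      then have "norm (f x - f y) \<le> C * \<bar>x - y\<bar> powr a" using r by (intro H) auto
      also have "\<dots> \<le> C * r powr a" using d C a by (intro mult_left_mono powr_mono2) auto
      finally show "\<bar>u - v\<bar> \<le> C * r powr a" using xy by simp
    qed (use r C in auto)
    then show "finite (fl ` S i)" "real (card (fl ` S i)) \<le> 2 * (C * r powr a) / r + 3" by auto
  qed
  define X where "X = (\<Union>i\<in>I. (\<lambda>j. (r * of_int i, r * of_int j)) ` (fl ` S i))"
  have fX: "finite X" unfolding X_def using I S by blast
  have "real (card X) \<le> real (\<Sum>i\<in>I. card (fl ` S i))"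
    unfolding X_def by (intro of_nat_mono order_trans[OF card_UN_le[OF I(1)]] sum_mono card_image_le S)
  also have "\<dots> \<le> (\<Sum>i\<in>I. 2 * (C * r powr a) / r + 3)" unfolding of_nat_sum by (intro sum_mono S)
  also have "\<dots> = real (card I) * (2 * (C * r powr a) / r + 3)" by simp
  also have "\<dots> \<le> (16 / r + 3) * (2 * (C * r powr a) / r + 3)" using I r C by (intro mult_right_mono) auto
  finally have cX: "real (card X) \<le> (16 / r + 3) * (2 * (C * r powr a) / r + 3)" .
  have "period_graph f \<subseteq> (\<Union>c\<in>X. ball c (3 * r))"
  proof
    fix z assume "z \<in> period_graph f"
    then obtain x where x: "x \<in> {0..2 * pi}" "z = (x, f x)" by (auto simp: period_graph_def)
    define c where "c = (r * of_int (fl x), r * of_int (fl (f x)))"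
    have "c \<in> X" unfolding X_def c_def I_def S_def using x by blast
    moreover have "dist c z \<le> \<bar>r * of_int (fl x) - x\<bar> + \<bar>r * of_int (fl (f x)) - f x\<bar>"
      unfolding c_def x dist_Pair_Pair dist_real_def by (intro sqrt_sum_squares_le_sum) auto
    then have "dist c z < 3 * r" using fld[of x] fld[of "f x"] r by linarith
    ultimately show "z \<in> (\<Union>c\<in>X. ball c (3 * r))" by auto
  qed
  then show ?thesis using fX cX by blast
qed

lemma covering_number_le:
  assumes "finite X" "E \<subseteq> (\<Union>c\<in>X. ball c \<epsilon>)"
  shows "covering_number E \<epsilon> \<le> card X"
  unfolding covering_number_def using assms by (intro Least_le) blast

text \<open>
  Some finite cover is required, since otherwise the minimum in the covering number is a
  default value.
\<close>

lemma covering_number_attained: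
  assumes "finite X" "E \<subseteq> (\<Union>c\<in>X. ball c \<epsilon>)"
  obtains C where "finite C" "card C = covering_number E \<epsilon>" "E \<subseteq> (\<Union>c\<in>C. ball c \<epsilon>)"
  using LeastI_ex[of "\<lambda>n. \<exists>C. finite C \<and> card C = n \<and> E \<subseteq> (\<Union>c\<in>C. ball c \<epsilon>)"] assms
  unfolding covering_number_def by blast

lemma ereal_three_halves: "ereal (3 / 2) = 3 / 2"
  by (simp add: numeral_eq_ereal)

text \<open>
  A Hoelder function of order \<open>a\<close> needs \<open>O(\<epsilon> powr (a - 2))\<close> balls, and \<open>a\<close> can be taken arbitrarily
  close to \<open>1/2\<close>.
\<close>

lemma upper_dim_holder_le:
  fixes f :: "real \<Rightarrow> real"
  assumes "holder_below_half f"
  shows "upper_minkowski_dim (period_graph f) \<le> 3 / 2"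
proof -
  let ?q = "\<lambda>\<epsilon>. ln (real (covering_number (period_graph f) \<epsilon>)) / ln (1 / \<epsilon>)"
  have "upper_minkowski_dim (period_graph f) \<le> ereal (3 / 2 + \<eta>)" if \<eta>: "0 < \<eta>" "\<eta> < 1 / 2" for \<eta>
    unfolding upper_minkowski_dim_def
  proof (rule Limsup_bounded)
    \<comment> \<open>half of the margin \<open>\<eta>\<close> pays for the exponent, the other half for the constant \<open>K\<close>\<close>
    define a where "a = 1 / 2 - \<eta> / 2"
    have a: "0 < a" "a < 1 / 2" using \<eta> by (auto simp: a_def)
    obtain C where C: "C \<ge> 0" "\<And>x y. \<bar>x - y\<bar> \<le> 1 \<Longrightarrow> norm (f x - f y) \<le> C * \<bar>x - y\<bar> powr a"
      by (rule holder_below_halfE[OF assms a]) blast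
    define K where "K = 51 * (6 * C + 3)"
    have "((\<lambda>\<epsilon>. K * \<epsilon> powr (\<eta> / 2)) \<longlongrightarrow> K * 0 powr (\<eta> / 2)) (at_right 0)"
      using \<eta> by (intro tendsto_intros) (auto simp: eventually_at_right_less eventually_at_filter)
    then have "((\<lambda>\<epsilon>. K * \<epsilon> powr (\<eta> / 2)) \<longlongrightarrow> 0) (at_right 0)" by simp
    from order_tendstoD(2)[OF this, of 1] 
    have "\<forall>\<^sub>F \<epsilon> in at_right 0. K * \<epsilon> powr (\<eta> / 2) < 1" by simp
    moreover have "\<forall>\<^sub>F \<epsilon> in at_right (0::real). 0 < \<epsilon> \<and> \<epsilon> < 1"
      unfolding eventually_at_right_field by (intro exI[of _ 1]) auto
    ultimately show "\<forall>\<^sub>F \<epsilon> in at_right 0. ereal (?q \<epsilon>) \<le> ereal (3 / 2 + \<eta>)"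
    proof eventually_elim
      case (elim \<epsilon>)
      then have \<epsilon>: "0 < \<epsilon>" "\<epsilon> < 1" "K * \<epsilon> powr (\<eta> / 2) < 1" by auto
      define N where "N = covering_number (period_graph f) \<epsilon>"
      obtain X where X: "finite X" "real (card X) \<le> (16 / (\<epsilon>/3) + 3) * (2 * (C * (\<epsilon>/3) powr a) / (\<epsilon>/3) + 3)"
          "period_graph f \<subseteq> (\<Union>c\<in>X. ball c (3 * (\<epsilon>/3)))"
        using period_graph_cover[OF C(2) a(1) C(1), of "\<epsilon>/3"] \<epsilon> by auto
      have "real N \<le> (16 / (\<epsilon>/3) + 3) * (2 * (C * (\<epsilon>/3) powr a) / (\<epsilon>/3) + 3)"
        using covering_number_le[OF X(1), of "period_graph f" \<epsilon>] X by (simp add: N_def)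
      also have "\<dots> \<le> (51 / \<epsilon>) * ((6 * C + 3) * \<epsilon> powr a / \<epsilon>)"
      proof (rule mult_mono)
        show "16 / (\<epsilon>/3) + 3 \<le> 51 / \<epsilon>" using \<epsilon> by (simp add: field_simps)
        have "(\<epsilon>/3) powr a \<le> \<epsilon> powr a" using \<epsilon> a by (intro powr_mono2) auto
        then have "C * (\<epsilon>/3) powr a \<le> C * \<epsilon> powr a" using C by (intro mult_left_mono)
        moreover have "\<epsilon> powr 1 \<le> \<epsilon> powr a" using \<epsilon> a by (intro powr_mono') auto
        ultimately have "6 * (C * (\<epsilon>/3) powr a) + 3 * \<epsilon> \<le> (6 * C + 3) * \<epsilon> powr a" using \<epsilon> by (simp add: algebra_simps)
        from divide_right_mono[OF this, of \<epsilon>]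
        show "2 * (C * (\<epsilon>/3) powr a) / (\<epsilon>/3) + 3 \<le> (6 * C + 3) * \<epsilon> powr a / \<epsilon>" using \<epsilon> by (simp add: add_divide_distrib)
      qed (use \<epsilon> C in auto)
      also have "\<dots> = K * \<epsilon> powr (a - 2)" using \<epsilon> by (simp add: K_def powr_diff power2_eq_square)
      also have "\<dots> = (K * \<epsilon> powr (\<eta> / 2)) * \<epsilon> powr (- (3 / 2 + \<eta>))"
        by (simp add: mult.assoc flip: powr_add) (simp add: a_def field_simps)
      also have "\<dots> \<le> 1 * \<epsilon> powr (- (3 / 2 + \<eta>))" using \<epsilon> by (intro mult_right_mono) auto
      finally have N: "real N \<le> \<epsilon> powr (- (3 / 2 + \<eta>))" by simp
      have "ln (real N) \<le> (3 / 2 + \<eta>) * ln (1 / \<epsilon>)"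
      proof (cases "N = 0")
        case True
        moreover have "(3 / 2 + \<eta>) * ln \<epsilon> \<le> 0" using \<epsilon> \<eta> by (intro mult_nonneg_nonpos) auto
        ultimately show ?thesis using \<epsilon> by (simp add: ln_div)
      next
        case False
        then have "ln (real N) \<le> ln (\<epsilon> powr (- (3 / 2 + \<eta>)))" using N \<epsilon> by (subst ln_le_cancel_iff) auto
        then show ?thesis using \<epsilon> by (simp add: ln_powr ln_div algebra_simps)
      qed
      then show ?case using \<epsilon> by (simp add: N_def pos_divide_le_eq)
    qed
  qed
  note ub = this
  show ?thesis
  proof (rule ereal_le_epsilon2)
    fix e :: real assume "e > 0"
    define \<eta> where "\<eta> = min e (1/4)"
    have "upper_minkowski_dim (period_graph f) \<le> ereal (3 / 2 + \<eta>)" using \<open>e > 0\<close> by (intro ub) (auto simp: \<eta>_def)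
    also have "\<dots> \<le> ereal (3 / 2) + ereal e" by (simp add: \<eta>_def)
    also note ereal_three_halves
    finally show "upper_minkowski_dim (period_graph f) \<le> 3 / 2 + ereal e" .
  qed
qed

text \<open>
  Every value between \<open>v x\<close> and \<open>v (x + \<epsilon>)\<close> is attained over \<open>{x..x + \<epsilon>}\<close>, so the second
  coordinates of the balls near that vertical strip cover an interval as long as the increment.
\<close>

lemma increment_le_covering:
  fixes v :: "real \<Rightarrow> real"
  assumes v: "continuous_on UNIV v" and X: "finite X" "period_graph v \<subseteq> (\<Union>c\<in>X. ball c \<epsilon>)"
    and \<epsilon>: "\<epsilon> > 0" and x: "0 \<le> x" "x + \<epsilon> \<le> 2 * pi"
  shows "\<bar>v (x + \<epsilon>) - v x\<bar> \<le> (\<Sum>c\<in>X. 2 * \<epsilon> * indicator {fst c - 2 * \<epsilon>..fst c + 2 * \<epsilon>} x)"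
proof -
  define a where "a = min (v x) (v (x + \<epsilon>))"
  define b where "b = max (v x) (v (x + \<epsilon>))"
  define X' where "X' = {c \<in> X. x \<in> {fst c - 2 * \<epsilon>..fst c + 2 * \<epsilon>}}"
  have fX': "finite X'" using X by (simp add: X'_def)
  have "{a..b} \<subseteq> (\<Union>c\<in>X'. {snd c - \<epsilon>..snd c + \<epsilon>})"
  proof
    fix y assume y: "y \<in> {a..b}"
    have "connected (v ` {x..x + \<epsilon>})"
      by (intro connected_continuous_image continuous_on_subset[OF v]) auto
    moreover have "a \<in> v ` {x..x + \<epsilon>}" "b \<in> v ` {x..x + \<epsilon>}" using \<epsilon> by (auto simp: a_def b_def min_def max_def)
    ultimately have "y \<in> v ` {x..x + \<epsilon>}" using y by (auto simp: connected_iff_interval)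
    then obtain z where z: "z \<in> {x..x + \<epsilon>}" "y = v z" by blast
    then have "(z, y) \<in> period_graph v" using x by (auto simp: period_graph_def)
    then obtain c where c: "c \<in> X" "dist c (z, y) < \<epsilon>" using X by auto
    have "\<bar>fst c - z\<bar> < \<epsilon>" "\<bar>snd c - y\<bar> < \<epsilon>"
      using c(2) dist_fst_le[of c "(z,y)"] dist_snd_le[of c "(z,y)"] by (auto simp: dist_real_def)
    then show "y \<in> (\<Union>c\<in>X'. {snd c - \<epsilon>..snd c + \<epsilon>})"
      using c(1) z(1) by (intro UN_I[of c]) (auto simp: X'_def)
  qed
  then have "measure lborel {a..b} \<le> measure lborel (\<Union>c\<in>X'. {snd c - \<epsilon>..snd c + \<epsilon>})"
    using fX' by (intro measure_mono_fmeasurable fmeasurable.finite_UN) (auto simp: fmeasurable_def emeasure_lborel_Icc_eq)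
  also have "\<dots> \<le> (\<Sum>c\<in>X'. measure lborel {snd c - \<epsilon>..snd c + \<epsilon>})"
    using fX' by (intro measure_UNION_le) auto
  also have "measure lborel {a..b} = b - a" by (simp add: a_def b_def)
  also have "(\<Sum>c\<in>X'. measure lborel {snd c - \<epsilon>..snd c + \<epsilon>}) = (\<Sum>c\<in>X'. 2 * \<epsilon>)" using \<epsilon> by simp
  finally have "b - a \<le> (\<Sum>c\<in>X'. 2 * \<epsilon>)" .
  also have "\<dots> = (\<Sum>c\<in>X. 2 * \<epsilon> * indicator {fst c - 2 * \<epsilon>..fst c + 2 * \<epsilon>} x)"
    unfolding X'_def using X by (intro sum.mono_neutral_cong_left) (auto simp: indicator_def)
  finally show ?thesis by (simp add: a_def b_def abs_if min_def max_def split: if_splits)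
qed

text \<open>
  Each ball contributes to the increment at \<open>x\<close> only when \<open>x\<close> is within \<open>2 * \<epsilon>\<close> of its centre.
\<close>

lemma integral_increment_le_covering:
  fixes v :: "real \<Rightarrow> real"
  assumes v: "continuous_on UNIV v" and X: "finite X" "period_graph v \<subseteq> (\<Union>c\<in>X. ball c \<epsilon>)"
    and \<epsilon>: "\<epsilon> > 0"
  shows "integral {0..2 * pi - \<epsilon>} (\<lambda>x. \<bar>v (x + \<epsilon>) - v x\<bar>) \<le> 8 * \<epsilon>\<^sup>2 * card X"
proof -
  let ?S = "{0..2 * pi - \<epsilon>}" and ?J = "\<lambda>c. {fst c - 2 * \<epsilon>..fst c + 2 * \<epsilon>}"
  have lm: "?J c \<inter> ?S \<in> lmeasurable" for c by (simp add: fmeasurable_Int_fmeasurable)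
  have ii: "(indicator (?J c) :: real \<Rightarrow> real) integrable_on ?S" for c
    using lm by (simp add: integrable_on_indicator)
  have "integral ?S (indicator (?J c) :: real \<Rightarrow> real) \<le> 4 * \<epsilon>" for c
  proof -
    have "integral ?S (indicator (?J c) :: real \<Rightarrow> real) = measure lebesgue (?J c \<inter> ?S)"
      by (rule integral_indicator[OF lm])
    also have "\<dots> \<le> measure lebesgue (?J c)" using lm by (intro measure_mono_fmeasurable) auto
    finally show ?thesis using \<epsilon> by simp
  qed
  note ib = this
  have "integral ?S (\<lambda>x. \<bar>v (x + \<epsilon>) - v x\<bar>) \<le> integral ?S (\<lambda>x. \<Sum>c\<in>X. 2 * \<epsilon> * indicator (?J c) x)"
  proof (rule integral_le)
    show "(\<lambda>x. \<bar>v (x + \<epsilon>) - v x\<bar>) integrable_on ?S"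
      by (intro integrable_continuous_real continuous_intros continuous_on_subset[OF v] continuous_on_compose2[OF v]) auto
    show "(\<lambda>x. \<Sum>c\<in>X. 2 * \<epsilon> * indicator (?J c) x) integrable_on ?S"
      using X ii by (intro integrable_sum integrable_on_mult_right) auto
    show "\<bar>v (x + \<epsilon>) - v x\<bar> \<le> (\<Sum>c\<in>X. 2 * \<epsilon> * indicator (?J c) x)" if "x \<in> ?S" for x
      using that by (intro increment_le_covering[OF v X \<epsilon>]) auto
  qed
  also have "\<dots> = (\<Sum>c\<in>X. 2 * \<epsilon> * integral ?S (indicator (?J c)))"
    using X ii by (subst integral_sum) (auto intro!: integrable_on_mult_right)
  also have "\<dots> \<le> (\<Sum>c\<in>X. 2 * \<epsilon> * (4 * \<epsilon>))" using \<epsilon> ib by (intro sum_mono mult_left_mono) auto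
  also have "\<dots> = 8 * \<epsilon>\<^sup>2 * card X" by (simp add: power2_eq_square)
  finally show ?thesis .
qed

text \<open>
  The square integral of the increments is at most their supremum times their integral. With the
  Hoelder exponent \<open>a\<close> and \<open>h powr (- s)\<close> covering balls this product has the order
  \<open>h powr (a + 2 - s)\<close>, and the exponent exceeds \<open>1\<close> once \<open>s < 3/2\<close> and \<open>a\<close> is close to \<open>1/2\<close>. The
  graph belongs to \<open>v\<close>, while the increments that are large belong to a function \<open>f\<close> controlled by
  \<open>v\<close>; this covers both \<open>v = \<bar>u\<bar>\<close> and \<open>v = \<bar>u\<bar>\<^sup>2\<close> with \<open>f = \<bar>u\<bar>\<^sup>2\<close>.
\<close>

lemma upper_dim_ge_of_increments:
  fixes f v :: "real \<Rightarrow> real"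
  assumes v: "holder_below_half v" and f: "\<And>x y. \<bar>f x - f y\<bar> \<le> B * \<bar>v x - v y\<bar>"
    and \<kappa>: "\<kappa> > 0" and M0: "M0 \<ge> (1::nat)"
    and low: "\<And>K h. K \<ge> (1::nat) \<Longrightarrow> h = 1 / (real M0 * real K) \<Longrightarrow> \<kappa> * h \<le> integral {0..2 * pi} (\<lambda>x. (f (x + h) - f x)\<^sup>2)"
  shows "upper_minkowski_dim (period_graph v) \<ge> 3 / 2"
proof (rule ccontr)
  let ?q = "\<lambda>\<epsilon>. ln (real (covering_number (period_graph v) \<epsilon>)) / ln (1 / \<epsilon>)"
  assume "\<not> ?thesis"
  then have "upper_minkowski_dim (period_graph v) < ereal (3 / 2)" unfolding ereal_three_halves by (rule not_le_imp_less)
  then obtain s0 where s0: "upper_minkowski_dim (period_graph v) < ereal s0" "s0 < 3 / 2"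
    using ereal_dense2[of "upper_minkowski_dim (period_graph v)" "ereal (3/2)"] by auto
  have ev: "\<forall>\<^sub>F \<epsilon> in at_right 0. ereal (?q \<epsilon>) < ereal s0"
    using s0(1) unfolding upper_minkowski_dim_def by (rule Limsup_lessD)
  \<comment> \<open>with \<open>s \<ge> 1\<close>, the exponent \<open>a\<close> below is positive and the end strip of the period is negligible\<close>
  define s where "s = max s0 1"
  define \<eta> where "\<eta> = 3 / 2 - s"
  have \<eta>: "0 < \<eta>" "\<eta> \<le> 1 / 2" using s0 by (auto simp: \<eta>_def s_def)
  define a where "a = 1 / 2 - \<eta> / 2"
  have a: "0 < a" "a < 1 / 2" using \<eta> by (auto simp: a_def)
  obtain C where C: "C \<ge> 0" "\<And>x y. \<bar>x - y\<bar> \<le> 1 \<Longrightarrow> norm (v x - v y) \<le> C * \<bar>x - y\<bar> powr a"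
    by (rule holder_below_halfE[OF v a]) blast
  have cv: "continuous_on UNIV v" using v by (rule holder_below_half_continuous)
  have cf: "continuous_on UNIV f"
  proof -
    have "(f \<longlongrightarrow> f x) (at x)" for x
    proof (rule LIM_zero_cancel, rule Lim_null_comparison)
      show "\<forall>\<^sub>F y in at x. norm (f y - f x) \<le> B * \<bar>v y - v x\<bar>" using f by simp
      have "isCont v x" using cv by (simp add: continuous_on_eq_continuous_at)
      then have "((\<lambda>y. B * \<bar>v y - v x\<bar>) \<longlongrightarrow> B * \<bar>v x - v x\<bar>) (at x)"
        unfolding isCont_def by (intro tendsto_intros)
      then show "((\<lambda>y. B * \<bar>v y - v x\<bar>) \<longlongrightarrow> 0) (at x)" by simp
    qed
    then show ?thesis by (simp add: continuous_on_eq_continuous_at isCont_def)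
  qed
  define D where "D = 8 * B\<^sup>2 * C + B\<^sup>2 * C\<^sup>2"
  have upper: "integral {0..2 * pi} (\<lambda>x. (f (x + h) - f x)\<^sup>2) \<le> D * h powr (1 + \<eta> / 2)"
    if h: "0 < h" "h < 1" and q: "?q h < s0" for h
  proof -
    let ?g = "\<lambda>x. (f (x + h) - f x)\<^sup>2"
    have gc: "continuous_on A ?g" for A
      by (intro continuous_intros continuous_on_subset[OF cf] continuous_on_compose2[OF cf]) auto
    have gi: "?g integrable_on {c..d}" for c d by (intro integrable_continuous_real gc)
    define N where "N = covering_number (period_graph v) h"
    obtain X where X: "finite X" "period_graph v \<subseteq> (\<Union>c\<in>X. ball c (3 * (h/3)))"
      using period_graph_cover[OF C(2) a(1) C(1), of "h/3"] h by auto
    obtain Y where Y: "finite Y" "card Y = N" "period_graph v \<subseteq> (\<Union>c\<in>Y. ball c h)"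
      using covering_number_attained[of X "period_graph v" h] X unfolding N_def by auto
    have "period_graph v \<noteq> {}" by (auto simp: period_graph_def)
    then have "Y \<noteq> {}" using Y by auto
    then have N1: "real N \<ge> 1" using Y(1) Y(2)[symmetric] by (simp add: Suc_le_eq card_gt_0_iff)
    have lh: "ln (1 / h) > 0" using h by simp
    have "ln (real N) / ln (1 / h) < s" using q by (simp add: N_def s_def)
    then have "ln (real N) < s * ln (1 / h)" using lh by (simp add: pos_divide_less_eq)
    then have "ln (real N) < ln (h powr (- s))" using h by (simp add: ln_powr ln_div)
    then have N: "real N \<le> h powr (- s)" using N1 h by (subst (asm) ln_less_cancel_iff) auto
    have pw: "\<bar>v (x + h) - v x\<bar> \<le> C * h powr a" for x using C(2)[of "x + h" x] h by simp
    have gv: "?g x \<le> B\<^sup>2 * \<bar>v (x + h) - v x\<bar>\<^sup>2" for x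
      using power_mono[OF f[of "x + h" x], of 2] by (simp add: power_mult_distrib)
    have "integral {0..2 * pi - h} ?g \<le> integral {0..2 * pi - h} (\<lambda>x. B\<^sup>2 * (C * h powr a) * \<bar>v (x + h) - v x\<bar>)"
    proof (rule integral_le[OF gi])
      show "(\<lambda>x. B\<^sup>2 * (C * h powr a) * \<bar>v (x + h) - v x\<bar>) integrable_on {0..2 * pi - h}"
        by (intro integrable_continuous_real continuous_intros continuous_on_subset[OF cv] continuous_on_compose2[OF cv]) auto
      fix x
      have "\<bar>v (x + h) - v x\<bar>\<^sup>2 \<le> (C * h powr a) * \<bar>v (x + h) - v x\<bar>"
        unfolding power2_eq_square using pw by (intro mult_right_mono) auto
      then have "B\<^sup>2 * \<bar>v (x + h) - v x\<bar>\<^sup>2 \<le> B\<^sup>2 * ((C * h powr a) * \<bar>v (x + h) - v x\<bar>)" by (intro mult_left_mono) auto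
      then show "?g x \<le> B\<^sup>2 * (C * h powr a) * \<bar>v (x + h) - v x\<bar>" using gv[of x] by (simp add: mult.assoc)
    qed
    also have "\<dots> = B\<^sup>2 * (C * h powr a) * integral {0..2 * pi - h} (\<lambda>x. \<bar>v (x + h) - v x\<bar>)" by simp
    also have "\<dots> \<le> B\<^sup>2 * (C * h powr a) * (8 * h\<^sup>2 * h powr (- s))"
    proof (rule mult_left_mono)
      have "integral {0..2 * pi - h} (\<lambda>x. \<bar>v (x + h) - v x\<bar>) \<le> 8 * h\<^sup>2 * card Y"
        by (rule integral_increment_le_covering[OF cv Y(1) Y(3) h(1)])
      also have "\<dots> \<le> 8 * h\<^sup>2 * h powr (- s)" using N Y by (intro mult_left_mono) auto
      finally show "integral {0..2 * pi - h} (\<lambda>x. \<bar>v (x + h) - v x\<bar>) \<le> 8 * h\<^sup>2 * h powr (- s)" .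
    qed (use C in auto)
    also have "\<dots> = 8 * B\<^sup>2 * C * h powr (1 + \<eta> / 2)"
    proof -
      have "h powr (1 + \<eta> / 2) = h powr (a + 2 + - s)" by (simp add: a_def \<eta>_def field_simps)
      also have "\<dots> = h powr a * h\<^sup>2 * h powr (- s)" unfolding powr_add using h by simp
      finally show ?thesis by simp
    qed
    finally have 1: "integral {0..2 * pi - h} ?g \<le> 8 * B\<^sup>2 * C * h powr (1 + \<eta> / 2)" .
    \<comment> \<open>the graph covers one period only, so the increments across its right end need the Hoelder bound\<close>
    have "integral {2 * pi - h..2 * pi} ?g \<le> integral {2 * pi - h..2 * pi} (\<lambda>x. B\<^sup>2 * (C * h powr a)\<^sup>2)"
    proof (rule integral_le[OF gi])
      fix x
      have "\<bar>v (x + h) - v x\<bar>\<^sup>2 \<le> (C * h powr a)\<^sup>2" using pw by (intro power_mono) auto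
      then have "B\<^sup>2 * \<bar>v (x + h) - v x\<bar>\<^sup>2 \<le> B\<^sup>2 * (C * h powr a)\<^sup>2" by (intro mult_left_mono) auto
      then show "?g x \<le> B\<^sup>2 * (C * h powr a)\<^sup>2" using gv[of x] by simp
    qed auto
    also have "\<dots> = B\<^sup>2 * C\<^sup>2 * (h powr 1 * (h powr a * h powr a))" using h by (simp add: power2_eq_square)
    also have "\<dots> = B\<^sup>2 * C\<^sup>2 * h powr (1 + (a + a))" by (simp only: powr_add)
    also have "\<dots> \<le> B\<^sup>2 * C\<^sup>2 * h powr (1 + \<eta> / 2)" using h \<eta> by (intro mult_left_mono powr_mono') (auto simp: a_def)
    finally have 2: "integral {2 * pi - h..2 * pi} ?g \<le> B\<^sup>2 * C\<^sup>2 * h powr (1 + \<eta> / 2)" .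
    have "integral {0..2 * pi} ?g = integral {0..2 * pi - h} ?g + integral {2 * pi - h..2 * pi} ?g"
      using h pi_gt3 by (intro Henstock_Kurzweil_Integration.integral_combine[symmetric] gi) auto
    then show ?thesis using 1 2 by (simp add: D_def distrib_right)
  qed
  have ev1: "\<forall>\<^sub>F \<epsilon> in at_right (0::real). 0 < \<epsilon> \<and> \<epsilon> < 1"
    unfolding eventually_at_right_field by (intro exI[of _ 1]) auto
  have "((\<lambda>h. D * h powr (\<eta> / 2)) \<longlongrightarrow> D * 0 powr (\<eta> / 2)) (at_right 0)"
    using \<eta> by (intro tendsto_intros) (auto simp: eventually_at_right_less eventually_at_filter)
  then have "((\<lambda>h. D * h powr (\<eta> / 2)) \<longlongrightarrow> 0) (at_right 0)" by simp
  from order_tendstoD(2)[OF this \<kappa>] ev ev1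
  have evb: "\<forall>\<^sub>F h in at_right 0. integral {0..2 * pi} (\<lambda>x. (f (x + h) - f x)\<^sup>2) < \<kappa> * h"
  proof eventually_elim
    case (elim h)
    have "integral {0..2 * pi} (\<lambda>x. (f (x + h) - f x)\<^sup>2) \<le> D * h powr (1 + \<eta> / 2)"
      using elim by (intro upper) auto
    also have "\<dots> = (D * h powr (\<eta> / 2)) * h" using elim by (simp add: powr_add)
    also have "\<dots> < \<kappa> * h" using elim by (intro mult_strict_right_mono) auto
    finally show ?case .
  qed
  have "filterlim (\<lambda>K. 1 / (real M0 * real K)) (at_right 0) sequentially"
    using M0 by real_asymp
  from eventually_happens'[OF _ eventually_conj[OF filterlim_iff[THEN iffD1, OF this, rule_format, OF evb] eventually_ge_at_top[of 1]]]
  obtain K where "K \<ge> 1" "integral {0..2 * pi} (\<lambda>x. (f (x + 1 / (real M0 * real K)) - f x)\<^sup>2) < \<kappa> * (1 / (real M0 * real K))"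
    by auto
  then show False using low[of K "1 / (real M0 * real K)"] by simp
qed

section \<open>The series behind the solution\<close>

definition weyl_series :: "real \<Rightarrow> nat \<Rightarrow> real \<Rightarrow> complex" where
  "weyl_series t N x = (\<Sum>k\<in>{1..N}. cis (real k * x - (real k)\<^sup>2 * t) / of_nat k)"

lemma weyl_series_by_parts:
  assumes "M \<le> N"
  shows "weyl_series t N x - weyl_series t M x =
    weyl_sum t N x / of_nat (N + 1) - weyl_sum t M x / of_nat (M + 1)
    + (\<Sum>k\<in>{M<..N}. weyl_sum t k x * (1 / of_nat k - 1 / of_nat (k + 1)))"
  using assms
proof (induction N rule: dec_induct)
  case base then show ?case by simp
next
  case (step n)
  have i: "{M<..Suc n} = insert (Suc n) {M<..n}" using step.hyps by auto
  have w: "weyl_sum t (Suc n) x = weyl_sum t n x + cis (real (Suc n) * x - (real (Suc n))\<^sup>2 * t)"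
    by (simp add: weyl_sum_def)
  have "weyl_series t (Suc n) x - weyl_series t M x
     = weyl_series t n x - weyl_series t M x + cis (real (Suc n) * x - (real (Suc n))\<^sup>2 * t) / of_nat (Suc n)"
    by (simp add: weyl_series_def)
  also have "cis (real (Suc n) * x - (real (Suc n))\<^sup>2 * t) = weyl_sum t (Suc n) x - weyl_sum t n x"
    using w by simp
  finally show ?case unfolding step.IH i by (simp add: diff_divide_distrib right_diff_distrib)
qed

lemma powr_neg_difference_ge:
  assumes "x > 0" "g > 0"
  shows "g * (x + 1) powr (- 1 - g) \<le> x powr (- g) - (x + 1) powr (- g :: real)"
proof -
  have "\<exists>z. x < z \<and> z < x + 1 \<and> (x + 1) powr (- g) - x powr (- g) = (x + 1 - x) * (- g * z powr (- g - 1))"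
    using assms by (intro MVT2) (auto intro!: derivative_eq_intros)
  then obtain z where z: "x < z" "z < x + 1" "(x + 1) powr (- g) - x powr (- g) = - g * z powr (- g - 1)" by auto
  have "(x + 1) powr (- g - 1) \<le> z powr (- g - 1)" using z assms by (intro powr_mono2') auto
  then have "g * (x + 1) powr (- g - 1) \<le> g * z powr (- g - 1)" using assms by simp
  moreover have eq: "- g - 1 = - 1 - g" by simp
  ultimately show ?thesis using z(3) unfolding eq by linarith
qed

lemma sum_powr_tail_le:
  assumes "M \<le> N" "M \<ge> 1" "g > 0"
  shows "(\<Sum>k\<in>{M<..N}. real k powr (- 1 - g)) \<le> (real M powr (- g) - real N powr (- g)) / g"
  using assms(1)
proof (induction N rule: dec_induct)
  case (step n)
  have i: "{M<..Suc n} = insert (Suc n) {M<..n}" using step.hyps by auto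
  have "real (Suc n) powr (- 1 - g) \<le> (real n powr (- g) - real (Suc n) powr (- g)) / g"
    using powr_neg_difference_ge[of "real n" g] step.hyps assms by (simp add: field_simps)
  then show ?case using step.IH unfolding i by (simp add: diff_divide_distrib)
qed simp

text \<open>
  Summation by parts turns the bound \<open>k powr (1 - g)\<close> for the exponential sums into terms of order
  \<open>k powr (- 1 - g)\<close>. The same constant serves both conclusions because they are used together.
\<close>

lemma weyl_series_tail:
  assumes "weyl_bounded t" "0 < g" "g < 1 / 2"
  obtains C where "C \<ge> 0" 
    and "\<And>M N x. 1 \<le> M \<Longrightarrow> M \<le> N \<Longrightarrow> norm (weyl_series t N x - weyl_series t M x) \<le> C * real M powr (- g)"
    and "\<And>N x. norm (weyl_sum t N x) \<le> C * real N powr (1 - g)"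
proof -
  have "1/2 - g > 0" using assms by simp
  with assms(1) obtain C0 where C0: "\<And>N x. norm (weyl_sum t N x) \<le> C0 * real N powr (1 / 2 + (1 / 2 - g))"
    unfolding weyl_bounded_def by blast
  have W: "norm (weyl_sum t N x) \<le> C0 * real N powr (1 - g)" for N x using C0[of N x] by simp
  have C0p: "C0 \<ge> 0" using W[of 1 0] norm_ge_zero[of "weyl_sum t 1 0"] by (simp add: weyl_sum_def)
  have W': "norm (weyl_sum t N x) / real (N + 1) \<le> C0 * real N powr (- g)" if "N \<ge> 1" for N x
  proof -
    have "norm (weyl_sum t N x) / real (N + 1) \<le> norm (weyl_sum t N x) / real N"
      using that by (intro divide_left_mono) auto
    also have "\<dots> \<le> C0 * real N powr (1 - g) / real N" using W that by (intro divide_right_mono) auto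
    also have "\<dots> = C0 * real N powr (- g)" using that by (simp add: powr_diff powr_minus field_simps)
    finally show ?thesis .
  qed
  have tail: "norm (weyl_series t N x - weyl_series t M x) \<le> C0 * (2 + 1 / g) * real M powr (- g)"
    if MN: "1 \<le> M" "M \<le> N" for M N x
  proof -
    have "norm (weyl_sum t k x * (1 / of_nat k - 1 / of_nat (k + 1))) \<le> C0 * real k powr (- 1 - g)" if k: "k \<in> {M<..N}" for k
    proof -
      have "k \<ge> 1" using k MN by auto
      have "(1 / of_nat k - 1 / of_nat (k + 1) :: complex) = of_real (1 / real k - 1 / real (k + 1))" by simp
      also have "1 / real k - 1 / real (k + 1) = 1 / (real k * real (k + 1))"
        using \<open>k \<ge> 1\<close> by (simp add: field_simps)
      finally have eq: "(1 / of_nat k - 1 / of_nat (k + 1) :: complex) = of_real (1 / (real k * real (k + 1)))" .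
      then have "norm (weyl_sum t k x * (1 / of_nat k - 1 / of_nat (k + 1))) = norm (weyl_sum t k x) / real (k + 1) / real k"
        unfolding eq by (simp only: norm_mult norm_of_real) (simp add: mult.commute)
      also have "\<dots> \<le> C0 * real k powr (- g) / real k" using W'[OF \<open>k \<ge> 1\<close>, of x] by (intro divide_right_mono) auto
      also have "\<dots> = C0 * real k powr (- 1 - g)" using \<open>k \<ge> 1\<close> by (simp add: powr_diff powr_minus field_simps)
      finally show ?thesis .
    qed
    then have "norm (\<Sum>k\<in>{M<..N}. weyl_sum t k x * (1 / of_nat k - 1 / of_nat (k + 1))) \<le> (\<Sum>k\<in>{M<..N}. C0 * real k powr (- 1 - g))"
      by (rule sum_norm_le)
    also have "\<dots> = C0 * (\<Sum>k\<in>{M<..N}. real k powr (- 1 - g))" by (simp add: sum_distrib_left)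
    also have "\<dots> \<le> C0 * ((real M powr (- g) - real N powr (- g)) / g)"
      using MN assms C0p by (intro mult_left_mono sum_powr_tail_le) auto
    also have "\<dots> \<le> C0 * (real M powr (- g) / g)" using assms C0p by (intro mult_left_mono divide_right_mono) auto
    finally have 1: "norm (\<Sum>k\<in>{M<..N}. weyl_sum t k x * (1 / of_nat k - 1 / of_nat (k + 1))) \<le> C0 * (real M powr (- g) / g)" .
    have "norm (weyl_sum t N x / of_nat (N + 1)) = norm (weyl_sum t N x) / real (N + 1)"
      by (simp only: norm_divide norm_of_nat)
    also have "\<dots> \<le> C0 * real N powr (- g)" using W' MN by simp
    also have "\<dots> \<le> C0 * real M powr (- g)" using MN assms C0p by (intro mult_left_mono powr_mono2') auto
    finally have 2: "norm (weyl_sum t N x / of_nat (N + 1)) \<le> C0 * real M powr (- g)" .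
    have "norm (weyl_sum t M x / of_nat (M + 1)) = norm (weyl_sum t M x) / real (M + 1)"
      by (simp only: norm_divide norm_of_nat)
    also have "\<dots> \<le> C0 * real M powr (- g)" using W' MN by simp
    finally have 3: "norm (weyl_sum t M x / of_nat (M + 1)) \<le> C0 * real M powr (- g)" .
    have "norm (weyl_series t N x - weyl_series t M x) \<le> C0 * real M powr (- g) + C0 * real M powr (- g) + C0 * (real M powr (- g) / g)"
      unfolding weyl_series_by_parts[OF MN(2)]
      by (intro norm_triangle_le add_mono 1 norm_triangle_le_diff 2 3)
    then show ?thesis by (simp add: algebra_simps)
  qed
  show thesis
  proof (rule that)
    show "C0 * (2 + 1 / g) \<ge> 0" using C0p assms by simp
    show "norm (weyl_series t N x - weyl_series t M x) \<le> C0 * (2 + 1 / g) * real M powr (- g)"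
      if "1 \<le> M" "M \<le> N" for M N x using tail that .
    have "C0 * 1 \<le> C0 * (2 + 1 / g)" using C0p assms by (intro mult_left_mono) auto
    then show "norm (weyl_sum t N x) \<le> C0 * (2 + 1 / g) * real N powr (1 - g)" for N x
      using order_trans[OF W[of N x] mult_right_mono] by (metis mult.right_neutral powr_ge_zero)
  qed
qed

definition weyl_limit :: "real \<Rightarrow> real \<Rightarrow> complex" where
  "weyl_limit t x = lim (\<lambda>N. weyl_series t N x)"

lemma weyl_limit_tail:
  assumes C: "\<And>M N x. 1 \<le> M \<Longrightarrow> M \<le> N \<Longrightarrow> norm (weyl_series t N x - weyl_series t M x) \<le> C * real M powr (- g)"
    and g: "g > 0" and M: "M \<ge> 1"
  shows "norm (weyl_limit t x - weyl_series t M x) \<le> C * real M powr (- g)"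
proof -
  have lim0: "(\<lambda>M. C * real M powr (- g)) \<longlonglongrightarrow> 0"
    using tendsto_mult_right_zero[OF tendsto_neg_powr[of "-g" real sequentially]] g filterlim_real_sequentially by simp
  have "Cauchy (\<lambda>N. weyl_series t N x)"
  proof (rule CauchyI')
    fix e :: real assume "e > 0"
    from order_tendstoD(2)[OF lim0 this] obtain K where K: "\<And>M. M \<ge> K \<Longrightarrow> C * real M powr (- g) < e"
      unfolding eventually_sequentially by blast
    show "\<exists>M. \<forall>m\<ge>M. \<forall>n>m. dist (weyl_series t m x) (weyl_series t n x) < e"
    proof (intro exI[of _ "max 1 K"] allI impI)
      fix m n assume "m \<ge> max 1 K" "n > m"
      then show "dist (weyl_series t m x) (weyl_series t n x) < e" unfolding dist_norm
        using C[of m n x] K[of m] norm_minus_commute[of "weyl_series t m x" "weyl_series t n x"] by auto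
    qed
  qed
  then have "(\<lambda>N. weyl_series t N x) \<longlonglongrightarrow> weyl_limit t x"
    unfolding weyl_limit_def using Cauchy_convergent convergent_LIMSEQ_iff by blast
  then have "(\<lambda>N. norm (weyl_series t N x - weyl_series t M x)) \<longlonglongrightarrow> norm (weyl_limit t x - weyl_series t M x)"
    by (intro tendsto_intros)
  then show ?thesis
    by (rule tendsto_upperbound) (auto intro!: eventually_sequentiallyI[of M] C M)
qed

lemma weyl_series_uniform_limit:
  assumes "weyl_bounded t"
  shows "uniform_limit UNIV (weyl_series t) (weyl_limit t) sequentially"
proof (rule uniform_limitI)
  fix e :: real assume "e > 0"
  obtain C where C: "\<And>M N x. 1 \<le> M \<Longrightarrow> M \<le> N \<Longrightarrow> norm (weyl_series t N x - weyl_series t M x) \<le> C * real M powr (- (1/4))"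
    by (rule weyl_series_tail[OF assms, of "1/4"]) auto
  have "(\<lambda>M. C * real M powr (- (1/4))) \<longlonglongrightarrow> 0"
    using tendsto_mult_right_zero[OF tendsto_neg_powr[of "-(1/4)" real sequentially]] filterlim_real_sequentially by simp
  from order_tendstoD(2)[OF this \<open>e > 0\<close>] eventually_ge_at_top[of 1]
  show "\<forall>\<^sub>F n in sequentially. \<forall>x\<in>UNIV. dist (weyl_series t n x) (weyl_limit t x) < e"
  proof eventually_elim
    case (elim n)
    then show ?case using weyl_limit_tail[OF C, of n] by (auto simp: dist_norm norm_minus_commute intro: le_less_trans)
  qed
qed

text \<open>
  Differentiating a term cancels its factor \<open>1 / k\<close>, so the derivative of the series is the
  exponential sum times \<open>\<i>\<close>.
\<close>

lemma weyl_series_lipschitz: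
  assumes "\<And>x. norm (weyl_sum t M x) \<le> B"
  shows "norm (weyl_series t M x - weyl_series t M y) \<le> B * \<bar>x - y\<bar>"
proof -
  have der: "(weyl_series t M has_derivative (\<lambda>h. h *\<^sub>R (\<i> * weyl_sum t M z))) (at z within UNIV)" for z
  proof -
    have c: "((\<lambda>z. cis (real k * z - (real k)\<^sup>2 * t) / of_nat k) has_vector_derivative \<i> * cis (real k * z - (real k)\<^sup>2 * t)) (at z)"
      if "k \<ge> 1" for k :: nat
    proof -
      have "((\<lambda>z. cis (real k * z - (real k)\<^sup>2 * t)) has_vector_derivative (real k) *\<^sub>R (\<i> * cis (real k * z - (real k)\<^sup>2 * t))) (at z)"
        unfolding has_vector_derivative_def
        by (auto intro!: derivative_eq_intros simp: algebra_simps scaleR_conv_of_real)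
      then have "((\<lambda>z. cis (real k * z - (real k)\<^sup>2 * t) / of_nat k) has_vector_derivative (real k *\<^sub>R (\<i> * cis (real k * z - (real k)\<^sup>2 * t))) / of_nat k) (at z)"
        by (rule has_vector_derivative_divide)
      then show ?thesis using that by (simp add: scaleR_conv_of_real)
    qed
    have "((\<lambda>z. weyl_series t M z) has_vector_derivative (\<Sum>k\<in>{1..M}. \<i> * cis (real k * z - (real k)\<^sup>2 * t))) (at z)"
      unfolding weyl_series_def by (intro has_vector_derivative_sum c) auto
    then show ?thesis unfolding has_vector_derivative_def weyl_sum_def by (simp add: sum_distrib_left)
  qed
  have "norm (weyl_series t M x - weyl_series t M y) \<le> B * norm (x - y)"
  proof (rule differentiable_bound[OF convex_UNIV der])
    fix z :: real
    show "onorm (\<lambda>h. h *\<^sub>R (\<i> * weyl_sum t M z)) \<le> B"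
    proof (rule onorm_bound)
      show "B \<ge> 0" using order_trans[OF norm_ge_zero assms] .
      show "norm (h *\<^sub>R (\<i> * weyl_sum t M z)) \<le> B * norm h" for h
        using mult_right_mono[OF assms[of z], of "\<bar>h\<bar>"] by (simp add: norm_mult mult.commute)
    qed
  qed auto
  then show ?thesis by simp
qed

text \<open>
  Cut the series at a length \<open>M\<close> comparable to \<open>1 / \<bar>x - y\<bar>\<close>: the tail is \<open>O(M powr (- g))\<close>, and the
  partial sum has derivative \<open>O(M powr (1 - g))\<close>, which is the exponential sum itself.
\<close>

lemma weyl_limit_holder:
  assumes "weyl_bounded t"
  shows "holder_below_half (weyl_limit t)"
  unfolding holder_below_half_def
proof (intro allI impI)
  fix g :: real assume g: "0 < g" "g < 1 / 2"
  obtain C where C: "C \<ge> 0" 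
    "\<And>M N x. 1 \<le> M \<Longrightarrow> M \<le> N \<Longrightarrow> norm (weyl_series t N x - weyl_series t M x) \<le> C * real M powr (- g)"
    "\<And>N x. norm (weyl_sum t N x) \<le> C * real N powr (1 - g)"
    by (rule weyl_series_tail[OF assms g]) blast
  have "norm (weyl_limit t x - weyl_limit t y) \<le> 4 * C * \<bar>x - y\<bar> powr g" if d1: "\<bar>x - y\<bar> \<le> 1" for x y
  proof (cases "x = y")
    case False
    define d where "d = \<bar>x - y\<bar>"
    have d: "0 < d" "d \<le> 1" using False d1 by (auto simp: d_def)
    define M where "M = nat \<lceil>1 / d\<rceil>"
    have M: "1 / d \<le> real M" "real M \<le> 2 / d" "M \<ge> 1"
    proof -
      have "1 / d \<ge> 1" using d by simp
      then have "\<lceil>1 / d\<rceil> \<ge> 1" by linarith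
      then show "1 / d \<le> real M" "M \<ge> 1" unfolding M_def by linarith+
      have "real M \<le> 1 / d + 1" unfolding M_def using \<open>\<lceil>1 / d\<rceil> \<ge> 1\<close> by linarith
      also have "\<dots> \<le> 2 / d" using d by (simp add: field_simps)
      finally show "real M \<le> 2 / d" .
    qed
    have t: "C * real M powr (- g) \<le> C * d powr g"
    proof -
      have "real M powr (- g) \<le> (1 / d) powr (- g)" using M d g by (intro powr_mono2') auto
      also have "\<dots> = d powr g" using d by (simp add: powr_divide powr_minus field_simps)
      finally show ?thesis using C(1) by (rule mult_left_mono)
    qed
    have l: "C * real M powr (1 - g) * d \<le> 2 * C * d powr g"
    proof -
      have "real M powr (1 - g) \<le> (2 / d) powr (1 - g)" using M d g by (intro powr_mono2) auto
      also have "\<dots> = 2 powr (1 - g) * (1 / d) powr (1 - g)" using d by (simp flip: powr_mult)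
      also have "\<dots> \<le> 2 powr 1 * (1 / d) powr (1 - g)" using g by (intro mult_right_mono powr_mono) auto
      also have "\<dots> = 2 * (d powr g / d)" using d by (simp add: powr_divide powr_diff field_simps)
      finally have "real M powr (1 - g) * d \<le> 2 * d powr g" using d by (simp add: field_simps)
      from mult_left_mono[OF this C(1)] show ?thesis by (simp add: algebra_simps)
    qed
    have "norm (weyl_limit t x - weyl_limit t y) \<le> norm (weyl_limit t x - weyl_series t M x)
      + norm (weyl_series t M x - weyl_series t M y) + norm (weyl_limit t y - weyl_series t M y)"
      using norm_triangle_ineq[of "weyl_limit t x - weyl_series t M x" "weyl_series t M x - weyl_series t M y"]
        norm_triangle_ineq4[of "weyl_limit t x - weyl_series t M x + (weyl_series t M x - weyl_series t M y)" "weyl_limit t y - weyl_series t M y"]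
      by simp
    also have "\<dots> \<le> C * d powr g + 2 * C * d powr g + C * d powr g"
      using weyl_limit_tail[OF C(2) g(1) M(3)] weyl_series_lipschitz[OF C(3), of M x y] t l
      unfolding d_def by (intro add_mono) (auto intro: order_trans)
    finally show ?thesis by (simp add: d_def)
  qed simp
  then show "\<exists>C. \<forall>x y. \<bar>x - y\<bar> \<le> 1 \<longrightarrow> norm (weyl_limit t x - weyl_limit t y) \<le> C * \<bar>x - y\<bar> powr g" by blast
qed

lemma weyl_limit_bounded:
  assumes "weyl_bounded t"
  shows "\<exists>B. \<forall>x. norm (weyl_limit t x) \<le> B"
proof -
  obtain C where C: "C \<ge> 0" 
    "\<And>M N x. 1 \<le> M \<Longrightarrow> M \<le> N \<Longrightarrow> norm (weyl_series t N x - weyl_series t M x) \<le> C * real M powr (- (1/4))"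
    by (rule weyl_series_tail[OF assms, of "1/4"]) auto
  have "norm (weyl_limit t x) \<le> C + 1" for x
    using weyl_limit_tail[OF C(2), of 1 x] norm_triangle_ineq2[of "weyl_limit t x" "weyl_series t 1 x"]
    by (simp add: weyl_series_def)
  then show ?thesis by blast
qed

section \<open>The sawtooth series\<close>

definition sine_sum :: "nat \<Rightarrow> real \<Rightarrow> real" where
  "sine_sum N x = (\<Sum>k\<in>{1..N}. sin (real k * x) / real k)"

lemma dirichlet_kernel:
  "2 * sin (x / 2) * (\<Sum>k\<in>{1..N}. cos (real k * x)) = sin ((real N + 1 / 2) * x) - sin (x / 2)"
proof (induction N)
  case (Suc N)
  have "2 * sin (x / 2) * cos (real (Suc N) * x) = sin ((real (Suc N) + 1 / 2) * x) - sin ((real N + 1 / 2) * x)"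
    using sin_add[of "real (Suc N) * x" "x / 2"] sin_diff[of "real (Suc N) * x" "x / 2"]
    by (simp add: algebra_simps)
  then show ?case using Suc by (simp add: distrib_left)
qed simp

text \<open>
  The derivative of \<open>sine_sum N y + y / 2\<close> is the Dirichlet kernel, which oscillates rapidly.
  Adding the correction \<open>cos ((N + 1/2) * y) / ((2 * N + 1) * sin (y / 2))\<close> amounts to one
  integration by parts: the derivative becomes \<open>O(1 / N)\<close> away from \<open>0\<close>, and the value at \<open>pi\<close> is
  known.
\<close>

lemma sine_sum_tendsto_aux:
  assumes x: "0 < x" "x \<le> pi"
  shows "(\<lambda>N. sine_sum N x) \<longlonglongrightarrow> (pi - x) / 2"
proof -
  define s where "s = sin (x / 2)"
  have s: "0 < s" unfolding s_def using x by (intro sin_gt_zero) auto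
  have sy: "s \<le> sin (y / 2)" if "x \<le> y" "y \<le> pi" for y
    unfolding s_def using that x by (intro sin_monotone_2pi_le) auto
  define G where "G N y = sine_sum N y + y / 2 + cos ((real N + 1 / 2) * y) / ((2 * real N + 1) * sin (y / 2))" for N y
  define G' where "G' N y = - (cos ((real N + 1 / 2) * y) * cos (y / 2)) / (2 * (2 * real N + 1) * (sin (y / 2))\<^sup>2)" for N y
  have der: "(G N has_field_derivative G' N y) (at y within {x..pi})" if y: "y \<in> {x..pi}" for N y
  proof -
    have sp: "sin (y / 2) > 0" using sy[of y] y s by auto
    have F: "(sine_sum N has_field_derivative (\<Sum>k\<in>{1..N}. cos (real k * y))) (at y within {x..pi})"
      unfolding sine_sum_def
    proof (rule DERIV_sum)
      fix k assume k: "k \<in> {1..N}"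
      have "((\<lambda>y. sin (real k * y) / real k) has_field_derivative (cos (real k * y) * real k) / real k) (at y within {x..pi})"
        by (intro DERIV_cdivide) (auto intro!: derivative_eq_intros)
      then show "((\<lambda>y. sin (real k * y) / real k) has_field_derivative cos (real k * y)) (at y within {x..pi})"
        using k by simp
    qed
    have Q: "((\<lambda>y. cos ((real N + 1 / 2) * y) / ((2 * real N + 1) * sin (y / 2))) has_field_derivative
       ((- sin ((real N + 1 / 2) * y) * (real N + 1 / 2)) * ((2 * real N + 1) * sin (y / 2)) 
         - cos ((real N + 1 / 2) * y) * ((2 * real N + 1) * (cos (y / 2) / 2))) / (((2 * real N + 1) * sin (y / 2)) * ((2 * real N + 1) * sin (y / 2)))) (at y within {x..pi})"
    proof (rule DERIV_divide)
      show "((\<lambda>y. cos ((real N + 1 / 2) * y)) has_field_derivative (- sin ((real N + 1 / 2) * y) * (real N + 1 / 2))) (at y within {x..pi})"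
        by (auto intro!: derivative_eq_intros)
      show "((\<lambda>y. (2 * real N + 1) * sin (y / 2)) has_field_derivative (2 * real N + 1) * (cos (y / 2) / 2)) (at y within {x..pi})"
        by (auto intro!: derivative_eq_intros)
    qed (use sp in auto)
    have "(\<Sum>k\<in>{1..N}. cos (real k * y)) = sin ((real N + 1 / 2) * y) / (2 * sin (y / 2)) - 1 / 2"
      using dirichlet_kernel[of y N] sp by (simp add: field_simps)
    moreover have "((- sin ((real N + 1 / 2) * y) * (real N + 1 / 2)) * ((2 * real N + 1) * sin (y / 2)) 
         - cos ((real N + 1 / 2) * y) * ((2 * real N + 1) * (cos (y / 2) / 2))) / (((2 * real N + 1) * sin (y / 2)) * ((2 * real N + 1) * sin (y / 2)))
       = - sin ((real N + 1 / 2) * y) / (2 * sin (y / 2)) + G' N y"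
    proof -
      have "((- S * (n / 2)) * (n * w) - C * (n * (c / 2))) / ((n * w) * (n * w)) = - S / (2 * w) + - (C * c) / (2 * n * w\<^sup>2)"
        if "n > 0" "w > 0" for S C c n w :: real
        using that by (simp add: field_simps power2_eq_square)
      from this[of "2 * real N + 1" "sin (y / 2)" "sin ((real N + 1 / 2) * y)" "cos ((real N + 1 / 2) * y)" "cos (y / 2)"] sp
      show ?thesis unfolding G'_def by (simp add: add_divide_distrib)
    qed
    moreover have "(G N has_field_derivative (\<Sum>k\<in>{1..N}. cos (real k * y)) + 1 / 2 + 
      ((- sin ((real N + 1 / 2) * y) * (real N + 1 / 2)) * ((2 * real N + 1) * sin (y / 2)) 
         - cos ((real N + 1 / 2) * y) * ((2 * real N + 1) * (cos (y / 2) / 2))) / (((2 * real N + 1) * sin (y / 2)) * ((2 * real N + 1) * sin (y / 2)))) (at y within {x..pi})"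
      unfolding G_def by (intro DERIV_add F Q) (auto intro!: derivative_eq_intros)
    ultimately show ?thesis by simp
  qed
  have bound: "norm (G' N y) \<le> 1 / (2 * (2 * real N + 1) * s\<^sup>2)" if y: "y \<in> {x..pi}" for N y
  proof -
    have "\<bar>cos ((real N + 1 / 2) * y) * cos (y / 2)\<bar> \<le> 1 * 1" unfolding abs_mult by (intro mult_mono) auto
    moreover have "s\<^sup>2 \<le> (sin (y / 2))\<^sup>2" using sy[of y] y s by (intro power_mono) auto
    ultimately show ?thesis unfolding G'_def using s
      by (auto simp: abs_divide intro!: frac_le mult_left_mono)
  qed
  have est: "\<bar>sine_sum N x - (pi - x) / 2\<bar> \<le> (1 / s + 1 + pi / s\<^sup>2) / (2 * real N + 1)" for N
  proof -
    have "norm (G N x - G N pi) \<le> 1 / (2 * (2 * real N + 1) * s\<^sup>2) * norm (x - pi)"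
      by (rule field_differentiable_bound[OF convex_real_interval(5) der bound]) (use x in auto)
    also have "\<dots> \<le> 1 / (2 * (2 * real N + 1) * s\<^sup>2) * (2 * pi)" using x by (intro mult_left_mono) auto
    also have "\<dots> = (pi / s\<^sup>2) / (2 * real N + 1)"
    proof -
      have "1 / (2 * n * w) * (2 * p) = p / w / n" for n w p :: real by simp
      then show ?thesis .
    qed
    finally have 1: "\<bar>G N x - G N pi\<bar> \<le> (pi / s\<^sup>2) / (2 * real N + 1)" by simp
    have 2: "\<bar>cos ((real N + 1 / 2) * x) / ((2 * real N + 1) * sin (x / 2))\<bar> \<le> (1 / s) / (2 * real N + 1)"
    proof -
      have "\<bar>c / (n * s)\<bar> \<le> (1 / s) / n" if "\<bar>c\<bar> \<le> 1" "n > 0" for c n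
        using that s divide_right_mono[of "\<bar>c\<bar>" 1 "n * s"] by (simp add: abs_mult mult.commute)
      then show ?thesis unfolding s_def[symmetric] by simp
    qed
    have 3: "\<bar>cos ((real N + 1 / 2) * pi) / (2 * real N + 1)\<bar> \<le> 1 / (2 * real N + 1)"
      by (auto simp: abs_divide divide_right_mono)
    have "sine_sum N pi = 0" by (simp add: sine_sum_def mult.commute)
    then have "sine_sum N x - (pi - x) / 2 = (G N x - G N pi) - cos ((real N + 1 / 2) * x) / ((2 * real N + 1) * sin (x / 2))
      + cos ((real N + 1 / 2) * pi) / (2 * real N + 1)"
      unfolding G_def by (simp add: diff_divide_distrib)
    then show ?thesis using 1 2 3 unfolding add_divide_distrib by linarith
  qed
  have "(\<lambda>N. (1 / s + 1 + pi / s\<^sup>2) / (2 * real N + 1)) \<longlonglongrightarrow> 0"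
    by real_asymp
  then have "(\<lambda>N. sine_sum N x - (pi - x) / 2) \<longlonglongrightarrow> 0"
    by (rule Lim_null_comparison[rotated]) (use est in auto)
  then show ?thesis by (simp add: LIM_zero_iff)
qed

lemma sine_sum_minus: "sine_sum N (- x) = - sine_sum N x"
  by (simp add: sine_sum_def sum_negf)

lemma sine_sum_periodic: "sine_sum N (x + 2 * pi * of_int p) = sine_sum N x"
proof -
  have "sin (real k * (x + 2 * pi * of_int p)) = sin (real k * x)" for k
  proof -
    have e: "real k * (x + 2 * pi * of_int p) = real k * x + 2 * pi * of_int (int k * p)" by (simp add: algebra_simps)
    show ?thesis using sin_cos_eq_iff[of "real k * (x + 2 * pi * of_int p)" "real k * x"] e by blast
  qed
  then show ?thesis by (simp add: sine_sum_def)
qed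

text \<open>
  The limit is the sawtooth, in the form it has on both sides of its jump at \<open>0\<close>.
\<close>

lemma sine_sum_tendsto:
  assumes "0 < \<bar>x\<bar>" "\<bar>x\<bar> < 2 * pi"
  shows "(\<lambda>N. sine_sum N x) \<longlonglongrightarrow> (sgn x * pi - x) / 2"
proof -
  have pos: "(\<lambda>N. sine_sum N y) \<longlonglongrightarrow> (pi - y) / 2" if "0 < y" "y < 2 * pi" for y
  proof (cases "y \<le> pi")
    case False
    have "sine_sum N y = - sine_sum N (2 * pi - y)" for N
      using sine_sum_periodic[of N "- y" 1] sine_sum_minus[of N y] by simp
    moreover have "(\<lambda>N. - sine_sum N (2 * pi - y)) \<longlonglongrightarrow> - ((pi - (2 * pi - y)) / 2)"
      using False that by (intro tendsto_minus sine_sum_tendsto_aux) auto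
    moreover have "- ((pi - (2 * pi - y)) / 2) = (pi - y) / 2" by (simp add: field_simps)
    ultimately show ?thesis by (simp only:)
  qed (use that sine_sum_tendsto_aux in auto)
  show ?thesis
  proof (cases "x > 0")
    case True then show ?thesis using pos[of x] assms by simp
  next
    case False
    then have "(\<lambda>N. - sine_sum N (- x)) \<longlonglongrightarrow> - ((pi - (- x)) / 2)"
      using assms by (intro tendsto_minus pos) auto
    then show ?thesis using False assms by (simp add: sine_sum_minus minus_divide_left)
  qed
qed


section \<open>The autocorrelation of the jumps\<close>

lemma sum_symmetric_int:
  fixes f :: "int \<Rightarrow> 'a::comm_monoid_add"
  shows "(\<Sum>k\<in>{- int N..int N}. f k) = f 0 + (\<Sum>k\<in>{1..N}. f (int k) + f (- int k))"
proof (induction N)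
  case (Suc N)
  have "{- int (Suc N)..int (Suc N)} = insert (int (Suc N)) (insert (- int (Suc N)) {- int N..int N})" by auto
  then show ?case using Suc by (simp add: algebra_simps)
qed simp


lemma sum_cis_over_index:
  "(\<Sum>k\<in>{- int N..int N}. cis (- of_int k * y) / of_int k) = - 2 * \<i> * of_real (sine_sum N y)"
proof -
  have "cis (- (real k * y)) - cis (real k * y) = - 2 * \<i> * of_real (sin (real k * y))" for k
    by (simp add: complex_eq_iff)
  then have *: "cis (- (real k * y)) / of_nat k - cis (real k * y) / of_nat k = - 2 * \<i> * of_real (sin (real k * y) / real k)" for k
    by (metis (no_types, lifting) diff_divide_distrib of_real_divide of_real_of_nat_eq times_divide_eq_right)
  show ?thesis unfolding sum_symmetric_int sine_sum_def using *
    by (simp add: sum_distrib_left)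
qed

text \<open>
  The Fourier transform of the measure with mass \<open>J j\<close> at the point \<open>2 * pi * j / q\<close>, which up to a
  factor \<open>2 * pi\<close> is that of the derivative of a step function with these jumps.
\<close>

definition jump_transform :: "(nat \<Rightarrow> complex) \<Rightarrow> nat \<Rightarrow> int \<Rightarrow> complex" where
  "jump_transform J q k = (\<Sum>j<q. J j * cis (- of_int k * (2 * pi / real q * real j)))"

text \<open>
  The term at \<open>k = 0\<close> vanishes, because division by zero gives zero.
\<close>

definition autocorrelation_series :: "(nat \<Rightarrow> complex) \<Rightarrow> nat \<Rightarrow> nat \<Rightarrow> real \<Rightarrow> complex" where
  "autocorrelation_series J q N y =
     (\<Sum>k\<in>{- int N..int N}. jump_transform J q k * cnj (jump_transform J q k) * cis (- of_int k * y) / of_int k)"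

lemma jump_transform_periodic:
  assumes "int q dvd m" "q \<ge> 1"
  shows "jump_transform J q (k + m) = jump_transform J q k"
proof -
  obtain p where p: "m = int q * p" using assms(1) by blast
  have "cis (- of_int (k + m) * (2 * pi / real q * real j)) = cis (- of_int k * (2 * pi / real q * real j))" for j
  proof -
    have e: "- of_int (k + m) * (2 * pi / real q * real j) = - of_int k * (2 * pi / real q * real j) + 2 * pi * of_int (- p * int j)"
      using assms(2) by (simp add: p field_simps)
    have "cis (2 * pi * of_int (- p * int j)) = 1" by (intro cis_multiple_2pi) simp
    then show ?thesis unfolding e cis_mult[symmetric] by simp
  qed
  then show ?thesis by (simp add: jump_transform_def)
qed

lemma autocorrelation_series_eq:
  "autocorrelation_series J q N y =
     - 2 * \<i> * (\<Sum>j<q. \<Sum>l<q. J j * cnj (J l) * of_real (sine_sum N (2 * pi / real q * (real j - real l) + y)))"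
proof -
  let ?d = "2 * pi / real q"
  have *: "jump_transform J q k * cnj (jump_transform J q k) * cis (- of_int k * y) / of_int k =
     (\<Sum>j<q. \<Sum>l<q. J j * cnj (J l) * (cis (- of_int k * (?d * (real j - real l) + y)) / of_int k))" for k
  proof -
    have "cis (- k * (d * (a - b) + y)) = cis (- k * (d * a)) * cnj (cis (- k * (d * b))) * cis (- k * y)" for k d a b :: real
      unfolding cis_cnj cis_mult by (simp add: algebra_simps)
    note c = this[of "of_int k" ?d]
    show ?thesis unfolding jump_transform_def cnj_sum complex_cnj_mult sum_product c
      unfolding sum_distrib_right sum_divide_distrib
      by (intro sum.cong refl) simp
  qed
  have "autocorrelation_series J q N y = (\<Sum>j<q. \<Sum>l<q. J j * cnj (J l) * (\<Sum>k\<in>{- int N..int N}. cis (- of_int k * (?d * (real j - real l) + y)) / of_int k))"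
    unfolding autocorrelation_series_def * sum_distrib_left
    by (subst sum.swap, rule sum.cong[OF refl], subst sum.swap, rule refl)
  then show ?thesis unfolding sum_cis_over_index by (simp add: sum_distrib_left mult_ac)
qed

text \<open>
  The limit is a combination of sawtooths with their jumps at the differences of the grid points.
  Their slopes add up to a multiple of \<open>\<bar>\<Sum>j. J j\<bar>\<^sup>2 = 0\<close>, so the limit is constant between grid
  points. At \<open>0\<close> only the diagonal terms jump, by a multiple of \<open>\<Sum>j. \<bar>J j\<bar>\<^sup>2 > 0\<close>, so the constants
  on the two adjacent arcs cannot both vanish; \<open>\<sigma>\<close> is the side on which the constant \<open>D\<close> is
  nonzero.
\<close>

lemma autocorrelation_series_tendsto:
  assumes J0: "(\<Sum>j<q. J j) = 0" and Jn: "\<exists>j<q. J j \<noteq> 0" and q: "q \<ge> 1"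
  obtains \<sigma> D where "\<sigma> = 1 \<or> \<sigma> = (-1::real)" "D \<noteq> 0"
    "\<And>y p. 0 < \<sigma> * y \<Longrightarrow> \<sigma> * y < 2 * pi / real q \<Longrightarrow>
      (\<lambda>N. autocorrelation_series J q N (y + 2 * pi * of_int p)) \<longlonglongrightarrow> D"
proof -
  define d where "d = 2 * pi / real q"
  have d: "d > 0" "d * real q = 2 * pi" using q by (auto simp: d_def)
  \<comment> \<open>the sign of \<open>2 * pi / q * (j - l) + y\<close>, where \<open>\<sigma>\<close> is that of \<open>y\<close>\<close>
  define S where "S \<sigma> j l = (if j = l then \<sigma> else if l < j then 1 else (-1::real))" for \<sigma> :: real and j l :: nat
  define D where "D \<sigma> = - \<i> * (\<Sum>j<q. \<Sum>l<q. J j * cnj (J l) * of_real (S \<sigma> j l * pi - d * (real j - real l)))" for \<sigma>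
  have lim: "(\<lambda>N. autocorrelation_series J q N (y + 2 * pi * of_int p)) \<longlonglongrightarrow> D \<sigma>"
    if s: "\<sigma> = 1 \<or> \<sigma> = -1" and y: "0 < \<sigma> * y" "\<sigma> * y < d" for \<sigma> y p
  proof -
    have ss: "(\<lambda>N. sine_sum N (d * (real j - real l) + (y + 2 * pi * of_int p))) \<longlonglongrightarrow> (S \<sigma> j l * pi - (d * (real j - real l) + y)) / 2"
      if jl: "j < q" "l < q" for j l
    proof -
      define z where "z = d * (real j - real l) + y"
      have ya: "\<bar>y\<bar> < d" "y \<noteq> 0" "sgn y = \<sigma>" using s y by auto
      have b1: "d * (real j - real l) \<le> d * (real q - 1)" using jl d by (intro mult_left_mono) auto
      have b2: "d * (real l - real j) \<le> d * (real q - 1)" using jl d by (intro mult_left_mono) auto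
      have z2: "\<bar>z\<bar> < 2 * pi" using b1 b2 ya(1) d(2) unfolding z_def by (simp add: algebra_simps)
      have zs: "z \<noteq> 0 \<and> sgn z = S \<sigma> j l"
      proof (cases j l rule: linorder_cases)
        case equal then show ?thesis using ya by (simp add: z_def S_def)
      next
        case less
        then have "d * 1 \<le> d * (real l - real j)" using d by (intro mult_left_mono) auto
        then have "z < 0" using ya unfolding z_def by (simp add: algebra_simps)
        then show ?thesis using less by (simp add: S_def)
      next
        case greater
        then have "d * 1 \<le> d * (real j - real l)" using d by (intro mult_left_mono) auto
        then have "z > 0" using ya unfolding z_def by (simp add: algebra_simps)
        then show ?thesis using greater by (simp add: S_def)
      qed
      have "(\<lambda>N. sine_sum N z) \<longlonglongrightarrow> (sgn z * pi - z) / 2"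
        using zs z2 by (intro sine_sum_tendsto) auto
      then show ?thesis using zs sine_sum_periodic[of _ z p] by (simp add: z_def algebra_simps)
    qed
    have "(\<lambda>N. autocorrelation_series J q N (y + 2 * pi * of_int p)) \<longlonglongrightarrow>
      - 2 * \<i> * (\<Sum>j<q. \<Sum>l<q. J j * cnj (J l) * of_real ((S \<sigma> j l * pi - (d * (real j - real l) + y)) / 2))"
      unfolding autocorrelation_series_eq d_def[symmetric]
      by (intro tendsto_intros ss) auto
    moreover have t: "- 2 * \<i> * (J j * cnj (J l) * of_real ((S \<sigma> j l * pi - (d * (real j - real l) + y)) / 2))
      = - \<i> * (J j * cnj (J l) * of_real (S \<sigma> j l * pi - d * (real j - real l))) + \<i> * of_real y * (J j * cnj (J l))" for j l
      by (simp add: field_simps)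
    have "- 2 * \<i> * (\<Sum>j<q. \<Sum>l<q. J j * cnj (J l) * of_real ((S \<sigma> j l * pi - (d * (real j - real l) + y)) / 2))
      = D \<sigma> + \<i> * of_real y * ((\<Sum>j<q. J j) * cnj (\<Sum>j<q. J j))"
      unfolding D_def cnj_sum sum_product unfolding sum_distrib_left t sum.distrib ..
    ultimately show ?thesis using J0 by simp
  qed
  have "D 1 - D (-1) = - 2 * pi * \<i> * (\<Sum>j<q. of_real ((cmod (J j))\<^sup>2))"
  proof -
    have "D 1 - D (-1) = - \<i> * (\<Sum>j<q. \<Sum>l<q. if l = j then J j * cnj (J l) * (2 * pi) else 0)"
      unfolding D_def right_diff_distrib[symmetric] sum_subtractf[symmetric]
      by (intro arg_cong2[of _ _ _ _ "(*)"] sum.cong refl) (auto simp: S_def algebra_simps)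
    also have "\<dots> = - \<i> * (\<Sum>j<q. J j * cnj (J j) * (2 * pi))" by simp
    also have "\<dots> = - 2 * pi * \<i> * (\<Sum>j<q. of_real ((cmod (J j))\<^sup>2))"
      unfolding complex_norm_square by (simp add: sum_distrib_left sum_negf mult_ac)
    finally show ?thesis .
  qed
  moreover have "(\<Sum>j<q. (cmod (J j))\<^sup>2) > 0"
    using Jn by (auto intro!: sum_pos2)
  then have "(\<Sum>j<q. complex_of_real ((cmod (J j))\<^sup>2)) \<noteq> 0"
    by (metis of_real_eq_0_iff of_real_sum less_irrefl)
  ultimately have "D 1 \<noteq> 0 \<or> D (-1) \<noteq> 0" by auto
  then obtain \<sigma> where "\<sigma> = 1 \<or> \<sigma> = -1" "D \<sigma> \<noteq> 0" by blast
  then show thesis using lim that unfolding d_def by blast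
qed

lemma norm_jump_transform_le: "cmod (jump_transform J q k) \<le> (\<Sum>j<q. cmod (J j))"
  unfolding jump_transform_def by (rule sum_norm_le) (simp add: norm_mult)

section \<open>Multiples at which the coefficients are large\<close>

lemma norm_one_minus_mult_le:
  fixes a b :: complex
  assumes "norm a = 1" shows "norm (1 - a * b) \<le> norm (1 - a) + norm (1 - b)"
proof -
  have "1 - a * b = (1 - a) + a * (1 - b)" by (simp add: algebra_simps)
  then have "norm (1 - a * b) \<le> norm (1 - a) + norm (a * (1 - b))" by (metis norm_triangle_ineq)
  then show ?thesis using assms by (simp add: norm_mult)
qed

text \<open>
  If a quadratic phase were close to \<open>1\<close> at three points in arithmetic progression, then so would be
  its second difference, which does not depend on \<open>n\<close>.
\<close>

lemma quadratic_phase_second_difference: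
  fixes \<theta> :: real and n r :: nat
  defines "w \<equiv> \<lambda>e::nat. cis (\<theta> * (real (n + r * e))\<^sup>2)"
  shows "\<exists>e\<le>2. norm (1 - w e) \<ge> norm (1 - cis (2 * \<theta> * (real r)\<^sup>2)) / 4"
proof (rule ccontr)
  assume "\<not> ?thesis"
  then have lt: "norm (1 - w e) < norm (1 - cis (2 * \<theta> * (real r)\<^sup>2)) / 4" if "e \<le> 2" for e
    using that by (meson not_le)
  have "cis (2 * \<theta> * (real r)\<^sup>2) = w 0 * (w 2 * (cnj (w 1) * cnj (w 1)))"
    unfolding w_def cis_cnj cis_mult by (simp add: power2_eq_square algebra_simps)
  moreover have n1: "norm (w e) = 1" "norm (cnj (w e)) = 1" for e by (simp_all add: w_def)
  moreover have "norm (1 - cnj (w 1)) = norm (1 - w 1)"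
    by (metis complex_cnj_diff complex_cnj_one complex_mod_cnj)
  ultimately have "norm (1 - cis (2 * \<theta> * (real r)\<^sup>2)) \<le> norm (1 - w 0) + (norm (1 - w 2) + (norm (1 - w 1) + norm (1 - w 1)))"
    using norm_one_minus_mult_le[of "w 0" "w 2 * (cnj (w 1) * cnj (w 1))"]
      norm_one_minus_mult_le[of "w 2" "cnj (w 1) * cnj (w 1)"] norm_one_minus_mult_le[of "cnj (w 1)" "cnj (w 1)"]
    by simp
  then show False using lt[of 0] lt[of 1] lt[of 2] by simp
qed

text \<open>
  Choose \<open>r\<close> such that \<open>2 * t * q * r\<close> is a small nonzero step modulo \<open>2 * pi\<close>. From any starting
  point, boundedly many steps of length \<open>r\<close> enter the target arc, and the step is so small that
  three consecutive multiples lie in it. One of these three has a large factor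
  \<open>\<bar>1 - cis (2 * t * (q * n)\<^sup>2)\<bar>\<close> by the second difference of the phase.
\<close>

lemma syndetic_good_multiples:
  fixes t \<sigma> :: real and q :: nat
  assumes t: "t / pi \<notin> \<rat>" and q: "q \<ge> 1" and \<sigma>: "\<sigma> = 1 \<or> \<sigma> = -1"
  obtains L c where "L \<ge> (1::nat)" "c > 0"
    "\<And>n0. \<exists>n\<ge>n0. n < n0 + L \<and> norm (1 - cis (2 * t * (real (q * n))\<^sup>2)) \<ge> c \<and>
       (\<exists>y p. 2 * t * real (q * n) = y + 2 * pi * of_int p \<and> 0 < \<sigma> * y \<and> \<sigma> * y < 2 * pi / real q)"
proof -
  define \<beta> where "\<beta> = real q * (t / pi)"
  have \<beta>: "\<beta> \<notin> \<rat>"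
  proof
    assume "\<beta> \<in> \<rat>"
    then have "\<beta> / real q \<in> \<rat>" by simp
    then show False using t q by (simp add: \<beta>_def)
  qed
  have q0: "real q > 0" using q by simp
  \<comment> \<open>the fractional part is positive and below \<open>1 / (4 * q)\<close>: three steps fit into an arc of length \<open>1 / q\<close>\<close>
  obtain r where r: "r > 0" "\<bar>frac (real r * \<beta>) - 1 / (8 * real q)\<bar> < 1 / (8 * real q)"
    by (rule Kronecker_approx_1_explicit[OF \<beta>, of "1 / (8 * real q)" "1 / (8 * real q)"]) (use q in auto)
  define \<eta> where "\<eta> = frac (real r * \<beta>)"
  define P where "P = \<lfloor>real r * \<beta>\<rfloor>"
  have rb: "real r * \<beta> = of_int P + \<eta>" by (simp add: P_def \<eta>_def frac_def)
  define \<alpha> where "\<alpha> = 1 / (8 * real q)"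
  have "0 < \<eta>" "\<eta> < 2 * \<alpha>" using r(2) unfolding \<eta>_def \<alpha>_def[symmetric] by linarith+
  moreover have "2 * \<alpha> = (1 / real q) / 4" by (simp add: \<alpha>_def)
  ultimately have \<eta>: "0 < \<eta>" "\<eta> < (1 / real q) / 4" by auto
  define K where "K = nat \<lceil>1 / \<eta>\<rceil> + 4"
  define \<theta> where "\<theta> = 2 * t * (real q)\<^sup>2"
  define c where "c = norm (1 - cis (2 * \<theta> * (real r)\<^sup>2)) / 4"
  have "c > 0"
  proof -
    have "sin (2 * \<theta> * (real r)\<^sup>2) \<noteq> 0"
      using irrational_sin_nonzero[OF t, of "4 * (int q)\<^sup>2 * (int r)\<^sup>2"] q r(1) by (simp add: \<theta>_def mult_ac)
    then have "cis (2 * \<theta> * (real r)\<^sup>2) \<noteq> 1" by (auto simp: complex_eq_iff)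
    then show ?thesis by (simp add: c_def)
  qed
  show thesis
  proof (rule that[of "r * K + 1" c])
    fix n0 :: nat
    define x0 where "x0 = real n0 * \<beta>"
    define A where "A = (if \<sigma> = 1 then 0 else - (1 / real q))"
    define P' where "P' = \<lfloor>x0 - A\<rfloor> + 1"
    have P': "x0 < A + of_int P'" "A + of_int P' \<le> x0 + 1" unfolding P'_def by linarith+
    \<comment> \<open>the number of steps of length \<open>\<eta>\<close> from \<open>x0\<close> to the left end of the arc\<close>
    define v where "v = (A + of_int P' - x0) / \<eta>"
    have v: "0 < v" "v \<le> 1 / \<eta>" using P' \<eta>(1) unfolding v_def by (auto intro!: divide_right_mono)
    define i where "i = nat (\<lfloor>v\<rfloor> + 1)"
    have i: "v < real i" "real i \<le> v + 1" unfolding i_def using v(1) by linarith+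
    have v\<eta>: "v * \<eta> = A + of_int P' - x0" using \<eta>(1) by (simp add: v_def)
    have loc: "A + of_int P' < x0 + (real i + real e) * \<eta>" "x0 + (real i + real e) * \<eta> < A + of_int P' + 1 / real q"
      if "e \<le> 2" for e
    proof -
      have "v * \<eta> < (real i + real e) * \<eta>" using i \<eta> by (intro mult_strict_right_mono) auto
      then show "A + of_int P' < x0 + (real i + real e) * \<eta>" using v\<eta> by simp
      have "(real i + real e) * \<eta> \<le> (v + 3) * \<eta>" using i \<eta> that by (intro mult_right_mono) auto
      then show "x0 + (real i + real e) * \<eta> < A + of_int P' + 1 / real q" using v\<eta> \<eta> by (simp add: distrib_right)
    qed
    obtain e where e: "e \<le> 2" "norm (1 - cis (\<theta> * (real (n0 + r * i + r * e))\<^sup>2)) \<ge> c"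
      using quadratic_phase_second_difference[of \<theta> r "n0 + r * i"] unfolding c_def by auto
    define n where "n = n0 + r * (i + e)"
    define w where "w = x0 + (real i + real e) * \<eta> - of_int P'"
    have nb: "real n * \<beta> = w + of_int (P' + (int i + int e) * P)"
    proof -
      have "real n * \<beta> = x0 + (real i + real e) * (real r * \<beta>)" by (simp add: n_def x0_def algebra_simps)
      then show ?thesis unfolding rb by (simp add: w_def algebra_simps)
    qed
    have "\<lceil>1 / \<eta>\<rceil> > 0" using \<eta>(1) by simp
    then have "real i + real e \<le> real K" using i v e(1) unfolding K_def by linarith
    then have "i + e \<le> K" by simp
    then have "n < n0 + (r * K + 1)" by (simp add: n_def less_Suc_eq_le)
    moreover have "norm (1 - cis (2 * t * (real (q * n))\<^sup>2)) \<ge> c"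
    proof -
      have n: "n0 + r * i + r * e = n" by (simp add: n_def distrib_left)
      show ?thesis using e(2) unfolding n by (simp add: \<theta>_def power_mult_distrib mult_ac)
    qed
    moreover have "2 * t * real (q * n) = 2 * pi * w + 2 * pi * of_int (P' + (int i + int e) * P)"
    proof -
      have "2 * t * real (q * n) = 2 * pi * (real n * \<beta>)" by (simp add: \<beta>_def)
      then show ?thesis unfolding nb by (simp add: distrib_left)
    qed
    moreover have "0 < \<sigma> * (2 * pi * w) \<and> \<sigma> * (2 * pi * w) < 2 * pi / real q"
    proof (cases "\<sigma> = 1")
      case True
      then have "0 < w" "w < 1 / real q" using loc[OF e(1)] by (auto simp: w_def A_def)
      then have "2 * pi * w < 2 * pi * (1 / real q)" by (intro mult_strict_left_mono) auto
      then show ?thesis using True \<open>0 < w\<close> by simp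
    next
      case False
      then have "0 < - w" "- w < 1 / real q" using loc[OF e(1)] by (auto simp: w_def A_def)
      then have "2 * pi * (- w) < 2 * pi * (1 / real q)" by (intro mult_strict_left_mono) auto
      then show ?thesis using False \<sigma> \<open>0 < - w\<close> by (auto simp: mult_pos_neg)
    qed
    moreover have "n \<ge> n0" by (simp add: n_def)
    ultimately show "\<exists>n\<ge>n0. n < n0 + (r * K + 1) \<and> norm (1 - cis (2 * t * (real (q * n))\<^sup>2)) \<ge> c \<and>
       (\<exists>y p. 2 * t * real (q * n) = y + 2 * pi * of_int p \<and> 0 < \<sigma> * y \<and> \<sigma> * y < 2 * pi / real q)"
      by blast
  qed (use \<open>c > 0\<close> in auto)
qed

section \<open>Fourier coefficients of the intensity\<close>

lemma integral_cis_period: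
  "((\<lambda>x. cis (of_int n * x)) has_integral (if n = 0 then 2 * of_real pi else 0)) {0..2 * pi}"
proof (cases "n = 0")
  case True
  then show ?thesis using has_integral_const_real[of "1::complex" 0 "2 * pi"] by (simp add: scaleR_conv_of_real)
next
  case False
  have "((\<lambda>x. cis (of_int n * x)) has_integral 
     cis (of_int n * (2 * pi)) / (\<i> * of_int n) - cis (of_int n * 0) / (\<i> * of_int n)) {0..2 * pi}"
  proof (rule fundamental_theorem_of_calculus)
    fix x assume "x \<in> {0..2 * pi}"
    have "((\<lambda>x. cis (of_int n * x)) has_vector_derivative of_int n *\<^sub>R (\<i> * cis (of_int n * x))) (at x within {0..2 * pi})"
      unfolding has_vector_derivative_def
      by (auto intro!: derivative_eq_intros simp: algebra_simps scaleR_conv_of_real)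
    then have "((\<lambda>x. cis (of_int n * x) / (\<i> * of_int n)) has_vector_derivative (of_int n *\<^sub>R (\<i> * cis (of_int n * x))) / (\<i> * of_int n)) (at x within {0..2 * pi})"
      by (rule has_vector_derivative_divide)
    then show "((\<lambda>x. cis (of_int n * x) / (\<i> * of_int n)) has_vector_derivative cis (of_int n * x)) (at x within {0..2 * pi})"
      using False by (simp add: scaleR_conv_of_real)
  qed simp
  moreover have "cis (of_int n * (2 * pi)) = 1" using cis_multiple_2pi[of "of_int n"] by (simp add: mult.commute)
  ultimately show ?thesis using False by simp
qed

lemma trig_parseval:
  assumes "finite A"
  shows "((\<lambda>x. (norm (\<Sum>m\<in>A. c m * cis (of_int m * x)))\<^sup>2) has_integral 2 * pi * (\<Sum>m\<in>A. (norm (c m))\<^sup>2)) {0..2 * pi}"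
proof -
  have eq: "of_real ((norm (\<Sum>m\<in>A. c m * cis (of_int m * x)))\<^sup>2) = (\<Sum>m\<in>A. \<Sum>n\<in>A. c m * cnj (c n) * cis (of_int (m - n) * x))" for x
  proof -
    have "cis (of_int (m - n) * x) = cis (of_int m * x) * cnj (cis (of_int n * x))" for m n :: int
      unfolding cis_cnj cis_mult by (simp add: algebra_simps)
    then show ?thesis unfolding complex_norm_square cnj_sum sum_product by (intro sum.cong refl) simp
  qed
  have "((\<lambda>x. \<Sum>m\<in>A. \<Sum>n\<in>A. c m * cnj (c n) * cis (of_int (m - n) * x)) has_integral 
     (\<Sum>m\<in>A. \<Sum>n\<in>A. c m * cnj (c n) * (if m - n = 0 then 2 * of_real pi else 0))) {0..2 * pi}"
    using assms by (intro has_integral_sum has_integral_mult_right integral_cis_period)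
  also have "(\<Sum>m\<in>A. \<Sum>n\<in>A. c m * cnj (c n) * (if m - n = 0 then 2 * of_real pi else 0)) = of_real (2 * pi * (\<Sum>m\<in>A. (norm (c m))\<^sup>2))"
  proof -
    have "(\<Sum>n\<in>A. c m * cnj (c n) * (if m - n = 0 then 2 * of_real pi else 0)) = (\<Sum>n\<in>A. if m = n then c m * cnj (c n) * (2 * of_real pi) else 0)" for m
      by (intro sum.cong) auto
    moreover have "\<dots> m = (if m \<in> A then c m * cnj (c m) * (2 * of_real pi) else 0)" for m using assms by simp
    ultimately show ?thesis by (simp add: complex_norm_square sum_distrib_left mult_ac del: of_real_power)
  qed
  finally have "((\<lambda>x. of_real ((norm (\<Sum>m\<in>A. c m * cis (of_int m * x)))\<^sup>2)) has_integral complex_of_real (2 * pi * (\<Sum>m\<in>A. (norm (c m))\<^sup>2))) {0..2 * pi}"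
    unfolding eq .
  from has_integral_linear[OF this bounded_linear_Re] show ?thesis by (simp add: o_def)
qed

text \<open>
  The Fourier coefficient at \<open>m\<close> of the squared modulus of the trigonometric polynomial with
  coefficients \<open>s\<close> on \<open>{- N..N}\<close>.
\<close>

definition intensity_coeff :: "(int \<Rightarrow> complex) \<Rightarrow> nat \<Rightarrow> int \<Rightarrow> complex" where
  "intensity_coeff s N m = (\<Sum>p\<in>{p \<in> {- int N..int N} \<times> {- int N..int N}. fst p - snd p = m}. s (fst p) * cnj (s (snd p)))"

lemma norm_square_trig_sum:
  fixes s :: "int \<Rightarrow> complex"
  defines "S \<equiv> \<lambda>N x. \<Sum>k\<in>{- int N..int N}. s k * cis (of_int k * x)"
  shows "S N x * cnj (S N x) = (\<Sum>m\<in>{- 2 * int N..2 * int N}. intensity_coeff s N m * cis (of_int m * x))"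
proof -
  let ?A = "{- int N..int N}"
  have "S N x * cnj (S N x) = (\<Sum>p\<in>?A \<times> ?A. s (fst p) * cnj (s (snd p)) * cis (of_int (fst p - snd p) * x))"
  proof -
    have "cis (of_int (m - n) * x) = cis (of_int m * x) * cnj (cis (of_int n * x))" for m n :: int
      unfolding cis_cnj cis_mult by (simp add: algebra_simps)
    then show ?thesis unfolding S_def cnj_sum sum_product sum.cartesian_product
      by (intro sum.cong refl) (auto simp: case_prod_beta)
  qed
  also have "\<dots> = (\<Sum>m\<in>{- 2 * int N..2 * int N}. \<Sum>p\<in>{p \<in> ?A \<times> ?A. fst p - snd p = m}. s (fst p) * cnj (s (snd p)) * cis (of_int (fst p - snd p) * x))"
    by (intro sum.group[symmetric]) auto
  also have "\<dots> = (\<Sum>m\<in>{- 2 * int N..2 * int N}. intensity_coeff s N m * cis (of_int m * x))"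
    unfolding intensity_coeff_def sum_distrib_right by (intro sum.cong) auto
  finally show ?thesis .
qed

lemma uniform_limit_norm_square:
  fixes l :: "'b \<Rightarrow> complex"
  assumes "uniform_limit X f l F" "bounded (l ` X)"
  shows "uniform_limit X (\<lambda>n x. (norm (f n x))\<^sup>2) (\<lambda>x. (norm (l x))\<^sup>2) F"
proof -
  have "(norm z)\<^sup>2 = Re (z * cnj z)" for z unfolding cmod_power2 by (simp add: power2_eq_square)
  moreover have "bounded ((\<lambda>x. cnj (l x)) ` X)" using assms(2) by (auto simp: bounded_iff)
  then have "uniform_limit X (\<lambda>n x. Re (f n x * cnj (f n x))) (\<lambda>x. Re (l x * cnj (l x))) F"
    using assms by (intro bounded_linear_uniform_limit_intros(2) uniform_lim_mult bounded_linear_uniform_limit_intros(3))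
  ultimately show ?thesis by simp
qed

lemma integral_uniform_limit_tendsto:
  fixes f :: "nat \<Rightarrow> real \<Rightarrow> real"
  assumes "uniform_limit {a..b} f g sequentially" "\<And>n. continuous_on {a..b} (f n)"
  shows "(\<lambda>n. integral {a..b} (f n)) \<longlonglongrightarrow> integral {a..b} g"
proof -
  obtain I J where *: "\<And>n. (f n has_integral I n) {a..b}" "(g has_integral J) {a..b}" "I \<longlonglongrightarrow> J"
    by (rule uniform_limit_integral[OF assms]) auto
  then show ?thesis unfolding integral_unique[OF *(1)] integral_unique[OF *(2)] by simp
qed

text \<open>
  For the trigonometric polynomials this is Parseval's identity with all but finitely many terms
  dropped, and the inequality survives the uniform limit. The
  coefficients \<open>c m\<close> of \<open>\<bar>u\<bar>\<^sup>2\<close> enter as limits of explicit sums.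
\<close>

lemma increments_bessel:
  fixes s :: "int \<Rightarrow> complex" and c :: "int \<Rightarrow> complex" and S :: "nat \<Rightarrow> real \<Rightarrow> complex"
  assumes S: "\<And>N x. S N x = (\<Sum>k\<in>{- int N..int N}. s k * cis (of_int k * x))"
    and u: "uniform_limit UNIV S u sequentially" and b: "bounded (range u)" and F: "finite F"
    and c: "\<And>m. m \<in> F \<Longrightarrow> (\<lambda>N. intensity_coeff s N m) \<longlonglongrightarrow> c m"
  shows "2 * pi * (\<Sum>m\<in>F. (norm (c m))\<^sup>2 * (norm (cis (of_int m * h) - 1))\<^sup>2)
    \<le> integral {0..2 * pi} (\<lambda>x. ((norm (u (x + h)))\<^sup>2 - (norm (u x))\<^sup>2)\<^sup>2)"
proof -
  define P where "P N x = (norm (S N x))\<^sup>2" for N x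
  define Q where "Q x = (norm (u x))\<^sup>2" for x
  have Pc: "continuous_on A (P N)" for N A unfolding P_def S by (intro continuous_intros)
  have PQ: "uniform_limit UNIV P Q sequentially"
    unfolding P_def Q_def using u b by (rule uniform_limit_norm_square)
  have shift: "uniform_limit {0..2*pi} (\<lambda>N x. P N (x + d)) (\<lambda>x. Q (x + d)) sequentially" for d
    using PQ unfolding uniform_limit_iff by (auto elim!: eventually_mono)
  obtain B where "\<And>x. norm (u x) \<le> B" using b by (auto simp: bounded_iff)
  then have QB: "norm (Q x) \<le> B\<^sup>2" for x unfolding Q_def by (simp add: power_mono)
  have bd: "bounded ((\<lambda>x. Q (x + h) - Q (x + 0)) ` {0..2*pi})"
    unfolding bounded_iff
  proof (intro exI[of _ "B\<^sup>2 + B\<^sup>2"] ballI)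
    fix y assume "y \<in> (\<lambda>x. Q (x + h) - Q (x + 0)) ` {0..2*pi}"
    then obtain x where "y = Q (x + h) - Q (x + 0)" by blast
    then show "norm y \<le> B\<^sup>2 + B\<^sup>2" using order_trans[OF norm_triangle_ineq4 add_mono[OF QB QB]] by blast
  qed
  define R where "R N x = (P N (x + h) - P N (x + 0))\<^sup>2" for N x
  have RR: "uniform_limit {0..2*pi} R (\<lambda>x. (Q (x + h) - Q (x + 0))\<^sup>2) sequentially"
    unfolding R_def power2_eq_square
    by (intro uniform_lim_mult uniform_limit_minus shift bd)
  have "continuous_on {0..2*pi} (R N)" for N
    unfolding R_def by (intro continuous_intros continuous_on_compose2[OF Pc]) auto
  from integral_uniform_limit_tendsto[OF RR this]
  have lim: "(\<lambda>N. integral {0..2*pi} (R N)) \<longlonglongrightarrow> integral {0..2*pi} (\<lambda>x. (Q (x + h) - Q x)\<^sup>2)" by simp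
  define w where "w m = (norm (cis (of_int m * h) - 1))\<^sup>2" for m
  have IR: "integral {0..2*pi} (R N) = 2 * pi * (\<Sum>m\<in>{- 2 * int N..2 * int N}. (norm (intensity_coeff s N m))\<^sup>2 * w m)" for N
  proof -
    have "R N x = (norm (\<Sum>m\<in>{- 2 * int N..2 * int N}. (intensity_coeff s N m * (cis (of_int m * h) - 1)) * cis (of_int m * x)))\<^sup>2" for x
    proof -
      have P: "of_real (P N y) = (\<Sum>m\<in>{- 2 * int N..2 * int N}. intensity_coeff s N m * cis (of_int m * y))" for y
        unfolding P_def complex_norm_square S by (rule norm_square_trig_sum)
      have sh: "cis (of_int m * (x + h)) = cis (of_int m * x) * cis (of_int m * h)" for m :: int
        unfolding cis_mult by (simp add: algebra_simps)
      have "complex_of_real (P N (x + h) - P N x) = (\<Sum>m\<in>{- 2 * int N..2 * int N}. (intensity_coeff s N m * (cis (of_int m * h) - 1)) * cis (of_int m * x))"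
        unfolding of_real_diff P sum_subtractf[symmetric] sh by (intro sum.cong refl) (simp add: algebra_simps)
      then have "(norm (complex_of_real (P N (x + h) - P N x)))\<^sup>2 = (norm (\<Sum>m\<in>{- 2 * int N..2 * int N}. (intensity_coeff s N m * (cis (of_int m * h) - 1)) * cis (of_int m * x)))\<^sup>2" by simp
      then show ?thesis unfolding R_def norm_of_real by simp
    qed
    then have "R N = (\<lambda>x. (norm (\<Sum>m\<in>{- 2 * int N..2 * int N}. (intensity_coeff s N m * (cis (of_int m * h) - 1)) * cis (of_int m * x)))\<^sup>2)" by blast
    then show ?thesis
      using integral_unique[OF trig_parseval[of "{- 2 * int N..2 * int N}" "\<lambda>m. intensity_coeff s N m * (cis (of_int m * h) - 1)"]]
      by (simp add: norm_mult power_mult_distrib w_def)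
  qed
  have "\<exists>K::nat. \<forall>m\<in>F. \<bar>m\<bar> \<le> int K"
  proof (intro exI ballI)
    fix m assume "m \<in> F"
    then have "\<bar>m\<bar> \<le> (\<Sum>m\<in>F. \<bar>m\<bar>)" using F by (intro member_le_sum) auto
    then show "\<bar>m\<bar> \<le> int (nat (\<Sum>m\<in>F. \<bar>m\<bar>))" by simp
  qed
  then obtain K where K: "\<And>m. m \<in> F \<Longrightarrow> \<bar>m\<bar> \<le> int K" by blast
  have "2 * pi * (\<Sum>m\<in>F. (norm (c m))\<^sup>2 * w m) \<le> integral {0..2*pi} (\<lambda>x. (Q (x + h) - Q x)\<^sup>2)"
  proof (rule tendsto_le[OF _ lim])
    show "(\<lambda>N. 2 * pi * (\<Sum>m\<in>F. (norm (intensity_coeff s N m))\<^sup>2 * w m)) \<longlonglongrightarrow> 2 * pi * (\<Sum>m\<in>F. (norm (c m))\<^sup>2 * w m)"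
      by (intro tendsto_intros c)
    show "\<forall>\<^sub>F N in sequentially. 2 * pi * (\<Sum>m\<in>F. (norm (intensity_coeff s N m))\<^sup>2 * w m) \<le> integral {0..2*pi} (R N)"
    proof (rule eventually_sequentiallyI[of K])
      fix N assume "N \<ge> K"
      then have "F \<subseteq> {- 2 * int N..2 * int N}" using K by fastforce
      then show "2 * pi * (\<Sum>m\<in>F. (norm (intensity_coeff s N m))\<^sup>2 * w m) \<le> integral {0..2*pi} (R N)"
        unfolding IR by (intro mult_left_mono sum_mono2) (auto simp: w_def)
    qed
  qed simp
  then show ?thesis unfolding w_def Q_def .
qed

text \<open>
  The mean \<open>a0\<close> of a step function is not determined by its jumps.
\<close>

definition step_coeff :: "(nat \<Rightarrow> complex) \<Rightarrow> nat \<Rightarrow> complex \<Rightarrow> int \<Rightarrow> complex" where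
  "step_coeff J q a0 k = (if k = 0 then a0 else jump_transform J q k / (2 * of_real pi * \<i> * of_int k))"

definition evolved_coeff :: "(nat \<Rightarrow> complex) \<Rightarrow> nat \<Rightarrow> complex \<Rightarrow> real \<Rightarrow> int \<Rightarrow> complex" where
  "evolved_coeff J q a0 t k = cis (- (of_int k)\<^sup>2 * t) * step_coeff J q a0 k"

lemma intensity_coeff_nonneg:
  "intensity_coeff s N (int m) = (\<Sum>k\<in>{- int N..int N - int m}. s (k + int m) * cnj (s k))"
  unfolding intensity_coeff_def
  by (rule sum.reindex_bij_witness[where i="\<lambda>k. (k + int m, k)" and j=snd]) (auto simp: diff_eq_eq add.commute)

text \<open>
  The quadratic parts of the phases of \<open>s (k + m)\<close> and \<open>cnj (s k)\<close> cancel up to a constant, leaving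
  the phase \<open>- 2 * k * m * t\<close>. Since \<open>q\<close> divides \<open>m\<close>, the jump transform takes the same value at
  \<open>k\<close> and \<open>k + m\<close>, so a partial fraction decomposition of \<open>1 / (k * (k + m))\<close> leaves two
  autocorrelation series at \<open>2 * t * m\<close>, one of them shifted by \<open>m\<close>. The terms with \<open>a0\<close>
  disappear because the jump transform vanishes at the multiples of \<open>q\<close>.
\<close>

lemma intensity_coeff_tendsto:
  fixes J :: "nat \<Rightarrow> complex" and a0 :: complex and t :: real
  assumes J0: "(\<Sum>j<q. J j) = 0" and q: "q \<ge> 1" and m: "m \<ge> 1" "q dvd m"
    and D: "(\<lambda>N. autocorrelation_series J q N (2 * t * real m)) \<longlonglongrightarrow> D"
  shows "(\<lambda>N. intensity_coeff (evolved_coeff J q a0 t) N (int m)) \<longlonglongrightarrow>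
    cis (- (real m)\<^sup>2 * t) / (4 * (of_real pi)\<^sup>2 * of_nat m) * ((1 - cis (2 * t * (real m)\<^sup>2)) * D)"
proof -
  let ?a = "jump_transform J q" and ?s = "evolved_coeff J q a0 t"
  define T where "T k = ?a k * cnj (?a k) * cis (- of_int k * (2 * t * real m)) / of_int k" for k :: int
  define pre where "pre = cis (- (real m)\<^sup>2 * t) / (4 * (of_real pi)\<^sup>2 * of_nat m)"
  define z where "z = cis (2 * t * (real m)\<^sup>2)"
  have per: "?a (k + int m) = ?a k" for k using m q by (intro jump_transform_periodic) auto
  have a0: "?a 0 = 0" using J0 by (simp add: jump_transform_def)
  have am: "?a (int m) = 0" "?a (- int m) = 0" using per[of 0] per[of "- int m"] a0 by auto
  have summand: "?s (k + int m) * cnj (?s k) = pre * (T k - z * T (k + int m))" for k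
  proof -
    consider "k = 0" | "k = - int m" | "k \<noteq> 0" "k + int m \<noteq> 0" by linarith
    then show ?thesis
    proof cases
      case 1
      then show ?thesis using m am by (simp add: evolved_coeff_def step_coeff_def T_def)
    next
      case 2
      then show ?thesis using m am by (simp add: evolved_coeff_def step_coeff_def T_def)
    next
      case 3
      have nz: "complex_of_int k \<noteq> 0" "complex_of_int (k + int m) \<noteq> 0" "(of_nat m :: complex) \<noteq> 0"
        using 3 m by (auto simp del: of_int_add)
      have ph: "cis (- (of_int (k + int m))\<^sup>2 * t) * cnj (cis (- (of_int k)\<^sup>2 * t)) = cis (- (real m)\<^sup>2 * t) * cis (- of_int k * (2 * t * real m))"
        unfolding cis_cnj cis_mult by (simp add: power2_eq_square algebra_simps)
      have zz: "z * cis (- of_int (k + int m) * (2 * t * real m)) = cis (- of_int k * (2 * t * real m))"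
        unfolding z_def cis_mult by (simp add: power2_eq_square algebra_simps)
      have "?s (k + int m) * cnj (?s k) = (cis (- (of_int (k + int m))\<^sup>2 * t) * cnj (cis (- (of_int k)\<^sup>2 * t))) * (?a k * cnj (?a k))
         * (1 / ((2 * of_real pi * \<i> * of_int (k + int m)) * cnj (2 * of_real pi * \<i> * of_int k)))"
        using 3 by (simp add: evolved_coeff_def step_coeff_def per)
      also have "1 / ((2 * of_real pi * \<i> * of_int (k + int m)) * cnj (2 * of_real pi * \<i> * of_int k)) = 1 / (4 * (of_real pi)\<^sup>2) * (1 / (of_int (k + int m) * of_int k :: complex))"
      proof -
        have eq: "(2 * of_real pi * \<i> * of_int x) * cnj (2 * of_real pi * \<i> * of_int y) = (4 * (of_real pi)\<^sup>2) * (of_int x * of_int y)" for x y :: int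
          by (simp add: complex_eq_iff power2_eq_square)
        show ?thesis unfolding eq by simp
      qed
      also have "1 / (of_int (k + int m) * of_int k :: complex) = (1 / of_nat m) * (1 / of_int k - 1 / of_int (k + int m))"
        using nz by (simp add: divide_simps)
      finally have "?s (k + int m) * cnj (?s k) = pre * (?a k * cnj (?a k) * cis (- of_int k * (2 * t * real m)) * (1 / of_int k - 1 / of_int (k + int m)))"
        unfolding ph pre_def by simp
      also have "?a k * cnj (?a k) * cis (- of_int k * (2 * t * real m)) * (1 / of_int k - 1 / of_int (k + int m)) = T k - z * T (k + int m)"
        unfolding T_def per zz[symmetric] by (simp add: right_diff_distrib)
      finally show ?thesis .
    qed
  qed
  define H where "H N = (\<Sum>k\<in>{- int N..int N}. T k)" for N :: nat
  have HD: "H \<longlonglongrightarrow> D" using D unfolding H_def T_def autocorrelation_series_def .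
  define A where "A = (\<Sum>j<q. cmod (J j))"
  have Tb: "norm (T k) \<le> A\<^sup>2 / \<bar>of_int k\<bar>" for k
    using norm_jump_transform_le[of J q k, folded A_def] order_trans[OF norm_ge_zero norm_jump_transform_le[of J q k, folded A_def]]
    unfolding T_def by (auto simp: norm_mult norm_divide power2_eq_square intro!: divide_right_mono mult_mono)
  have edge: "(\<lambda>N. T (f N)) \<longlonglongrightarrow> 0" if "filterlim (\<lambda>N. \<bar>real_of_int (f N)\<bar>) at_top sequentially" for f
  proof (rule Lim_null_comparison)
    show "(\<lambda>N. A\<^sup>2 / \<bar>of_int (f N)\<bar>) \<longlonglongrightarrow> 0" using that by (intro real_tendsto_divide_at_top[OF tendsto_const])
  qed (use Tb in auto)
  \<comment> \<open>the summation ranges are symmetric up to \<open>m\<close> terms at one end, which tend to zero\<close>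
  have e1: "(\<lambda>N. \<Sum>i<m. T (int N - int i)) \<longlonglongrightarrow> 0"
  proof -
    have "(\<lambda>N. \<Sum>i<m. T (int N - int i)) \<longlonglongrightarrow> (\<Sum>i<m. 0)"
      by (intro tendsto_sum edge) (simp, real_asymp)
    then show ?thesis by simp
  qed
  have e2: "(\<lambda>N. \<Sum>i<m. T (int i - int N)) \<longlonglongrightarrow> 0"
  proof -
    have "(\<lambda>N. \<Sum>i<m. T (int i - int N)) \<longlonglongrightarrow> (\<Sum>i<m. 0)"
      by (intro tendsto_sum edge) (simp, real_asymp)
    then show ?thesis by simp
  qed
  have split: "intensity_coeff ?s N (int m) = pre * ((H N - (\<Sum>i<m. T (int N - int i))) - z * (H N - (\<Sum>i<m. T (int i - int N))))"
    if "N \<ge> m" for N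
  proof -
    have 1: "(\<Sum>k\<in>{- int N..int N - int m}. T k) = H N - (\<Sum>i<m. T (int N - int i))"
    proof -
      have "(\<Sum>i<m. T (int N - int i)) = (\<Sum>k\<in>{int N - int m<..int N}. T k)"
        by (rule sum.reindex_bij_witness[where i="\<lambda>k. nat (int N - k)" and j="\<lambda>i. int N - int i"]) auto
      moreover have "{- int N..int N} = {- int N..int N - int m} \<union> {int N - int m<..int N}" using that by auto
      ultimately show ?thesis unfolding H_def by (simp add: sum.union_disjoint ivl_disj_int)
    qed
    have 2: "(\<Sum>k\<in>{- int N..int N - int m}. T (k + int m)) = H N - (\<Sum>i<m. T (int i - int N))"
    proof -
      have "(\<Sum>i<m. T (int i - int N)) = (\<Sum>k\<in>{- int N..<int m - int N}. T k)"
        by (rule sum.reindex_bij_witness[where i="\<lambda>k. nat (k + int N)" and j="\<lambda>i. int i - int N"]) auto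
      moreover have "(\<Sum>k\<in>{- int N..int N - int m}. T (k + int m)) = (\<Sum>k\<in>{int m - int N..int N}. T k)"
        by (rule sum.reindex_bij_witness[where i="\<lambda>k. k - int m" and j="\<lambda>k. k + int m"]) auto
      moreover have "{- int N..int N} = {- int N..<int m - int N} \<union> {int m - int N..int N}" using that by auto
      ultimately show ?thesis unfolding H_def by (simp add: sum.union_disjoint ivl_disj_int)
    qed
    show ?thesis unfolding intensity_coeff_nonneg summand 1[symmetric] 2[symmetric]
      by (simp add: sum_subtractf sum_distrib_left right_diff_distrib)
  qed
  have "(\<lambda>N. pre * ((H N - (\<Sum>i<m. T (int N - int i))) - z * (H N - (\<Sum>i<m. T (int i - int N))))) \<longlonglongrightarrow> pre * ((D - 0) - z * (D - 0))"
    by (intro tendsto_intros HD e1 e2)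
  then have "(\<lambda>N. intensity_coeff ?s N (int m)) \<longlonglongrightarrow> pre * ((D - 0) - z * (D - 0))"
    by (rule Lim_transform_eventually) (auto intro!: eventually_sequentiallyI[of m] simp: split)
  then show ?thesis unfolding pre_def z_def by (simp add: left_diff_distrib)
qed

text \<open>
  With \<open>h = 1 / (q * L * K)\<close>, each of the \<open>K\<close> windows of length \<open>L\<close> between \<open>L * K\<close> and
  \<open>2 * L * K\<close> contributes a frequency \<open>m = q * n\<close> whose coefficient is at least of the order
  \<open>1 / K\<close>. There \<open>m * h\<close> lies between \<open>1\<close> and \<open>2\<close>, so the factor \<open>\<bar>cis (m * h) - 1\<bar>\<close> is bounded
  below.
\<close>

lemma increments_lower_bound:
  fixes J :: "nat \<Rightarrow> complex" and S :: "nat \<Rightarrow> real \<Rightarrow> complex"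
  assumes t: "t / pi \<notin> \<rat>" and q: "q \<ge> 1" and J0: "(\<Sum>j<q. J j) = 0" and Jn: "\<exists>j<q. J j \<noteq> 0"
    and S: "\<And>N x. S N x = (\<Sum>k\<in>{- int N..int N}. evolved_coeff J q a0 t k * cis (of_int k * x))"
    and u: "uniform_limit UNIV S u sequentially" and b: "bounded (range u)"
  obtains \<kappa> M0 where "\<kappa> > 0" "M0 \<ge> (1::nat)"
    "\<And>K h. K \<ge> (1::nat) \<Longrightarrow> h = 1 / (real M0 * real K) \<Longrightarrow>
      \<kappa> * h \<le> integral {0..2 * pi} (\<lambda>x. ((norm (u (x + h)))\<^sup>2 - (norm (u x))\<^sup>2)\<^sup>2)"
proof -
  obtain \<sigma> D where \<sigma>: "\<sigma> = 1 \<or> \<sigma> = (-1::real)" and D: "D \<noteq> 0"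
    "\<And>y p. 0 < \<sigma> * y \<Longrightarrow> \<sigma> * y < 2 * pi / real q \<Longrightarrow>
      (\<lambda>N. autocorrelation_series J q N (y + 2 * pi * of_int p)) \<longlonglongrightarrow> D"
    by (rule autocorrelation_series_tendsto[OF J0 Jn q]) blast
  obtain L c where L: "L \<ge> (1::nat)" "c > 0"
    "\<And>n0. \<exists>n\<ge>n0. n < n0 + L \<and> norm (1 - cis (2 * t * (real (q * n))\<^sup>2)) \<ge> c \<and>
       (\<exists>y p. 2 * t * real (q * n) = y + 2 * pi * of_int p \<and> 0 < \<sigma> * y \<and> \<sigma> * y < 2 * pi / real q)"
    by (rule syndetic_good_multiples[OF t q \<sigma>]) blast
  define good where "good n \<longleftrightarrow> norm (1 - cis (2 * t * (real (q * n))\<^sup>2)) \<ge> c \<and>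
       (\<exists>y p. 2 * t * real (q * n) = y + 2 * pi * of_int p \<and> 0 < \<sigma> * y \<and> \<sigma> * y < 2 * pi / real q)" for n
  define C where "C m = cis (- (of_int m)\<^sup>2 * t) / (4 * (of_real pi)\<^sup>2 * of_int m) * ((1 - cis (2 * t * (of_int m)\<^sup>2)) * D)" for m :: int
  have Clim: "(\<lambda>N. intensity_coeff (evolved_coeff J q a0 t) N (int (q * n))) \<longlonglongrightarrow> C (int (q * n))" if "good n" "n \<ge> 1" for n
  proof -
    have "(\<lambda>N. autocorrelation_series J q N (2 * t * real (q * n))) \<longlonglongrightarrow> D"
      using that(1) D(2) unfolding good_def by metis
    from intensity_coeff_tendsto[OF J0 q _ _ this, of a0] that(2) q show ?thesis by (simp add: C_def)
  qed
  define e where "e = c * norm D / (8 * pi\<^sup>2 * real q * real L)"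
  define w where "w = 2 - 2 * cos (1::real)"
  have "cos (1::real) < cos 0" using pi_gt3 by (intro cos_monotone_0_pi) auto
  then have w: "w > 0" by (simp add: w_def)
  have e: "e > 0" using L D q by (simp add: e_def)
  have Clow: "norm (C (int (q * n))) \<ge> e / real K" if "good n" "n \<ge> 1" "n \<le> 2 * (L * K)" for n K
  proof -
    have "real (q * n) \<le> real (q * (2 * (L * K)))" using that by (intro of_nat_mono mult_left_mono) auto
    then have "4 * pi\<^sup>2 * real (q * n) \<le> 4 * pi\<^sup>2 * real (q * (2 * (L * K)))" by (rule mult_left_mono) simp
    then have mle: "4 * pi\<^sup>2 * real (q * n) \<le> 8 * pi\<^sup>2 * real q * real L * real K" by (simp add: mult_ac)
    have mp: "0 < 4 * pi\<^sup>2 * real (q * n)" using q that by simp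
    have "e / real K = c * norm D / (8 * pi\<^sup>2 * real q * real L * real K)" by (simp add: e_def)
    also have "\<dots> \<le> c * norm D / (4 * pi\<^sup>2 * real (q * n))"
      using mle L(2) by (intro divide_left_mono mult_pos_pos mp less_le_trans[OF mp mle]) auto
    also have "\<dots> \<le> norm (1 - cis (2 * t * (real (q * n))\<^sup>2)) * norm D / (4 * pi\<^sup>2 * real (q * n))"
      using that(1) mp unfolding good_def by (intro divide_right_mono mult_right_mono) auto
    also have "\<dots> = norm (C (int (q * n)))"
      by (simp add: C_def norm_mult norm_divide norm_power)
    finally show ?thesis .
  qed
  show thesis
  proof (rule that[of "2 * pi * (e\<^sup>2 * w * real (q * L))" "q * L"])
    show "2 * pi * (e\<^sup>2 * w * real (q * L)) > 0" using e w q L by simp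
    show "q * L \<ge> 1" using q L by simp
    fix K :: nat and h assume K: "K \<ge> 1" and h: "h = 1 / (real (q * L) * real K)"
    have "\<exists>n. n \<ge> L * K + L * i \<and> n < L * K + L * i + L \<and> good n" for i
      using L(3)[of "L * K + L * i"] unfolding good_def by blast
    then obtain n where n: "\<And>i. n i \<ge> L * K + L * i" "\<And>i. n i < L * K + L * i + L" "\<And>i. good (n i)" by metis
    define F where "F = (\<lambda>i. int (q * n i)) ` {..<K}"
    have inj: "inj_on (\<lambda>i. int (q * n i)) {..<K}"
    proof (rule strict_mono_on_imp_inj_on)
      show "strict_mono_on {..<K} (\<lambda>i. int (q * n i))"
      proof (rule strict_mono_onI)
        fix i j :: nat assume "i < j"
        then have "L * (i + 1) \<le> L * j" by (intro mult_left_mono) auto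
        then have "n i < n j" using n(2)[of i] n(1)[of j] by (simp add: algebra_simps)
        then show "int (q * n i) < int (q * n j)" using q by simp
      qed
    qed
    have nb: "n i \<ge> L * K" "n i \<ge> 1" "n i < 2 * (L * K)" if "i < K" for i
    proof -
      have "L * (i + 1) \<le> L * K" using that by (intro mult_left_mono) auto
      then show "n i < 2 * (L * K)" using n(2)[of i] by (simp add: algebra_simps)
      show "n i \<ge> L * K" using n(1)[of i] by simp
      then show "n i \<ge> 1" using L(1) K by (metis le_trans mult_le_mono nat_mult_1)
    qed
    have osc: "(norm (cis (of_int (int (q * n i)) * h) - 1))\<^sup>2 \<ge> w" if "i < K" for i
    proof -
      define y where "y = of_int (int (q * n i)) * h"
      have y: "y = real (n i) / real (L * K)" using q by (simp add: y_def h)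
      have LK: "real (L * K) > 0" using L(1) K by simp
      have "real (L * K) \<le> real (n i)" "real (n i) \<le> 2 * real (L * K)"
        using nb[OF that] by (simp_all flip: of_nat_mult)
      then have "1 \<le> y" "y \<le> 2" using LK unfolding y by (simp_all only: pos_le_divide_eq pos_divide_le_eq mult_1)
      then have "cos y \<le> cos 1" using pi_gt3 by (intro cos_monotone_0_pi_le) auto
      moreover have "(norm (cis y - 1))\<^sup>2 = 2 - 2 * cos y"
        using sin_cos_squared_add[of y] unfolding cmod_power2 by (simp add: power2_diff)
      ultimately show ?thesis unfolding y_def[symmetric] w_def by simp
    qed
    have "2 * pi * (e\<^sup>2 * w * real (q * L)) * h = 2 * pi * (\<Sum>i<K. (e / real K)\<^sup>2 * w)"
      using K q L by (simp add: h power2_eq_square field_simps)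
    also have "\<dots> \<le> 2 * pi * (\<Sum>i<K. (norm (C (int (q * n i))))\<^sup>2 * (norm (cis (of_int (int (q * n i)) * h) - 1))\<^sup>2)"
      using nb n(3) e w K osc by (intro mult_left_mono sum_mono mult_mono power_mono Clow) (auto intro: less_imp_le)
    also have "\<dots> = 2 * pi * (\<Sum>m\<in>F. (norm (C m))\<^sup>2 * (norm (cis (of_int m * h) - 1))\<^sup>2)"
      unfolding F_def by (subst sum.reindex[OF inj]) simp
    also have "\<dots> \<le> integral {0..2 * pi} (\<lambda>x. ((norm (u (x + h)))\<^sup>2 - (norm (u x))\<^sup>2)\<^sup>2)"
      by (rule increments_bessel[OF S u b]) (use Clim n(3) nb in \<open>auto simp: F_def\<close>)
    finally show "2 * pi * (e\<^sup>2 * w * real (q * L)) * h \<le> integral {0..2 * pi} (\<lambda>x. ((norm (u (x + h)))\<^sup>2 - (norm (u x))\<^sup>2)\<^sup>2)" .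
  qed
qed

section \<open>Step functions with jumps on a grid\<close>

lemma finite_interval_minus_interior:
  fixes I :: "real set"
  assumes "is_interval I" "bounded I"
  shows "finite (I - interior I)"
proof (rule finite_subset)
  show "I - interior I \<subseteq> {Inf I, Sup I}"
  proof
    fix x assume x: "x \<in> I - interior I"
    then have ne: "I \<noteq> {}" and xI: "x \<in> I" by auto
    have bd: "bdd_below I" "bdd_above I" using assms(2) by (auto simp: bounded_imp_bdd_below bounded_imp_bdd_above)
    have le: "Inf I \<le> x" "x \<le> Sup I" using xI bd by (auto intro: cInf_lower cSup_upper)
    show "x \<in> {Inf I, Sup I}"
    proof (rule ccontr)
      assume "x \<notin> {Inf I, Sup I}"
      then have "Inf I < x" "x < Sup I" using le by auto
      then obtain y z where yz: "y \<in> I" "y < x" "z \<in> I" "x < z"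
        using cInf_less_iff[OF ne bd(1)] less_cSup_iff[OF ne bd(2)] by blast
      have "{y<..<z} \<subseteq> I"
        using assms(1) yz unfolding is_interval_1 by (meson greaterThanLessThan_iff less_imp_le subsetI)
      then have "{y<..<z} \<subseteq> interior I" by (rule interior_maximal) simp
      then show False using x yz by auto
    qed
  qed
qed simp

lemma common_denominator:
  assumes "finite Z" "\<And>z. z \<in> Z \<Longrightarrow> \<exists>q\<in>\<rat>. z = q * pi"
  shows "\<exists>q\<ge>(1::nat). \<forall>z\<in>Z. \<exists>n::int. z = 2 * pi / real q * of_int n"
  using assms
proof (induction rule: finite_induct)
  case empty then show ?case by (intro exI[of _ 1]) simp
next
  case (insert z Z)
  then obtain q where q: "q \<ge> 1" "\<forall>z\<in>Z. \<exists>n::int. z = 2 * pi / real q * of_int n" by auto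
  obtain r where r: "r \<in> \<rat>" "z = r * pi" using insert.prems by blast
  obtain a b :: int where ab: "b > 0" "r = of_int a / of_int b" using r(1) by (meson Rats_cases')
  define p where "p = 2 * nat b"
  have p: "p \<ge> 1" "real p = 2 * of_int b" using ab by (auto simp: p_def)
  have "\<exists>n::int. w = 2 * pi / real (q * p) * of_int n" if "w \<in> insert z Z" for w
  proof (cases "w = z")
    case True
    have "w = 2 * pi / real (q * p) * of_int (int q * a)"
      unfolding True r(2) ab(2) of_nat_mult p(2) using q(1) ab(1) by simp
    then show ?thesis by (rule exI)
  next
    case False
    then have "w \<in> Z" using that by simp
    from bspec[OF q(2) this] obtain n :: int where "w = 2 * pi / real q * of_int n" ..
    moreover have "2 * pi / (Q * P) * (P * N) = 2 * pi / Q * N" if "P \<noteq> 0" for Q P N :: real using that by simp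
    from this[of "real p" "real q" "of_int n"] p(1)
    have "2 * pi / real (q * p) * of_int (int p * n) = 2 * pi / real q * of_int n" by simp
    ultimately have "w = 2 * pi / real (q * p) * of_int (int p * n)" by simp
    then show ?thesis by (rule exI)
  qed
  moreover have "q * p \<ge> 1" using p(1) q(1) by simp
  ultimately show ?case by (intro exI[of _ "q * p"] conjI ballI)
qed

text \<open>
  The discontinuities in one period are end points of the finitely many intervals, so they have a
  common denominator. Between two grid points the function is continuous with finitely many values.
  Nonconstancy is visible on the open cells because the intervals have interior points, and so every
  value of the function is taken off the grid.
\<close>

lemma step_function_grid:
  fixes g :: "real \<Rightarrow> complex"
  assumes step: "step_function g" and nc: "\<not> g constant_on UNIV"
    and rat: "\<And>x. \<not> isCont g x \<Longrightarrow> \<exists>q\<in>\<rat>. x = q * pi"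
  obtains q G where "q \<ge> (1::nat)"
    "\<And>j x. j < q \<Longrightarrow> 2 * pi / real q * real j < x \<Longrightarrow> x < 2 * pi / real q * real (Suc j) \<Longrightarrow> g x = G j"
    "\<exists>i<q. \<exists>j<q. G i \<noteq> G j"
proof -
  obtain a P where per: "periodic_2pi g" and P: "finite P" "partition_on {a..<a + 2 * pi} P"
    "\<And>I. I \<in> P \<Longrightarrow> is_interval I \<and> interior I \<noteq> {} \<and> g constant_on I"
    using step unfolding step_function_def by blast
  interpret periodic_fun_simple g "2 * pi"
    using per by unfold_locales (simp add: periodic_2pi_def)
  have shift: "g (x + 2 * pi * of_int n) = g x" for x n using plus_of_int[of x n] by (simp add: mult.commute)
  have UP: "\<Union>P = {a..<a + 2 * pi}" using P(2) by (simp add: partition_on_def)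
  have bI: "bounded I" if "I \<in> P" for I
  proof (rule bounded_subset)
    have "I \<subseteq> {a..<a + 2 * pi}" using UP that by blast
    then show "I \<subseteq> {a..a + 2 * pi}" by auto
  qed simp
  have reduce: "\<exists>n::int. x + 2 * pi * of_int n \<in> {a..<a + 2 * pi}" for x
  proof -
    define m where "m = \<lfloor>(x - a) / (2 * pi)\<rfloor>"
    have "of_int m \<le> (x - a) / (2 * pi)" "(x - a) / (2 * pi) < of_int m + 1" unfolding m_def by linarith+
    then have "2 * pi * of_int m \<le> x - a" "x - a < 2 * pi * of_int m + 2 * pi"
      by (simp_all add: pos_le_divide_eq pos_divide_less_eq algebra_simps)
    then show ?thesis by (intro exI[of _ "- m"]) simp
  qed
  have cont_shift: "isCont g (x + 2 * pi * of_int n)" if "isCont g x" for x n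
  proof -
    have "isCont (\<lambda>y. g (y - 2 * pi * of_int n)) (x + 2 * pi * of_int n)"
      by (rule isCont_o2[where f="\<lambda>y. y - 2 * pi * of_int n"]) (use that in \<open>auto intro!: continuous_intros\<close>)
    moreover have "(\<lambda>y. g (y - 2 * pi * of_int n)) = g" using shift[of _ "- n"] by simp
    ultimately show ?thesis by simp
  qed
  define Z where "Z = {z \<in> {a..<a + 2 * pi}. \<not> isCont g z}"
  have "Z \<subseteq> (\<Union>I\<in>P. I - interior I)"
  proof
    fix z assume z: "z \<in> Z"
    then have "z \<in> \<Union>P" unfolding UP Z_def by simp
    then obtain I where I: "I \<in> P" "z \<in> I" by blast
    have "z \<notin> interior I"
    proof
      assume zi: "z \<in> interior I"
      obtain c where "\<And>x. x \<in> I \<Longrightarrow> g x = c" using P(3)[OF I(1)] by (auto simp: constant_on_def)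
      then have "continuous_on (interior I) g"
        by (subst continuous_on_cong[OF refl, of _ _ "\<lambda>_. c"]) (use interior_subset in auto)
      then show False using zi z by (simp add: continuous_on_eq_continuous_at Z_def)
    qed
    then show "z \<in> (\<Union>I\<in>P. I - interior I)" using I by blast
  qed
  moreover have "finite (\<Union>I\<in>P. I - interior I)"
    using P bI by (auto intro: finite_interval_minus_interior)
  ultimately have "finite Z" by (rule finite_subset)
  moreover have "\<exists>q\<in>\<rat>. z = q * pi" if "z \<in> Z" for z using that rat by (auto simp: Z_def)
  ultimately obtain q where q: "q \<ge> 1" "\<And>z. z \<in> Z \<Longrightarrow> \<exists>n::int. z = 2 * pi / real q * of_int n"
    using common_denominator by meson
  define d where "d = 2 * pi / real q"
  have d: "d > 0" "d * real q = 2 * pi" using q by (auto simp: d_def)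
  have range_finite: "finite (range g)"
  proof (rule finite_subset)
    show "range g \<subseteq> (\<Union>I\<in>P. g ` I)"
    proof
      fix y assume "y \<in> range g"
      then obtain x where "y = g x" by blast
      moreover obtain n :: int where "x + 2 * pi * of_int n \<in> {a..<a + 2 * pi}" using reduce by blast
      then have "x + 2 * pi * of_int n \<in> \<Union>P" unfolding UP .
      then obtain I where "I \<in> P" "x + 2 * pi * of_int n \<in> I" by blast
      ultimately show "y \<in> (\<Union>I\<in>P. g ` I)" using shift[of x n] by (intro UN_I[of I]) (auto simp: image_iff intro: bexI[of _ "x + 2 * pi * of_int n"])
    qed
    have "finite (g ` I)" if I: "I \<in> P" for I
    proof -
      obtain c where "\<And>x. x \<in> I \<Longrightarrow> g x = c" using P(3)[OF I] by (auto simp: constant_on_def)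
      then have "g ` I \<subseteq> {c}" by auto
      then show ?thesis by (rule finite_subset) simp
    qed
    then show "finite (\<Union>I\<in>P. g ` I)" using P(1) by blast
  qed
  have cell: "\<exists>c. \<forall>x. d * real j < x \<longrightarrow> x < d * real (Suc j) \<longrightarrow> g x = c" for j
  proof -
    have "isCont g x" if x: "x \<in> {d * real j<..<d * real (Suc j)}" for x
    proof (rule ccontr)
      assume nC: "\<not> isCont g x"
      obtain n :: int where n: "x + 2 * pi * of_int n \<in> {a..<a + 2 * pi}" using reduce by blast
      have "\<not> isCont g (x + 2 * pi * of_int n)" using cont_shift[of "x + 2 * pi * of_int n" "- n"] nC by auto
      then obtain l :: int where "x + 2 * pi * of_int n = d * of_int l" using n q(2) unfolding Z_def d_def by blast
      then have "x = d * of_int l - (d * real q) * of_int n" unfolding d(2) by simp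
      moreover define M where "M = l - int q * n"
      ultimately have "x = d * of_int M" unfolding M_def by (simp add: algebra_simps)
      then have "real j < of_int M" "of_int M < real (Suc j)" using x d(1) by auto
      then have "(of_int (int j) :: real) < of_int M" "(of_int M :: real) < of_int (int (Suc j))" by simp_all
      then have "int j < M" "M < int (Suc j)" unfolding of_int_less_iff .
      then show False by simp
    qed
    then have "continuous_on {d * real j<..<d * real (Suc j)} g" by (simp add: continuous_at_imp_continuous_on)
    moreover have "finite (g ` {d * real j<..<d * real (Suc j)})" using range_finite by (rule finite_subset[rotated]) auto
    ultimately have "g constant_on {d * real j<..<d * real (Suc j)}" by (intro continuous_finite_range_constant) auto
    then show ?thesis by (auto simp: constant_on_def)
  qed
  define G where "G j = (SOME c. \<forall>x. d * real j < x \<longrightarrow> x < d * real (Suc j) \<longrightarrow> g x = c)" for j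
  have G: "g x = G j" if "d * real j < x" "x < d * real (Suc j)" for j x
    using someI_ex[OF cell[of j], folded G_def] that by blast
  have "\<exists>i<q. \<exists>j<q. G i \<noteq> G j"
  proof (rule ccontr)
    assume nex: "\<not> ?thesis"
    have eq: "G j = G 0" if "j < q" for j
    proof (rule ccontr)
      assume "G j \<noteq> G 0"
      then have "\<exists>i<q. \<exists>j<q. G i \<noteq> G j"
        using that q(1) by (intro exI[of _ j] exI[of _ 0] conjI) simp_all
      then show False using nex by (rule notE[rotated])
    qed
    have "g x = G 0" for x
    proof -
      obtain n :: int where n: "x + 2 * pi * of_int n \<in> {a..<a + 2 * pi}" using reduce by blast
      then have "x + 2 * pi * of_int n \<in> \<Union>P" unfolding UP .
      then obtain I where I: "I \<in> P" "x + 2 * pi * of_int n \<in> I" by blast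
      obtain u where "u \<in> interior I" using P(3)[OF I(1)] by blast
      then obtain e where e: "e > 0" "ball u e \<subseteq> I" by (meson mem_interior)
      \<comment> \<open>a point of the interval off the grid\<close>
      have "uncountable {u<..<u + e}" using e by (simp add: uncountable_open_interval)
      moreover have "countable (range (\<lambda>n::int. d * of_int n))" by blast
      ultimately obtain y where y: "y \<in> {u<..<u + e}" "y \<notin> range (\<lambda>n::int. d * of_int n)"
        by (meson countable_subset subsetI)
      have "y \<in> I" using e y(1) by (auto simp: subset_iff dist_real_def)
      then have "g (x + 2 * pi * of_int n) = g y" using P(3)[OF I(1)] I(2) by (auto simp: constant_on_def)
      define l where "l = \<lfloor>y / d\<rfloor>"
      have "of_int l \<le> y / d" "y / d < of_int l + 1" unfolding l_def by linarith+
      then have l: "d * of_int l \<le> y" "y < d * of_int l + d"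
        using d(1) by (simp_all add: pos_le_divide_eq pos_divide_less_eq algebra_simps)
      have l': "d * of_int l < y" using l(1) y(2) by (metis less_eq_real_def rangeI)
      define j where "j = nat (l mod int q)"
      have j: "j < q" "l = int j + int q * (l div int q)" using q(1) by (simp_all add: j_def nat_less_iff)
      have "d * of_int l = d * real j + 2 * pi * of_int (l div int q)"
        by (subst j(2)) (simp add: distrib_left d(2)[symmetric] mult.assoc)
      then have "g (y + 2 * pi * of_int (- (l div int q))) = G j"
        using l l' by (intro G) (simp_all add: distrib_left)
      then have "g y = G 0" unfolding shift using eq[OF j(1)] by simp
      then show ?thesis using \<open>g (x + 2 * pi * of_int n) = g y\<close> unfolding shift by simp
    qed
    then show False using nc by (auto simp: constant_on_def)
  qed
  then show thesis using that[of q G] q(1) G unfolding d_def by blast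
qed

text \<open>
  At \<open>j = 0\<close> the cell to the left is the last cell of the preceding period.
\<close>

definition cyclic_jump :: "(nat \<Rightarrow> complex) \<Rightarrow> nat \<Rightarrow> nat \<Rightarrow> complex" where
  "cyclic_jump G q j = G j - (if j = 0 then G (q - 1) else G (j - 1))"

lemma sum_cyclic_shift:
  fixes f :: "complex \<Rightarrow> nat \<Rightarrow> complex"
  assumes "q \<ge> 1" "E q = E (0::nat)"
  shows "(\<Sum>j<q. G j * E (Suc j)) = (\<Sum>j<q. (if j = 0 then G (q - 1) else G (j - 1)) * (E j :: complex))"
proof -
  obtain p where q: "q = Suc p" using assms(1) by (cases q) auto
  have "(\<Sum>j<q. (if j = 0 then G (q - 1) else G (j - 1)) * E j) = G (q - 1) * E 0 + (\<Sum>j<p. G j * E (Suc j))"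
    unfolding q by (subst sum.lessThan_Suc_shift) simp
  also have "\<dots> = (\<Sum>j<q. G j * E (Suc j))" unfolding q using assms(2) by (simp add: q)
  finally show ?thesis ..
qed

lemma sum_cyclic_jump: 
  assumes "q \<ge> 1" shows "(\<Sum>j<q. cyclic_jump G q j) = 0"
  using sum_cyclic_shift[of q "\<lambda>_. 1" G] assms by (simp add: cyclic_jump_def sum_subtractf)

lemma cyclic_jump_nonzero:
  assumes "\<exists>i<q. \<exists>j<q. G i \<noteq> G j"
  shows "\<exists>j<q. cyclic_jump G q j \<noteq> 0"
proof (rule ccontr)
  assume "\<not> ?thesis"
  then have z: "cyclic_jump G q j = 0" if "j < q" for j using that by blast
  have "G j = G 0" if "j < q" for j using that
  proof (induction j)
    case (Suc j) then show ?case using z[of "Suc j"] by (simp add: cyclic_jump_def)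
  qed simp
  then show False using assms by metis
qed

text \<open>
  The integrand differs from a sum of continuous pieces only at the grid points, which also settles
  its measurability. Integrating each piece and summing by parts around the circle produces the
  jumps.
\<close>

lemma fourier_coeff_grid:
  fixes g :: "real \<Rightarrow> complex"
  assumes q: "q \<ge> (1::nat)"
    and G: "\<And>j x. j < q \<Longrightarrow> 2 * pi / real q * real j < x \<Longrightarrow> x < 2 * pi / real q * real (Suc j) \<Longrightarrow> g x = G j"
    and k: "k \<noteq> 0"
  shows "fourier_coeff g k = jump_transform (cyclic_jump G q) q k / (2 * of_real pi * \<i> * of_int k)"
proof -
  define d where "d = 2 * pi / real q"
  have d: "d > 0" "d * real q = 2 * pi" using q by (auto simp: d_def)
  let ?I = "\<lambda>j. {d * real j..d * real (Suc j)}"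
  define E where "E j = cis (- of_int k * (d * real j))" for j :: nat
  have Eq: "E q = E 0"
    using cis_multiple_2pi[of "- of_int k"] by (simp add: E_def d(2) mult.commute)
  have expcis: "exp (- \<i> * of_int k * of_real x) = cis (- of_int k * x)" for x
    by (simp add: cis_conv_exp mult.assoc)
  have HI: "((\<lambda>x. cis (- of_int k * x)) has_integral (E j - E (Suc j)) / (\<i> * of_int k)) (?I j)" for j
  proof -
    have "((\<lambda>x. cis (- of_int k * x)) has_integral 
       cis (- of_int k * (d * real (Suc j))) / (- \<i> * of_int k) - cis (- of_int k * (d * real j)) / (- \<i> * of_int k)) (?I j)"
    proof (rule fundamental_theorem_of_calculus)
      show "d * real j \<le> d * real (Suc j)" using d(1) by (intro mult_left_mono) auto
      fix x assume "x \<in> ?I j"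
      have "((\<lambda>x. cis (- of_int k * x)) has_vector_derivative (- of_int k) *\<^sub>R (\<i> * cis (- of_int k * x))) (at x within ?I j)"
        unfolding has_vector_derivative_def
        by (auto intro!: derivative_eq_intros simp: algebra_simps scaleR_conv_of_real)
      then have "((\<lambda>x. cis (- of_int k * x) / (- \<i> * of_int k)) has_vector_derivative ((- of_int k) *\<^sub>R (\<i> * cis (- of_int k * x))) / (- \<i> * of_int k)) (at x within ?I j)"
        by (rule has_vector_derivative_divide)
      moreover have "((- of_int k) *\<^sub>R (\<i> * cis (- of_int k * x))) / (- \<i> * of_int k) = cis (- of_int k * x)"
        using k by (simp add: scaleR_conv_of_real)
      ultimately show "((\<lambda>x. cis (- of_int k * x) / (- \<i> * of_int k)) has_vector_derivative cis (- of_int k * x)) (at x within ?I j)"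
        by simp
    qed
    moreover have "cis (- of_int k * (d * real (Suc j))) / (- \<i> * of_int k) - cis (- of_int k * (d * real j)) / (- \<i> * of_int k) = (E j - E (Suc j)) / (\<i> * of_int k)"
      unfolding E_def by (simp add: diff_divide_distrib)
    ultimately show ?thesis by simp
  qed
  have si: "set_integrable lborel (?I j) (\<lambda>x. G j * cis (- of_int k * x))" for j
    by (intro borel_integrable_atLeastAtMost' continuous_intros)
  have LI: "(LINT x:?I j|lborel. G j * cis (- of_int k * x)) = G j * ((E j - E (Suc j)) / (\<i> * of_int k))" for j
    unfolding set_borel_integral_eq_integral(2)[OF si] by (intro integral_unique has_integral_mult_right HI)
  have "(LINT x:{0..2 * pi}|lborel. g x * exp (- \<i> * of_int k * of_real x))
      = (LINT x|lborel. (\<Sum>j<q. indicator (?I j) x *\<^sub>R (G j * cis (- of_int k * x))))"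
    unfolding set_lebesgue_integral_def
  proof (rule integral_discrete_difference[of "(\<lambda>j. d * real j) ` {..q}"])
    fix x assume x: "x \<notin> (\<lambda>j. d * real j) ` {..q}"
    show "indicator {0..2 * pi} x *\<^sub>R (g x * exp (- \<i> * of_int k * of_real x)) = (\<Sum>j<q. indicator (?I j) x *\<^sub>R (G j * cis (- of_int k * x)))"
    proof (cases "x \<in> {0..2 * pi}")
      case True
      define j where "j = nat \<lfloor>x / d\<rfloor>"
      have x0: "0 \<le> x / d" using True d(1) by simp
      then have "real j \<le> x / d" "x / d < real (Suc j)" unfolding j_def by linarith+
      then have j: "d * real j \<le> x" "x < d * real (Suc j)" using d(1) by (simp_all add: pos_le_divide_eq pos_divide_less_eq mult.commute)
      have "x \<noteq> d * real q" using x by auto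
      then have "x < d * real q" using True d(2) by simp
      then have "d * real j < d * real q" using j(1) by linarith
      then have jq: "j < q" using d(1) by simp
      then have "x \<noteq> d * real j" using x by auto
      then have j1: "d * real j < x" using j(1) by simp
      then have gx: "g x = G j" using G[OF jq] j(2) by (simp add: d_def)
      have "x \<in> ?I i \<longleftrightarrow> i = j" if "i < q" for i
      proof
        assume i: "x \<in> ?I i"
        then have "d * real i < d * real (Suc j)" using j by (meson atLeastAtMost_iff le_less_trans)
        moreover have "d * real j < d * real (Suc i)" using i j1 by (meson atLeastAtMost_iff less_le_trans)
        ultimately have "real i < real (Suc j)" "real j < real (Suc i)" using d(1) mult_less_cancel_left_pos by blast+
        then show "i = j" by simp
      qed (use j in auto)
      then have "(\<Sum>i<q. indicator (?I i) x *\<^sub>R (G i * cis (- of_int k * x))) = (\<Sum>i<q. if i = j then G j * cis (- of_int k * x) else 0)"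
        by (intro sum.cong) (auto simp: indicator_def)
      also have "\<dots> = G j * cis (- of_int k * x)" using jq by simp
      finally show ?thesis unfolding expcis gx using True by simp
    next
      case False
      have "x \<notin> ?I i" if i: "i < q" for i
      proof
        assume xi: "x \<in> ?I i"
        have "d * real (Suc i) \<le> d * real q" using i d(1) by (intro mult_left_mono) auto
        moreover have "0 \<le> d * real i" using d(1) by simp
        ultimately show False using False xi d(2) by auto
      qed
      then show ?thesis using False by simp
    qed
  qed auto
  also have "\<dots> = (\<Sum>j<q. (LINT x:?I j|lborel. G j * cis (- of_int k * x)))"
    unfolding set_lebesgue_integral_def using si unfolding set_integrable_def by (intro Bochner_Integration.integral_sum) auto
  also have "\<dots> = (\<Sum>j<q. G j * E j - G j * E (Suc j)) / (\<i> * of_int k)"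
    unfolding LI sum_divide_distrib by (intro sum.cong refl) (simp add: right_diff_distrib)
  also have "(\<Sum>j<q. G j * E j - G j * E (Suc j)) = (\<Sum>j<q. G j * E j) - (\<Sum>j<q. (if j = 0 then G (q - 1) else G (j - 1)) * E j)"
    unfolding sum_subtractf sum_cyclic_shift[of q E G, OF q Eq] ..
  also have "\<dots> = (\<Sum>j<q. cyclic_jump G q j * E j)"
    unfolding sum_subtractf[symmetric] cyclic_jump_def left_diff_distrib ..
  also have "\<dots> = jump_transform (cyclic_jump G q) q k"
    unfolding jump_transform_def E_def d_def ..
  finally show ?thesis unfolding fourier_coeff_def by simp
qed


section \<open>The evolution of a step function\<close>

text \<open>
  By Parseval's identity and uniform convergence, the square integral of \<open>u\<close> minus a finite part of
  its series is a constant minus the sum of the squared coefficients in that part. Along the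
  symmetric partial sums it tends to zero, and it decreases when the part grows; therefore it tends
  to zero along all finite sets of frequencies.
\<close>

lemma trig_series_L2_limit:
  fixes s :: "int \<Rightarrow> complex" and S :: "nat \<Rightarrow> real \<Rightarrow> complex"
  assumes S: "\<And>N x. S N x = (\<Sum>k\<in>{- int N..int N}. s k * cis (of_int k * x))"
    and u: "uniform_limit UNIV S u sequentially" and b: "bounded (range u)"
  shows "((\<lambda>K. integral {0..2 * pi} (\<lambda>x. (norm (u x - (\<Sum>k\<in>K. s k * cis (of_int k * x))))\<^sup>2)) \<longlongrightarrow> 0) (finite_subsets_at_top UNIV)"
proof -
  define SK where "SK K x = (\<Sum>k\<in>K. s k * cis (of_int k * x))" for K x
  define W where "W K = (\<Sum>k\<in>K. (norm (s k))\<^sup>2)" for K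
  have lim: "(\<lambda>N. 2 * pi * (W {- int N..int N} - W K)) \<longlonglongrightarrow> integral {0..2 * pi} (\<lambda>x. (norm (u x - SK K x))\<^sup>2)" if K: "finite K" for K
  proof -
    have "uniform_limit {0..2*pi} (\<lambda>N x. S N x - SK K x) (\<lambda>x. u x - SK K x) sequentially"
      by (intro uniform_limit_minus uniform_limit_on_subset[OF u] uniform_limit_const) auto
    moreover have "bounded ((\<lambda>x. u x - SK K x) ` {0..2 * pi})"
    proof -
      obtain B where B: "\<And>x. norm (u x) \<le> B" using b by (auto simp: bounded_iff)
      have "norm (u x - SK K x) \<le> B + (\<Sum>k\<in>K. norm (s k))" for x
        unfolding SK_def by (intro order_trans[OF norm_triangle_ineq4] add_mono B sum_norm_le) (simp add: norm_mult)
      then show ?thesis unfolding bounded_iff by blast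
    qed
    ultimately have "uniform_limit {0..2*pi} (\<lambda>N x. (norm (S N x - SK K x))\<^sup>2) (\<lambda>x. (norm (u x - SK K x))\<^sup>2) sequentially"
      by (rule uniform_limit_norm_square)
    moreover have "continuous_on {0..2*pi} (\<lambda>x. (norm (S N x - SK K x))\<^sup>2)" for N
      unfolding S SK_def by (intro continuous_intros)
    ultimately have "(\<lambda>N. integral {0..2*pi} (\<lambda>x. (norm (S N x - SK K x))\<^sup>2)) \<longlonglongrightarrow> integral {0..2 * pi} (\<lambda>x. (norm (u x - SK K x))\<^sup>2)"
      by (rule integral_uniform_limit_tendsto)
    moreover have "\<exists>N0::nat. K \<subseteq> {- int N0..int N0}"
    proof (intro exI subsetI)
      fix m assume "m \<in> K"
      then have "\<bar>m\<bar> \<le> (\<Sum>m\<in>K. \<bar>m\<bar>)" using K by (intro member_le_sum) auto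
      then show "m \<in> {- int (nat (\<Sum>m\<in>K. \<bar>m\<bar>))..int (nat (\<Sum>m\<in>K. \<bar>m\<bar>))}" by auto
    qed
    then obtain N0 :: nat where N0: "K \<subseteq> {- int N0..int N0}" by blast
    have "integral {0..2*pi} (\<lambda>x. (norm (S N x - SK K x))\<^sup>2) = 2 * pi * (W {- int N..int N} - W K)" if "N \<ge> N0" for N
    proof -
      have sub: "K \<subseteq> {- int N..int N}" using N0 that by fastforce
      have "S N x - SK K x = (\<Sum>k\<in>{- int N..int N} - K. s k * cis (of_int k * x))" for x
        unfolding S SK_def using sub by (simp add: sum_diff)
      moreover have "W {- int N..int N} - W K = (\<Sum>k\<in>{- int N..int N} - K. (norm (s k))\<^sup>2)"
        unfolding W_def using sub by (simp add: sum_diff)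
      ultimately show ?thesis
        using integral_unique[OF trig_parseval[of "{- int N..int N} - K" s]] by simp
    qed
    ultimately show ?thesis
      by (rule_tac Lim_transform_eventually) (auto intro!: eventually_sequentiallyI[of N0])
  qed
  define T where "T = integral {0..2 * pi} (\<lambda>x. (norm (u x - SK {} x))\<^sup>2)"
  have T: "(\<lambda>N. 2 * pi * W {- int N..int N}) \<longlonglongrightarrow> T" using lim[of "{}"] by (simp add: T_def W_def)
  have eq: "integral {0..2 * pi} (\<lambda>x. (norm (u x - SK K x))\<^sup>2) = T - 2 * pi * W K" if "finite K" for K
  proof (rule LIMSEQ_unique[OF lim[OF that]])
    show "(\<lambda>N. 2 * pi * (W {- int N..int N} - W K)) \<longlonglongrightarrow> T - 2 * pi * W K"
      using tendsto_diff[OF T tendsto_const[of "2 * pi * W K"]] by (simp add: right_diff_distrib)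
  qed
  have nn: "integral {0..2 * pi} (\<lambda>x. (norm (u x - SK K x))\<^sup>2) \<ge> 0" if "finite K" for K
    by (cases "(\<lambda>x. (norm (u x - SK K x))\<^sup>2) integrable_on {0..2 * pi}")
      (auto intro: integral_nonneg simp: not_integrable_integral)
  show ?thesis unfolding SK_def[symmetric]
  proof (rule tendstoI)
    fix e :: real assume "e > 0"
    have "\<forall>\<^sub>F N in sequentially. T - e < 2 * pi * W {- int N..int N}"
      using order_tendstoD(1)[OF T, of "T - e"] \<open>e > 0\<close> by simp
    then obtain N where N: "T - e < 2 * pi * W {- int N..int N}" by (auto simp: eventually_sequentially)
    have "dist (integral {0..2 * pi} (\<lambda>x. (norm (u x - SK K x))\<^sup>2)) 0 < e" if K: "finite K" "{- int N..int N} \<subseteq> K" for K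
    proof -
      have "W {- int N..int N} \<le> W K" unfolding W_def using K by (intro sum_mono2) auto
      then have "2 * pi * W {- int N..int N} \<le> 2 * pi * W K" by simp
      then have "integral {0..2 * pi} (\<lambda>x. (norm (u x - SK K x))\<^sup>2) < e" using eq[OF K(1)] N by linarith
      then show ?thesis using nn[OF K(1)] by simp
    qed
    then show "\<forall>\<^sub>F K in finite_subsets_at_top UNIV. dist (integral {0..2 * pi} (\<lambda>x. (norm (u x - SK K x))\<^sup>2)) 0 < e"
      unfolding eventually_finite_subsets_at_top by (intro exI[of _ "{- int N..int N}"]) auto
  qed
qed

lemma schrodinger_evolutionI:
  fixes g :: "real \<Rightarrow> complex" and t :: real
  defines "s \<equiv> \<lambda>k. cis (- (of_int k)\<^sup>2 * t) * fourier_coeff g k"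
  assumes S: "\<And>N x. S N x = (\<Sum>k\<in>{- int N..int N}. s k * cis (of_int k * x))"
    and u: "uniform_limit UNIV S u sequentially" and b: "bounded (range u)" and c: "continuous_on UNIV u"
  shows "schrodinger_evolution g t u"
proof -
  have lim: "(\<lambda>N. S N x) \<longlonglongrightarrow> u x" for x using u by (rule tendsto_uniform_limitI) simp
  have "cis (of_int k * (x + 2 * pi)) = cis (of_int k * x)" for k :: int and x
    using cis_multiple_2pi[of "of_int k"] by (simp add: distrib_left mult.commute flip: cis_mult)
  then have "S N (x + 2 * pi) = S N x" for N x by (simp add: S)
  then have "u (x + 2 * pi) = u x" for x using LIMSEQ_unique[OF lim[of "x + 2 * pi"]] lim[of x] by simp
  then have 1: "periodic_2pi u" by (simp add: periodic_2pi_def)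
  have 2: "u \<in> borel_measurable borel" using c by (rule borel_measurable_continuous_onI)
  have 3: "set_integrable lborel {0..2 * pi} (\<lambda>x. (cmod (u x))\<^sup>2)"
    by (intro borel_integrable_atLeastAtMost' continuous_intros continuous_on_subset[OF c]) auto
  have e: "exp (- \<i> * of_real t * (of_int k)\<^sup>2 + \<i> * of_int k * of_real x) * fourier_coeff g k = s k * cis (of_int k * x)" for k x
  proof -
    have "exp (- \<i> * of_real t * (of_int k)\<^sup>2 + \<i> * of_int k * of_real x) = cis (- (of_int k)\<^sup>2 * t) * cis (of_int k * x)"
      unfolding cis_mult by (simp add: cis_conv_exp algebra_simps)
    then show ?thesis by (simp add: s_def)
  qed
  have si: "set_integrable lborel {0..2 * pi} (\<lambda>x. (cmod (u x - (\<Sum>k\<in>K. s k * cis (of_int k * x))))\<^sup>2)" for K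
    by (intro borel_integrable_atLeastAtMost' continuous_intros continuous_on_subset[OF c]) auto
  show ?thesis unfolding schrodinger_evolution_def e set_borel_integral_eq_integral(2)[OF si]
    using 1 2 3 trig_series_L2_limit[OF S u b] by blast
qed

text \<open>
  Pairing \<open>k\<close> with \<open>- k\<close> reflects the series, with the opposite sign because of the denominator
  \<open>k\<close>.
\<close>

lemma evolved_sum_eq_weyl_series:
  "(\<Sum>k\<in>{- int N..int N}. evolved_coeff J q a0 t k * cis (of_int k * x)) =
    a0 + (\<Sum>j<q. J j * (weyl_series t N (x - 2 * pi / real q * real j) - weyl_series t N (- (x - 2 * pi / real q * real j)))) / (2 * of_real pi * \<i>)"
proof -
  define d where "d = 2 * pi / real q"
  define e where "e k y = cis (real k * y - (real k)\<^sup>2 * t) / of_nat k" for k :: nat and y :: real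
  have main: "evolved_coeff J q a0 t (int k) * cis (of_int (int k) * x) + evolved_coeff J q a0 t (- int k) * cis (of_int (- int k) * x)
     = (\<Sum>j<q. J j * (e k (x - d * real j) - e k (- (x - d * real j)))) / (2 * of_real pi * \<i>)"
    if k: "k \<ge> 1" for k
  proof -
    have p: "cis (- (of_int l)\<^sup>2 * t) * jump_transform J q l * cis (of_int l * x) = (\<Sum>j<q. J j * cis (of_int l * (x - d * real j) - (of_int l)\<^sup>2 * t))" for l
    proof -
      have eq: "cis (- (of_int l)\<^sup>2 * t) * (J j * cis (- of_int l * (d * real j))) * cis (of_int l * x) = J j * cis (of_int l * (x - d * real j) - (of_int l)\<^sup>2 * t)" for j
      proof -
        have "cis (- (of_int l)\<^sup>2 * t) * cis (- of_int l * (d * real j)) * cis (of_int l * x) = cis (of_int l * (x - d * real j) - (of_int l)\<^sup>2 * t)"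
          unfolding cis_mult by (simp add: algebra_simps)
        then show ?thesis by (simp add: mult_ac)
      qed
      show ?thesis unfolding jump_transform_def d_def[symmetric] sum_distrib_left sum_distrib_right
        by (intro sum.cong refl eq)
    qed
    have "evolved_coeff J q a0 t (int k) * cis (of_int (int k) * x)
       = (cis (- (of_int (int k))\<^sup>2 * t) * jump_transform J q (int k) * cis (of_int (int k) * x)) / of_nat k / (2 * of_real pi * \<i>)"
      using k by (simp add: evolved_coeff_def step_coeff_def)
    moreover have "evolved_coeff J q a0 t (- int k) * cis (of_int (- int k) * x)
       = - ((cis (- (of_int (- int k))\<^sup>2 * t) * jump_transform J q (- int k) * cis (of_int (- int k) * x)) / of_nat k / (2 * of_real pi * \<i>))"
      using k by (simp add: evolved_coeff_def step_coeff_def)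
    ultimately show ?thesis unfolding p e_def
      by (simp add: sum_divide_distrib sum_subtractf right_diff_distrib diff_divide_distrib)
  qed
  have "(\<Sum>k\<in>{- int N..int N}. evolved_coeff J q a0 t k * cis (of_int k * x))
     = a0 + (\<Sum>k\<in>{1..N}. (\<Sum>j<q. J j * (e k (x - d * real j) - e k (- (x - d * real j)))) / (2 * of_real pi * \<i>))"
    unfolding sum_symmetric_int
  proof (rule arg_cong2[of _ _ _ _ "(+)"])
    show "evolved_coeff J q a0 t 0 * cis (of_int 0 * x) = a0" by (simp add: evolved_coeff_def step_coeff_def)
  qed (rule sum.cong[OF refl], rule main, simp)
  also have "(\<Sum>k\<in>{1..N}. (\<Sum>j<q. J j * (e k (x - d * real j) - e k (- (x - d * real j)))) / (2 * of_real pi * \<i>))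
     = (\<Sum>j<q. J j * (weyl_series t N (x - d * real j) - weyl_series t N (- (x - d * real j)))) / (2 * of_real pi * \<i>)"
    unfolding sum_divide_distrib[symmetric] weyl_series_def e_def[symmetric] sum_subtractf[symmetric] sum_distrib_left
    by (subst sum.swap) (rule refl)
  finally show ?thesis unfolding d_def .
qed

definition evolved_limit :: "(nat \<Rightarrow> complex) \<Rightarrow> nat \<Rightarrow> complex \<Rightarrow> real \<Rightarrow> real \<Rightarrow> complex" where
  "evolved_limit J q a0 t x =
    a0 + (\<Sum>j<q. J j * (weyl_limit t (x - 2 * pi / real q * real j) - weyl_limit t (- (x - 2 * pi / real q * real j)))) / (2 * of_real pi * \<i>)"

text \<open>
  One estimate serves uniform convergence (\<open>x = y\<close>), Hoelder continuity (\<open>f = f'\<close>) and boundedness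
  (\<open>f' = 0\<close>).
\<close>

lemma evolved_limit_diff_le:
  "norm ((a0 + (\<Sum>j<q. J j * (f (x - d * real j) - f (- (x - d * real j)))) / (2 * of_real pi * \<i>)) -
      (a0 + (\<Sum>j<q. J j * (f' (y - d * real j) - f' (- (y - d * real j)))) / (2 * of_real pi * \<i>)))
    \<le> (\<Sum>j<q. norm (J j) * (norm (f (x - d * real j) - f' (y - d * real j)) + norm (f (- (x - d * real j)) - f' (- (y - d * real j)))))"
  (is "norm ?D \<le> ?R")
proof -
  have "?D = (\<Sum>j<q. J j * ((f (x - d * real j) - f' (y - d * real j)) - (f (- (x - d * real j)) - f' (- (y - d * real j))))) / (2 * of_real pi * \<i>)"
    unfolding add_diff_cancel_left diff_divide_distrib[symmetric] sum_subtractf[symmetric] 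
    by (intro arg_cong2[of _ _ _ _ "(/)"] sum.cong refl) (simp add: algebra_simps)
  then have "norm ?D = norm (\<Sum>j<q. J j * ((f (x - d * real j) - f' (y - d * real j)) - (f (- (x - d * real j)) - f' (- (y - d * real j))))) / (2 * pi)"
    by (simp add: norm_divide norm_mult)
  also have "\<dots> \<le> ?R / (2 * pi)"
    by (intro divide_right_mono sum_norm_le) (auto simp: norm_mult intro!: mult_left_mono norm_triangle_ineq4)
  also have "\<dots> \<le> ?R / 1" using pi_gt3 by (intro divide_left_mono sum_nonneg) auto
  finally show ?thesis by simp
qed

lemma evolved_limit_uniform:
  assumes "weyl_bounded t" and S: "\<And>N x. S N x = (\<Sum>k\<in>{- int N..int N}. evolved_coeff J q a0 t k * cis (of_int k * x))"
  shows "uniform_limit UNIV S (evolved_limit J q a0 t) sequentially"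
proof (rule uniform_limitI)
  fix e :: real assume e: "e > 0"
  \<comment> \<open>the added 1 keeps \<open>A\<close> positive\<close>
  define A where "A = 2 * (\<Sum>j<q. norm (J j)) + 1"
  have A: "A > 0" unfolding A_def by (intro add_nonneg_pos mult_nonneg_nonneg sum_nonneg) auto
  have "\<forall>\<^sub>F N in sequentially. \<forall>x\<in>UNIV. dist (weyl_series t N x) (weyl_limit t x) < e / A"
    using weyl_series_uniform_limit[OF assms(1)] e A unfolding uniform_limit_iff by (meson divide_pos_pos)
  then show "\<forall>\<^sub>F N in sequentially. \<forall>x\<in>UNIV. dist (S N x) (evolved_limit J q a0 t x) < e"
  proof eventually_elim
    case (elim N)
    then have *: "norm (weyl_series t N x - weyl_limit t x) \<le> e / A" for x by (simp add: dist_norm less_imp_le)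
    show ?case
    proof
      fix x
      have "dist (S N x) (evolved_limit J q a0 t x) \<le> (\<Sum>j<q. norm (J j) * (e / A + e / A))"
        unfolding dist_norm S evolved_sum_eq_weyl_series evolved_limit_def
        by (rule order_trans[OF evolved_limit_diff_le]) (intro sum_mono mult_left_mono add_mono *, auto)
      also have "\<dots> = (A - 1) * (e / A)"
        unfolding sum_distrib_right[symmetric] by (simp add: A_def)
      also have "\<dots> < A * (e / A)" using e A by (intro mult_strict_right_mono) auto
      finally show "dist (S N x) (evolved_limit J q a0 t x) < e" using A by simp
    qed
  qed
qed

lemma evolved_limit_holder:
  assumes "weyl_bounded t" shows "holder_below_half (evolved_limit J q a0 t)"
  unfolding holder_below_half_def
proof (intro allI impI)
  fix a :: real assume a: "0 < a" "a < 1 / 2"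
  obtain C where C: "C \<ge> 0" "\<And>x y. \<bar>x - y\<bar> \<le> 1 \<Longrightarrow> norm (weyl_limit t x - weyl_limit t y) \<le> C * \<bar>x - y\<bar> powr a"
    by (rule holder_below_halfE[OF weyl_limit_holder[OF assms] a]) blast
  have "norm (evolved_limit J q a0 t x - evolved_limit J q a0 t y) \<le> (2 * C * (\<Sum>j<q. norm (J j))) * \<bar>x - y\<bar> powr a"
    if xy: "\<bar>x - y\<bar> \<le> 1" for x y
  proof -
    have "norm (evolved_limit J q a0 t x - evolved_limit J q a0 t y) \<le> (\<Sum>j<q. norm (J j) * (C * \<bar>x - y\<bar> powr a + C * \<bar>x - y\<bar> powr a))"
      unfolding evolved_limit_def
    proof (rule order_trans[OF evolved_limit_diff_le], intro sum_mono mult_left_mono add_mono)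
      fix j
      show "norm (weyl_limit t (x - 2 * pi / real q * real j) - weyl_limit t (y - 2 * pi / real q * real j)) \<le> C * \<bar>x - y\<bar> powr a"
        using C(2)[of "x - 2 * pi / real q * real j" "y - 2 * pi / real q * real j"] xy by simp
      show "norm (weyl_limit t (- (x - 2 * pi / real q * real j)) - weyl_limit t (- (y - 2 * pi / real q * real j))) \<le> C * \<bar>x - y\<bar> powr a"
        using C(2)[of "- (x - 2 * pi / real q * real j)" "- (y - 2 * pi / real q * real j)"] xy by (simp add: abs_minus_commute)
    qed auto
    also have "\<dots> = (2 * C * (\<Sum>j<q. norm (J j))) * \<bar>x - y\<bar> powr a"
      unfolding sum_distrib_right[symmetric] by (simp add: algebra_simps)
    finally show ?thesis .
  qed
  then show "\<exists>C. \<forall>x y. \<bar>x - y\<bar> \<le> 1 \<longrightarrow> norm (evolved_limit J q a0 t x - evolved_limit J q a0 t y) \<le> C * \<bar>x - y\<bar> powr a" by blast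
qed

lemma evolved_limit_bounded:
  assumes "weyl_bounded t" shows "bounded (range (evolved_limit J q a0 t))"
proof -
  obtain B where B: "\<And>x. norm (weyl_limit t x) \<le> B" using weyl_limit_bounded[OF assms] by blast
  have "norm (evolved_limit J q a0 t x) \<le> norm a0 + (\<Sum>j<q. norm (J j) * (B + B))" for x
  proof -
    have "norm (evolved_limit J q a0 t x - a0) \<le>
      (\<Sum>j<q. norm (J j) * (norm (weyl_limit t (x - 2 * pi / real q * real j)) + norm (weyl_limit t (- (x - 2 * pi / real q * real j)))))"
      using evolved_limit_diff_le[where f="weyl_limit t" and f'="\<lambda>_. 0" and d="2 * pi / real q"]
      unfolding evolved_limit_def by simp
    also have "\<dots> \<le> (\<Sum>j<q. norm (J j) * (B + B))"
      by (intro sum_mono mult_left_mono add_mono B) auto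
    finally have "norm (evolved_limit J q a0 t x - a0) \<le> (\<Sum>j<q. norm (J j) * (B + B))" .
    then show ?thesis using norm_triangle_ineq2[of "evolved_limit J q a0 t x" a0] by linarith
  qed
  then show ?thesis by (auto simp: bounded_iff)
qed


section \<open>Dimension of the graphs\<close>

lemma holder_below_half_of_le:
  fixes u :: "real \<Rightarrow> 'a::real_normed_vector" and v :: "real \<Rightarrow> 'b::real_normed_vector"
  assumes u: "holder_below_half u" and B: "B \<ge> 0" and v: "\<And>x y. norm (v x - v y) \<le> B * norm (u x - u y)"
  shows "holder_below_half v"
  unfolding holder_below_half_def
proof (intro allI impI)
  fix a :: real assume a: "0 < a" "a < 1 / 2"
  obtain C where C: "\<And>x y. \<bar>x - y\<bar> \<le> 1 \<Longrightarrow> norm (u x - u y) \<le> C * \<bar>x - y\<bar> powr a"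
    by (rule holder_below_halfE[OF u a]) blast
  have "norm (v x - v y) \<le> (B * C) * \<bar>x - y\<bar> powr a" if "\<bar>x - y\<bar> \<le> 1" for x y
    using order_trans[OF v mult_left_mono[OF C[OF that] B]] by (simp add: mult.assoc)
  then show "\<exists>C. \<forall>x y. \<bar>x - y\<bar> \<le> 1 \<longrightarrow> norm (v x - v y) \<le> C * \<bar>x - y\<bar> powr a" by blast
qed


theorem theorem3p10:
  fixes g :: "real \<Rightarrow> complex"
  assumes "step_function g"
    and "\<not> g constant_on UNIV"
    and "\<And>x. \<not> isCont g x \<Longrightarrow> \<exists>q\<in>\<rat>. x = q * pi"
  shows "AE t in lborel. \<exists>u. schrodinger_evolution g t u \<and> continuous_on UNIV u \<and>
           upper_minkowski_dim (period_graph (\<lambda>x. (cmod (u x))\<^sup>2)) = 3 / 2 \<and>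
           upper_minkowski_dim (period_graph (\<lambda>x. cmod (u x))) = 3 / 2"
proof -
  obtain q G where q: "q \<ge> (1::nat)"
    and G: "\<And>j x. j < q \<Longrightarrow> 2 * pi / real q * real j < x \<Longrightarrow> x < 2 * pi / real q * real (Suc j) \<Longrightarrow> g x = G j"
    and nc: "\<exists>i<q. \<exists>j<q. G i \<noteq> G j"
    by (rule step_function_grid[OF assms]) (assumption, rule that)
  define J where "J = cyclic_jump G q"
  have J0: "(\<Sum>j<q. J j) = 0" unfolding J_def by (rule sum_cyclic_jump[OF q])
  have Jn: "\<exists>j<q. J j \<noteq> 0" unfolding J_def by (rule cyclic_jump_nonzero[OF nc])
  define a0 where "a0 = fourier_coeff g 0"
  have fc: "fourier_coeff g k = step_coeff J q a0 k" for k
    using fourier_coeff_grid[of q g G k, OF q G] by (simp add: step_coeff_def a0_def J_def)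
  show ?thesis using AE_weyl_bounded AE_irrational_multiple_pi
  proof eventually_elim
    case (elim t)
    define S where "S N x = (\<Sum>k\<in>{- int N..int N}. evolved_coeff J q a0 t k * cis (of_int k * x))" for N x
    define u where "u = evolved_limit J q a0 t"
    have ul: "uniform_limit UNIV S u sequentially" unfolding u_def by (rule evolved_limit_uniform[OF elim(1) S_def])
    have hu: "holder_below_half u" unfolding u_def by (rule evolved_limit_holder[OF elim(1)])
    have bu: "bounded (range u)" unfolding u_def by (rule evolved_limit_bounded[OF elim(1)])
    have cu: "continuous_on UNIV u" using hu by (rule holder_below_half_continuous)
    have ev: "schrodinger_evolution g t u"
    proof (rule schrodinger_evolutionI[OF _ ul bu cu])
      show "S N x = (\<Sum>k\<in>{- int N..int N}. (cis (- (of_int k)\<^sup>2 * t) * fourier_coeff g k) * cis (of_int k * x))" for N x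
        unfolding S_def evolved_coeff_def fc ..
    qed
    obtain \<kappa> M0 where low: "\<kappa> > 0" "M0 \<ge> (1::nat)"
      "\<And>K h. K \<ge> (1::nat) \<Longrightarrow> h = 1 / (real M0 * real K) \<Longrightarrow>
        \<kappa> * h \<le> integral {0..2 * pi} (\<lambda>x. ((norm (u (x + h)))\<^sup>2 - (norm (u x))\<^sup>2)\<^sup>2)"
      by (rule increments_lower_bound[OF elim(2) q J0 Jn S_def ul bu]) blast
    obtain B where B: "\<And>x. norm (u x) \<le> B" using bu by (auto simp: bounded_iff)
    have B0: "B \<ge> 0" using order_trans[OF norm_ge_zero B] .
    have sq: "\<bar>(norm (u x))\<^sup>2 - (norm (u y))\<^sup>2\<bar> \<le> (2 * B) * \<bar>norm (u x) - norm (u y)\<bar>" for x y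
    proof -
      have "\<bar>(norm (u x))\<^sup>2 - (norm (u y))\<^sup>2\<bar> = (norm (u x) + norm (u y)) * \<bar>norm (u x) - norm (u y)\<bar>"
        by (simp add: square_diff_square_factored power2_eq_square abs_mult)
      also have "\<dots> \<le> (2 * B) * \<bar>norm (u x) - norm (u y)\<bar>"
        using add_mono[OF B[of x] B[of y]] by (intro mult_right_mono) auto
      finally show ?thesis .
    qed
    have hv: "holder_below_half (\<lambda>x. cmod (u x))"
      by (rule holder_below_half_of_le[OF hu, of 1]) (auto intro: norm_triangle_ineq3)
    have hf: "holder_below_half (\<lambda>x. (cmod (u x))\<^sup>2)"
      by (rule holder_below_half_of_le[OF hv, of "2 * B"]) (use B0 sq in auto)
    have "upper_minkowski_dim (period_graph (\<lambda>x. (cmod (u x))\<^sup>2)) \<ge> 3 / 2"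
      by (rule upper_dim_ge_of_increments[OF hf _ low(1,2), of "\<lambda>x. (cmod (u x))\<^sup>2" 1]) (use low(3) in auto)
    moreover have "upper_minkowski_dim (period_graph (\<lambda>x. cmod (u x))) \<ge> 3 / 2"
      by (rule upper_dim_ge_of_increments[OF hv sq low(1,2)]) (use low(3) in auto)
    ultimately show ?case
      using ev cu upper_dim_holder_le[OF hf] upper_dim_holder_le[OF hv] by (meson order_antisym)
  qed
qed

end
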